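(* There exist constants $c_3,c_5>0$ depending only on $n$ such that the following holds. Let $\epsilon\in(0,1)$ and $M\ge1$. Let $V_0,W_0\in V_d(\mathbb{R}^n)$ with $\|V_0\|(\mathbb{R}^n)\le M$ and $\|W_0\|(\mathbb{R}^n)\le M$. Let $\mathcal{T}=\{t_i\}_{i=0}^m$ be a subdivision of $[0,1]$ satisfying $c_3\,\delta(\mathcal{T})\le(M+1)^{-3}\epsilon^8$. Let $V_{\epsilon,\mathcal{T}}(t)$ (resp. $W_{\epsilon,\mathcal{T}}(t)$) be the time-discrete approximate mean curvature flow with respect to $\mathcal{T}$ starting from $V_0$ (resp. $W_0$). Then, for any $t\in[0,1]$, $$\Delta\big(V_{\epsilon,\mathcal{T}}(t),W_{\epsilon,\mathcal{T}}(t)\big)\le\exp\big(c_{5,M}\,t\,\epsilon^{-n-7}\big)\,\Delta(V_0,W_0),\qquad c_{5,M}=c_5(M+1)^2.$$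
   Context: Let $n\ge 2$, $1\le d\le n$. $G_{d,n}$ is the Grassmannian of $d$-dimensional linear subspaces of $\mathbb{R}^n$; $S\in G_{d,n}$ is identified with the orthogonal projection matrix onto $S$, the distance on $G_{d,n}$ is $\|S-T\|$ (operator norm), and $\mathbb{R}^n\times G_{d,n}$ carries the metric $|x-y|+\|S-T\|$. A $d$-varifold is a nonnegative Radon measure on $\mathbb{R}^n\times G_{d,n}$; $V_d(\mathbb{R}^n)$ is the set of $d$-varifolds; $\|V\|(A)=V(A\times G_{d,n})$. The bounded Lipschitz distance of finite Radon measures on a metric space $X$ is $\Delta(\mu,\nu)=\sup\{|\int\varphi\,d\mu-\int\varphi\,d\nu|:\varphi\in C^0(X,\mathbb{R}_+),\ \max(\|\varphi\|_\infty,\mathrm{Lip}(\varphi))\le 1\}$. Push-forward: for a $C^1$ diffeomorphism $f$ of $\mathbb{R}^n$, $f_\#V(\varphi)=\int\varphi(f(x),Df(x)(S))\,J_Sf(x)\,dV(x,S)$, where $J_Sf(x)=\det(Y^tY)^{1/2}$, $Y=Df(x)(s_1|\dots|s_d)$ with $(s_i)$ an orthonormal basis of $S$. Kernel: $\psi\in C^\infty(\mathbb{R}^n)$ is a fixed radially symmetric function (depending only on $n$) with $0\le\psi\le1$, $\psi=1$ on $\{|x|\le 1/2\}$, $\psi=0$ on $\{|x|\ge1\}$, $|\nabla\psi|\le3$; $\Phi_\epsilon(x)=c(\epsilon)\psi(x)(2\pi\epsilon^2)^{-n/2}\exp(-|x|^2/(2\epsilon^2))$ with $c(\epsilon)$ such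 that $\int\Phi_\epsilon=1$. Approximate mean curvature: $h_\epsilon(\cdot,V)=\Phi_\epsilon*\tilde h_\epsilon(\cdot,V)$, $\tilde h_\epsilon(y,V)=-\dfrac{(\delta V*\Phi_\epsilon)(y)}{(\|V\|*\Phi_\epsilon)(y)+\epsilon}$, where $(\|V\|*\Phi_\epsilon)(y)=\int\Phi_\epsilon(x-y)\,d\|V\|(x)$, $(\delta V*\Phi_\epsilon)(y)=\int S(\nabla\Phi_\epsilon(x-y))\,dV(x,S)$. A subdivision $\mathcal{T}=\{t_i\}_{i=0}^m$ of $[0,1]$ satisfies $0=t_0<\dots<t_m=1$; $\delta(\mathcal{T})=\max_i(t_i-t_{i-1})$. The time-discrete approximate mean curvature flow with respect to $\mathcal{T}$ starting from $V_0$ is defined by $V_{\epsilon,\mathcal{T}}(0)=V_0$ and, recursively, $V_{\epsilon,\mathcal{T}}(t)=[\mathrm{id}+(t-t_i)h_\epsilon(\cdot,V_{\epsilon,\mathcal{T}}(t_i))]_\#V_{\epsilon,\mathcal{T}}(t_i)$ for $t\in[t_i,t_{i+1}]$; the constant $c_3$ is such that the step-size condition makes all these maps $C^1$ diffeomorphisms and keeps all masses $\le M+1$. *)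

theory Defs
  imports
    "Jordan_Normal_Form.Determinant"
    "HOL-Analysis.Analysis"
begin

subsection \<open>Smoothness\<close>

primrec C_k :: "nat \<Rightarrow> ('a::euclidean_space \<Rightarrow> 'b::euclidean_space) \<Rightarrow> bool" where
  "C_k 0 f \<longleftrightarrow> continuous_on UNIV f"
| "C_k (Suc k) f \<longleftrightarrow>
     f differentiable_on UNIV \<and> (\<forall>v. C_k k (\<lambda>x. frechet_derivative f (at x) v))"

definition C_infinity :: "('a::euclidean_space \<Rightarrow> 'b::euclidean_space) \<Rightarrow> bool" where
  "C_infinity f \<longleftrightarrow> (\<forall>k. C_k k f)"

definition C1_diffeo :: "('a::euclidean_space \<Rightarrow> 'a) \<Rightarrow> bool" where
  "C1_diffeo f \<longleftrightarrow> bij f \<and> C_k 1 f \<and> C_k 1 (inv_into UNIV f)"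

definition grad :: "('a::euclidean_space \<Rightarrow> real) \<Rightarrow> 'a \<Rightarrow> 'a" where
  "grad f x = (\<Sum>i\<in>Basis. frechet_derivative f (at x) i *\<^sub>R i)"

subsection \<open>Grassmannian\<close>

text \<open>A subspace is represented by the orthogonal projection onto it, an element of
  the type of bounded linear maps, whose norm is the operator norm.\<close>

definition orth_proj :: "'a::euclidean_space set \<Rightarrow> 'a \<Rightarrow>\<^sub>L 'a" where
  "orth_proj U =
     (THE P. \<forall>x. blinfun_apply P x \<in> U \<and> (\<forall>u\<in>U. orthogonal (x - blinfun_apply P x) u))"

definition grassmannian :: "nat \<Rightarrow> ('a::euclidean_space \<Rightarrow>\<^sub>L 'a) set" where
  "grassmannian d = orth_proj ` {U. subspace U \<and> dim U = d}"

definition subspace_of :: "('a::euclidean_space \<Rightarrow>\<^sub>L 'a) \<Rightarrow> 'a set" where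
  "subspace_of S = range (blinfun_apply S)"

lemma orth_proj:
  assumes "subspace U"
  shows "blinfun_apply (orth_proj U) x \<in> U"
    and "u \<in> U \<Longrightarrow> orthogonal (x - blinfun_apply (orth_proj U) x) u"
proof -
  let ?Q = "\<lambda>P. \<forall>x. blinfun_apply P x \<in> U \<and> (\<forall>u\<in>U. orthogonal (x - blinfun_apply P x) u)"
  have uniq: "P x = P' x"
    if "P x \<in> U" "\<forall>u\<in>U. orthogonal (x - P x) u" "P' x \<in> U" "\<forall>u\<in>U. orthogonal (x - P' x) u"
    for P P' :: "'a \<Rightarrow> 'a" and x
  proof -
    have "P x - P' x \<in> U"
      using that assms by (auto intro: subspace_diff)
    then have "inner (x - P' x) (P x - P' x) = 0" "inner (x - P x) (P x - P' x) = 0"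
      using that by (auto simp: orthogonal_def)
    then have "inner (P x - P' x) (P x - P' x) = 0"
      by (simp add: inner_diff_left)
    then show ?thesis by simp
  qed
  obtain B where B: "B \<subseteq> U" "pairwise orthogonal B" "\<And>b. b \<in> B \<Longrightarrow> norm b = 1"
      "independent B" "span B = U"
    using orthonormal_basis_subspace[OF assms] by metis
  have fin: "finite B" using B(4) by (rule independent_imp_finite)
  define p where "p x = (\<Sum>b\<in>B. inner x b *\<^sub>R b)" for x
  have lin: "linear p"
    unfolding p_def
    by (intro linearI) (auto simp: inner_add_left scaleR_add_left sum.distrib scaleR_sum_right)
  have pU: "p x \<in> U" for x
    unfolding p_def using assms B(1) by (auto intro!: subspace_sum subspace_scale)
  have porth: "orthogonal (x - p x) u" if "u \<in> U" for x u
  proof -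
    have "orthogonal (x - p x) b" if "b \<in> B" for b
    proof -
      have "inner (p x) b = (\<Sum>c\<in>B. if c = b then inner x b else 0)"
        unfolding p_def inner_sum_left using B(2,3) that
        by (intro sum.cong) (auto simp: pairwise_def orthogonal_def dot_square_norm)
      then show ?thesis
        using fin that by (simp add: orthogonal_def inner_diff_left)
    qed
    then show ?thesis using that B(5) orthogonal_to_span by blast
  qed
  have "?Q (Blinfun p)"
    using pU porth lin by (simp add: bounded_linear_Blinfun_apply linear_conv_bounded_linear)
  moreover have "P = Blinfun p" if "?Q P" for P
    using that \<open>?Q (Blinfun p)\<close> uniq[of "blinfun_apply P" _ "blinfun_apply (Blinfun p)"]
    by (intro blinfun_eqI) blast
  ultimately have "?Q (orth_proj U)"
    unfolding orth_proj_def by (rule theI)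
  then show "blinfun_apply (orth_proj U) x \<in> U"
    and "u \<in> U \<Longrightarrow> orthogonal (x - blinfun_apply (orth_proj U) x) u" by auto
qed

lemma subspace_of_orth_proj:
  assumes "subspace U"
  shows "subspace_of (orth_proj U) = U"
proof -
  have "blinfun_apply (orth_proj U) u = u" if "u \<in> U" for u
  proof -
    have "u - blinfun_apply (orth_proj U) u \<in> U"
      using that assms orth_proj(1) by (auto intro: subspace_diff)
    then have "orthogonal (u - blinfun_apply (orth_proj U) u) (u - blinfun_apply (orth_proj U) u)"
      using orth_proj(2)[OF assms] by blast
    then show ?thesis by (simp add: orthogonal_def)
  qed
  then show ?thesis
    unfolding subspace_of_def using orth_proj(1)[OF assms] by (metis image_subset_iff rangeI subsetI subset_antisym)
qed

definition orthonormal_basis :: "nat \<Rightarrow> 'a::euclidean_space set \<Rightarrow> (nat \<Rightarrow> 'a) \<Rightarrow> bool" where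
  "orthonormal_basis d U s \<longleftrightarrow>
     (\<forall>i<d. \<forall>j<d. inner (s i) (s j) = (if i = j then 1 else 0)) \<and> span (s ` {..<d}) = U"

lemma orthonormal_basis_exists:
  assumes "subspace U" "dim U = d"
  shows "\<exists>s. orthonormal_basis d U s"
proof -
  obtain B where B: "B \<subseteq> U" "pairwise orthogonal B" "\<And>b. b \<in> B \<Longrightarrow> norm b = 1"
      "independent B" "card B = dim U" "span B = U"
    using orthonormal_basis_subspace[OF assms(1)] by metis
  have "finite B" using B(4) by (rule independent_imp_finite)
  then obtain s where s: "bij_betw s {..<d} B"
    using B(5) assms(2) ex_bij_betw_nat_finite atLeast0LessThan by metis
  have "inner (s i) (s j) = (if i = j then 1 else 0)" if "i < d" "j < d" for i j
    using that s B(2,3)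
    by (auto simp: bij_betw_def inj_on_def pairwise_def orthogonal_def dot_square_norm)
      (metis imageI lessThan_iff)+
  moreover have "s ` {..<d} = B" using s by (simp add: bij_betw_def)
  ultimately show ?thesis using B(6) unfolding orthonormal_basis_def by blast
qed

subsection \<open>Varifolds\<close>

definition radon_on :: "'a::topological_space set \<Rightarrow> 'a measure \<Rightarrow> bool" where
  "radon_on X \<mu> \<longleftrightarrow>
     sets \<mu> = sets (restrict_space borel X) \<and>
     (\<forall>K. compact K \<and> K \<subseteq> X \<longrightarrow> emeasure \<mu> K < \<infinity>) \<and>
     (\<forall>A\<in>sets \<mu>. emeasure \<mu> A = (SUP K\<in>{K. compact K \<and> K \<subseteq> A}. emeasure \<mu> K))"

type_synonym 'a varifold = "('a \<times> ('a \<Rightarrow>\<^sub>L 'a)) measure"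

definition is_varifold :: "nat \<Rightarrow> 'a::euclidean_space varifold \<Rightarrow> bool" where
  "is_varifold d V \<longleftrightarrow> radon_on (UNIV \<times> grassmannian d) V"

definition weight :: "'a::euclidean_space varifold \<Rightarrow> 'a measure" where
  "weight V = distr V borel fst"

text \<open>The product type carries the Euclidean product metric in the library; it induces the same
  topology as the sum metric, but the Lipschitz constants differ.\<close>

definition sum_dist :: "'a::metric_space \<times> 'b::metric_space \<Rightarrow> 'a \<times> 'b \<Rightarrow> real" where
  "sum_dist p q = dist (fst p) (fst q) + dist (snd p) (snd q)"

definition bounded_lipschitz_dist ::
  "'a::topological_space set \<Rightarrow> ('a \<Rightarrow> 'a \<Rightarrow> real) \<Rightarrow> 'a measure \<Rightarrow> 'a measure \<Rightarrow> real" where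
  "bounded_lipschitz_dist X \<rho> \<mu> \<nu> =
     Sup {\<bar>(LINT x|\<mu>. \<phi> x) - (LINT x|\<nu>. \<phi> x)\<bar> | \<phi>.
       continuous_on X \<phi> \<and> (\<forall>x\<in>X. 0 \<le> \<phi> x) \<and> (\<forall>x\<in>X. \<bar>\<phi> x\<bar> \<le> 1) \<and>
       (\<forall>x\<in>X. \<forall>y\<in>X. \<bar>\<phi> x - \<phi> y\<bar> \<le> \<rho> x y)}"

definition varifold_dist :: "nat \<Rightarrow> 'a::euclidean_space varifold \<Rightarrow> 'a varifold \<Rightarrow> real" where
  "varifold_dist d = bounded_lipschitz_dist (UNIV \<times> grassmannian d) sum_dist"

subsection \<open>Push-forward\<close>

text \<open>The matrix below is \<open>Y\<^sup>t Y\<close>. Two orthonormal bases of \<open>S\<close> differ by an orthogonal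
  \<open>d \<times> d\<close> matrix, so its determinant does not depend on the chosen basis.\<close>

definition tangential_jacobian ::
  "nat \<Rightarrow> ('a::euclidean_space \<Rightarrow> 'a) \<Rightarrow> 'a \<Rightarrow> ('a \<Rightarrow>\<^sub>L 'a) \<Rightarrow> real" where
  "tangential_jacobian d f x S =
     (let s = (SOME s. orthonormal_basis d (subspace_of S) s);
          Y = (\<lambda>i. frechet_derivative f (at x) (s i))
      in sqrt (Determinant.det (Matrix.mat d d (\<lambda>(i, j). inner (Y i) (Y j)))))"

text \<open>Integrating a test function against this measure gives
  \<open>\<integral> \<phi> (f x, Df(x)(S)) J\<^sub>S f(x) dV(x, S)\<close>.\<close>

definition push_forward ::
  "nat \<Rightarrow> ('a::euclidean_space \<Rightarrow> 'a) \<Rightarrow> 'a varifold \<Rightarrow> 'a varifold" where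
  "push_forward d f V =
     distr (density V (\<lambda>(x, S). ennreal (tangential_jacobian d f x S)))
       (restrict_space borel (UNIV \<times> grassmannian d))
       (\<lambda>(x, S). (f x, orth_proj (frechet_derivative f (at x) ` subspace_of S)))"

subsection \<open>Approximate mean curvature\<close>

definition is_cutoff :: "('a::euclidean_space \<Rightarrow> real) \<Rightarrow> bool" where
  "is_cutoff \<psi> \<longleftrightarrow>
     C_infinity \<psi> \<and>
     (\<forall>x y. norm x = norm y \<longrightarrow> \<psi> x = \<psi> y) \<and>
     (\<forall>x. 0 \<le> \<psi> x \<and> \<psi> x \<le> 1) \<and>
     (\<forall>x. norm x \<le> 1 / 2 \<longrightarrow> \<psi> x = 1) \<and>
     (\<forall>x. norm x \<ge> 1 \<longrightarrow> \<psi> x = 0) \<and>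
     (\<forall>x. norm (grad \<psi> x) \<le> 3)"

definition truncated_gaussian :: "('a::euclidean_space \<Rightarrow> real) \<Rightarrow> real \<Rightarrow> 'a \<Rightarrow> real" where
  "truncated_gaussian \<psi> \<epsilon> x =
     \<psi> x * (2 * pi * \<epsilon>\<^sup>2) powr (- real DIM('a) / 2) * exp (- (norm x)\<^sup>2 / (2 * \<epsilon>\<^sup>2))"

definition kernel :: "('a::euclidean_space \<Rightarrow> real) \<Rightarrow> real \<Rightarrow> 'a \<Rightarrow> real" where
  "kernel \<psi> \<epsilon> x = truncated_gaussian \<psi> \<epsilon> x / (LINT y|lborel. truncated_gaussian \<psi> \<epsilon> y)"

definition smoothed_weight ::
  "('a::euclidean_space \<Rightarrow> real) \<Rightarrow> real \<Rightarrow> 'a varifold \<Rightarrow> 'a \<Rightarrow> real" where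
  "smoothed_weight \<psi> \<epsilon> V y = (LINT x|weight V. kernel \<psi> \<epsilon> (x - y))"

definition smoothed_first_variation ::
  "('a::euclidean_space \<Rightarrow> real) \<Rightarrow> real \<Rightarrow> 'a varifold \<Rightarrow> 'a \<Rightarrow> 'a" where
  "smoothed_first_variation \<psi> \<epsilon> V y =
     (LINT p|V. blinfun_apply (snd p) (grad (kernel \<psi> \<epsilon>) (fst p - y)))"

definition pre_mean_curvature ::
  "('a::euclidean_space \<Rightarrow> real) \<Rightarrow> real \<Rightarrow> 'a varifold \<Rightarrow> 'a \<Rightarrow> 'a" where
  "pre_mean_curvature \<psi> \<epsilon> V y =
     - (smoothed_first_variation \<psi> \<epsilon> V y /\<^sub>R (smoothed_weight \<psi> \<epsilon> V y + \<epsilon>))"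

definition mean_curvature ::
  "('a::euclidean_space \<Rightarrow> real) \<Rightarrow> real \<Rightarrow> 'a varifold \<Rightarrow> 'a \<Rightarrow> 'a" where
  "mean_curvature \<psi> \<epsilon> V x = (LINT y|lborel. kernel \<psi> \<epsilon> (x - y) *\<^sub>R pre_mean_curvature \<psi> \<epsilon> V y)"

subsection \<open>Time-discrete flow\<close>

definition is_subdivision :: "nat \<Rightarrow> (nat \<Rightarrow> real) \<Rightarrow> bool" where
  "is_subdivision m T \<longleftrightarrow> T 0 = 0 \<and> T m = 1 \<and> (\<forall>i<m. T i < T (Suc i))"

definition mesh :: "nat \<Rightarrow> (nat \<Rightarrow> real) \<Rightarrow> real" where
  "mesh m T = Max ((\<lambda>i. T (Suc i) - T i) ` {..<m})"

definition step_map ::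
  "('a::euclidean_space \<Rightarrow> real) \<Rightarrow> real \<Rightarrow> real \<Rightarrow> 'a varifold \<Rightarrow> 'a \<Rightarrow> 'a" where
  "step_map \<psi> \<epsilon> \<tau> V x = x + \<tau> *\<^sub>R mean_curvature \<psi> \<epsilon> V x"

primrec flow_node ::
  "('a::euclidean_space \<Rightarrow> real) \<Rightarrow> nat \<Rightarrow> real \<Rightarrow> (nat \<Rightarrow> real) \<Rightarrow> 'a varifold \<Rightarrow> nat \<Rightarrow> 'a varifold"
where
  "flow_node \<psi> d \<epsilon> T V\<^sub>0 0 = V\<^sub>0"
| "flow_node \<psi> d \<epsilon> T V\<^sub>0 (Suc i) =
     push_forward d (step_map \<psi> \<epsilon> (T (Suc i) - T i) (flow_node \<psi> d \<epsilon> T V\<^sub>0 i))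
       (flow_node \<psi> d \<epsilon> T V\<^sub>0 i)"

text \<open>For \<open>t > 0\<close> the index chosen is the \<open>i\<close> with \<open>T i < t \<le> T (Suc i)\<close>; that the defining
  equation also holds at the left end points is \<open>flow_eq\<close> below.\<close>

definition flow ::
  "('a::euclidean_space \<Rightarrow> real) \<Rightarrow> nat \<Rightarrow> real \<Rightarrow> (nat \<Rightarrow> real) \<Rightarrow> 'a varifold \<Rightarrow> real \<Rightarrow> 'a varifold"
where
  "flow \<psi> d \<epsilon> T V\<^sub>0 t =
     (if t \<le> 0 then V\<^sub>0
      else let i = (LEAST i. t \<le> T (Suc i));
               V = flow_node \<psi> d \<epsilon> T V\<^sub>0 i
           in push_forward d (step_map \<psi> \<epsilon> (t - T i) V) V)"

text \<open>The total function \<open>push_forward\<close> is the geometric push-forward only for \<open>C\<^sup>1\<close>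
  diffeomorphisms, so it has to be stated that all maps used by \<open>flow\<close> are of this kind.\<close>

definition flow_well_posed ::
  "('a::euclidean_space \<Rightarrow> real) \<Rightarrow> nat \<Rightarrow> real \<Rightarrow> nat \<Rightarrow> (nat \<Rightarrow> real) \<Rightarrow> real \<Rightarrow> 'a varifold \<Rightarrow> bool"
where
  "flow_well_posed \<psi> d \<epsilon> m T M V\<^sub>0 \<longleftrightarrow>
     (\<forall>i<m. \<forall>t\<in>{T i..T (Suc i)}. C1_diffeo (step_map \<psi> \<epsilon> (t - T i) (flow \<psi> d \<epsilon> T V\<^sub>0 (T i)))) \<and>
     (\<forall>t\<in>{0..1}. emeasure (weight (flow \<psi> d \<epsilon> T V\<^sub>0 t)) UNIV \<le> ennreal (M + 1))"

lemma push_forward_ident: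
  fixes V :: "'a::euclidean_space varifold"
  assumes V: "sets V = sets (restrict_space borel (UNIV \<times> grassmannian d))"
  shows "push_forward d (\<lambda>x. x) V = V"
proof -
  have D: "frechet_derivative (\<lambda>x::'a. x) (at x) = (\<lambda>x. x)" for x
    by (simp add: frechet_derivative_ident)
  have sp: "space V = UNIV \<times> grassmannian d"
    using sets_eq_imp_space_eq[OF V] by (simp add: space_restrict_space)
  have *: "orth_proj (subspace_of S) = S \<and> tangential_jacobian d (\<lambda>x. x) x S = 1"
    if S: "S \<in> grassmannian d" for S :: "'a \<Rightarrow>\<^sub>L 'a" and x
  proof -
    obtain U where U: "S = orth_proj U" "subspace U" "dim U = d"
      using S unfolding grassmannian_def by blast
    then have so: "subspace_of S = U" by (simp add: subspace_of_orth_proj)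
    let ?s = "SOME s. orthonormal_basis d U s"
    have "orthonormal_basis d U ?s"
      using orthonormal_basis_exists[OF U(2,3)] by (rule someI_ex)
    then have "Matrix.mat d d (\<lambda>(i, j). inner (?s i) (?s j)) = 1\<^sub>m d"
      by (intro eq_matI) (auto simp: orthonormal_basis_def)
    then have "tangential_jacobian d (\<lambda>x. x) x S = 1"
      unfolding tangential_jacobian_def Let_def so D by simp
    then show ?thesis using so U(1) by simp
  qed
  have "density V (\<lambda>(x, S). ennreal (tangential_jacobian d (\<lambda>x. x) x S)) = density V (\<lambda>_. 1)"
  proof -
    have "AE p in V. (case p of (x, S) \<Rightarrow> ennreal (tangential_jacobian d (\<lambda>x. x) x S)) = 1"
      by (rule AE_I2) (auto simp: sp *)
    moreover have "(\<lambda>(x, S). ennreal (tangential_jacobian d (\<lambda>x. x) x S)) \<in> borel_measurable V"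
      by (subst measurable_cong[where g = "\<lambda>_. 1"]) (auto simp: sp *)
    ultimately show ?thesis by (intro density_cong) auto
  qed
  then have "push_forward d (\<lambda>x. x) V = distr V (restrict_space borel (UNIV \<times> grassmannian d))
      (\<lambda>(x, S). (x, orth_proj (subspace_of S)))"
    unfolding push_forward_def D by (simp add: density_1)
  also have "\<dots> = distr V V (\<lambda>p. p)"
    using V by (intro distr_cong) (auto simp: sp *)
  finally show ?thesis by (simp add: distr_id2)
qed

lemma subdivision_mono:
  assumes "is_subdivision m T" "i \<le> j" "j \<le> m"
  shows "T i \<le> T j"
  using assms(2,3)
proof (induction j rule: dec_induct)
  case (step j)
  then have "T j < T (Suc j)" using assms(1) by (simp add: is_subdivision_def)
  then show ?case using step by simp
qed simp

lemma flow_eq: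
  fixes V\<^sub>0 :: "'a::euclidean_space varifold"
  assumes V0: "is_varifold d V\<^sub>0" and T: "is_subdivision m T"
    and i: "i < m" and t: "t \<in> {T i..T (Suc i)}"
  shows "flow \<psi> d \<epsilon> T V\<^sub>0 0 = V\<^sub>0"
    and "flow \<psi> d \<epsilon> T V\<^sub>0 t =
      push_forward d (step_map \<psi> \<epsilon> (t - T i) (flow \<psi> d \<epsilon> T V\<^sub>0 (T i))) (flow \<psi> d \<epsilon> T V\<^sub>0 (T i))"
proof -
  show "flow \<psi> d \<epsilon> T V\<^sub>0 0 = V\<^sub>0" by (simp add: flow_def)
  have inside: "flow \<psi> d \<epsilon> T V\<^sub>0 s = push_forward d (step_map \<psi> \<epsilon> (s - T j)
      (flow_node \<psi> d \<epsilon> T V\<^sub>0 j)) (flow_node \<psi> d \<epsilon> T V\<^sub>0 j)"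
    if j: "j < m" and s: "T j < s" "s \<le> T (Suc j)" for j s
  proof -
    have "T 0 \<le> T j" using subdivision_mono[OF T] j by simp
    then have "0 < s" using s T by (simp add: is_subdivision_def)
    moreover have "(LEAST k. s \<le> T (Suc k)) = j"
    proof (rule Least_equality)
      show "j \<le> k" if "s \<le> T (Suc k)" for k
      proof (rule ccontr)
        assume "\<not> j \<le> k"
        then have "T (Suc k) \<le> T j" using subdivision_mono[OF T] j by simp
        then show False using s that by simp
      qed
    qed (use s in simp)
    ultimately show ?thesis by (simp add: flow_def Let_def)
  qed
  have node: "flow \<psi> d \<epsilon> T V\<^sub>0 (T j) = flow_node \<psi> d \<epsilon> T V\<^sub>0 j" if "j \<le> m" for j
  proof (cases j)
    case 0
    then show ?thesis using T by (simp add: flow_def is_subdivision_def)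
  next
    case (Suc k)
    then show ?thesis using inside[of k "T j"] T that by (simp add: is_subdivision_def)
  qed
  have sets_node: "sets (flow_node \<psi> d \<epsilon> T V\<^sub>0 i) =
      sets (restrict_space borel (UNIV \<times> grassmannian d))"
    using V0 by (cases i) (auto simp: is_varifold_def radon_on_def push_forward_def)
  show "flow \<psi> d \<epsilon> T V\<^sub>0 t =
      push_forward d (step_map \<psi> \<epsilon> (t - T i) (flow \<psi> d \<epsilon> T V\<^sub>0 (T i))) (flow \<psi> d \<epsilon> T V\<^sub>0 (T i))"
  proof (cases "t = T i")
    case True
    then have "step_map \<psi> \<epsilon> (t - T i) (flow_node \<psi> d \<epsilon> T V\<^sub>0 i) = (\<lambda>x. x)"
      by (auto simp: step_map_def)
    then show ?thesis
      using push_forward_ident[OF sets_node] node[of i] i True by simp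
  next
    case False
    then show ?thesis using inside[OF i, of t] node[of i] i t by simp
  qed
qed

end

theory Submission
  imports Defs
begin

text \<open>
  Write a step of the flow as the push-forward under \<open>id + \<tau> h\<close>. Each step is controlled by
  bounds for \<open>h\<close> that are uniform in the varifold.

  Since \<open>\<bar>\<nabla>\<Phi>\<bar> \<le> \<epsilon>\<^sup>-\<^sup>2 \<Phi> + C\<close> on the unit ball, dividing \<open>\<delta>V * \<Phi>\<close> by \<open>\<parallel>V\<parallel> * \<Phi> + \<epsilon>\<close> costs only
  \<open>C (M + 1) \<epsilon>\<^sup>-\<^sup>2\<close>, hence \<open>\<parallel>Dh\<parallel> \<le> C (M + 1) \<epsilon>\<^sup>-\<^sup>4\<close>, and a step of length at most
  \<open>c (M + 1)\<^sup>-\<^sup>3 \<epsilon>\<^sup>8\<close> is a diffeomorphism. The first variation of \<open>V\<close> in direction \<open>h\<close> is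
  \<open>- \<integral> \<bar>\<delta>V * \<Phi>\<bar>\<^sup>2 / (\<parallel>V\<parallel> * \<Phi> + \<epsilon>) \<le> 0\<close>, so a step changes the mass only by the second order term
  \<open>C \<tau>\<^sup>2 \<parallel>Dh\<parallel>\<^sup>2 (M + 1) \<le> \<tau>\<close>, and the total gain over \<open>[0, 1]\<close> is at most 1.

  For stability, a test function for \<open>f\<^sub>#V\<close> pulls back to a test function for \<open>V\<close> up to a factor
  \<open>1 + C \<tau>\<close>, because the map \<open>S \<mapsto> (I + A) S\<close> on the Grassmannian and the tangential Jacobian have
  Lipschitz constants \<open>1 + O(\<parallel>A\<parallel>)\<close> and \<open>O(\<parallel>A\<parallel>)\<close>. The dependence of \<open>h\<close> on \<open>V\<close> is Lipschitz with constant
  \<open>C (M + 1) \<epsilon>\<^sup>-\<^sup>n\<^sup>-\<^sup>7\<close> in the bounded Lipschitz distance. Iterating gives the exponential.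
\<close>

section \<open>Perturbed orthogonal projections\<close>

text \<open>Stability tolerates a factor \<open>1 + C * \<tau>\<close> per step, but the mass bound
  does not: there the linear term of the Jacobian has to be kept exactly, as the trace of S A, so
  that after integration it meets the sign of the first variation. Only the remainder is estimated.
  As \<open>K\<close> is of order m eps^-4, a remainder of order tau^2 K^2 m stays below tau exactly
  when tau m^3 eps^-8 is small, which is the step-size condition.

  The Jacobian is defined through an orthonormal basis obtained by choice, which need not vary
  continuously with the plane. Sylvester's determinant identity replaces its Gram determinant by one
  in a fixed basis of the whole space, where the projection enters linearly.

  The exponent n + 7 is n + 4 for the Lipschitz constant of the kernel gradient, 1 for the division
  by the smoothed mass plus eps, and 2 for the outer derivative. Of the two factors M + 1, one sits
  in the Lipschitz bound of the field and one comes from integrating over the varifold.\<close>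

lemma orth_proj_fixes:
  assumes "subspace U" "u \<in> U"
  shows "blinfun_apply (orth_proj U) u = u"
proof -
  have "u - blinfun_apply (orth_proj U) u \<in> U"
    using assms orth_proj(1) by (auto intro: subspace_diff)
  then have "orthogonal (u - blinfun_apply (orth_proj U) u) (u - blinfun_apply (orth_proj U) u)"
    using orth_proj(2)[OF assms(1)] by blast
  then show ?thesis by (simp add: orthogonal_def)
qed

lemma orth_proj_self_adjoint:
  assumes "subspace U"
  shows "inner (blinfun_apply (orth_proj U) x) y = inner x (blinfun_apply (orth_proj U) y)"
proof -
  let ?P = "blinfun_apply (orth_proj U)"
  have "inner (x - ?P x) (?P y) = 0" "inner (y - ?P y) (?P x) = 0"
    using orth_proj[OF assms] by (auto simp: orthogonal_def)
  then show ?thesis unfolding inner_diff_left by (metis eq_iff_diff_eq_0 inner_commute)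
qed

lemma norm_orth_proj_le:
  assumes "subspace U"
  shows "norm (blinfun_apply (orth_proj U) x) \<le> norm x"
proof -
  let ?P = "blinfun_apply (orth_proj U)"
  have "?P (?P x) = ?P x"
    using orth_proj_fixes orth_proj(1) assms by blast
  then have "inner (?P x) (?P x) = inner x (?P x)"
    using orth_proj_self_adjoint[OF assms, of x "?P x"] by simp
  also have "\<dots> \<le> norm x * norm (?P x)"
    by (rule norm_cauchy_schwarz)
  finally have "norm (?P x) * norm (?P x) \<le> norm x * norm (?P x)"
    by (simp add: power2_norm_eq_inner[symmetric] power2_eq_square)
  then show ?thesis
    by (cases "norm (?P x) = 0") (auto simp: mult_le_cancel_right)
qed

lemma orth_proj_closest:
  assumes "subspace U" "u \<in> U"
  shows "norm (x - blinfun_apply (orth_proj U) x) \<le> norm (x - u)"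
proof -
  let ?P = "blinfun_apply (orth_proj U)"
  have "?P x - u \<in> U"
    using assms orth_proj(1) by (auto intro: subspace_diff)
  then have "orthogonal (x - ?P x) (?P x - u)"
    using orth_proj(2)[OF assms(1)] by blast
  then have "norm ((x - ?P x) + (?P x - u)) ^ 2 = norm (x - ?P x) ^ 2 + norm (?P x - u) ^ 2"
    by (rule norm_add_Pythagorean)
  then have "norm (x - ?P x) ^ 2 \<le> norm (x - u) ^ 2" by simp
  then show ?thesis by (rule power2_le_imp_le) simp
qed

text \<open>Writing \<open>P - Q = P (I - Q) - (I - P) Q\<close>, the two summands take orthogonal values, and
  \<open>P (I - Q)\<close> is the adjoint of \<open>(I - Q) P\<close>.\<close>

lemma norm_orth_proj_diff_le:
  assumes U: "subspace U" and W: "subspace W" and a: "0 \<le> a"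
    and UW: "\<And>x. x \<in> U \<Longrightarrow> norm (x - blinfun_apply (orth_proj W) x) \<le> a * norm x"
    and WU: "\<And>x. x \<in> W \<Longrightarrow> norm (x - blinfun_apply (orth_proj U) x) \<le> a * norm x"
  shows "norm (orth_proj U - orth_proj W) \<le> a"
proof (rule norm_blinfun_bound[OF a])
  fix x
  define P where "P = blinfun_apply (orth_proj U)"
  define Q where "Q = blinfun_apply (orth_proj W)"
  have lin: "P (y - z) = P y - P z" "Q (y - z) = Q y - Q z" for y z
    by (simp_all add: P_def Q_def blinfun.diff_right)
  have PU: "P y \<in> U" and QW: "Q y \<in> W" for y
    using orth_proj(1) U W by (auto simp: P_def Q_def)
  define r where "r = x - Q x"
  have 1: "norm (P r) \<le> a * norm r"
  proof -
    have QQ: "Q r = 0"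
      using orth_proj_fixes[OF W QW[unfolded Q_def]] by (simp add: r_def Q_def blinfun.diff_right)
    have "inner (P r) (P r) = inner (P r) r"
      using orth_proj_self_adjoint[OF U, of r "P r"] orth_proj_fixes[OF U PU]
      by (simp add: P_def inner_commute)
    also have "\<dots> = inner (P r - Q (P r)) r"
      using orth_proj_self_adjoint[OF W, of "P r" r] QQ by (simp add: Q_def inner_diff_left)
    also have "\<dots> \<le> norm (P r - Q (P r)) * norm r" by (rule norm_cauchy_schwarz)
    also have "\<dots> \<le> (a * norm (P r)) * norm r"
      using UW[OF PU] by (intro mult_right_mono) (auto simp: Q_def)
    finally have "norm (P r) * norm (P r) \<le> (a * norm r) * norm (P r)"
      by (simp add: power2_norm_eq_inner[symmetric] power2_eq_square mult_ac)
    then show ?thesis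
      using a by (cases "norm (P r) = 0") (auto simp: mult_le_cancel_right)
  qed
  have 2: "norm (Q x - P (Q x)) \<le> a * norm (Q x)"
    using WU[OF QW] by (simp add: P_def)
  have "orthogonal (P r) (- (Q x - P (Q x)))"
    using orth_proj(2)[OF U PU, of "Q x" r]
    by (simp only: P_def orthogonal_def inner_minus_right inner_commute[of "blinfun_apply (orth_proj U) r"])
  then have "norm (P r + - (Q x - P (Q x))) ^ 2 = norm (P r) ^ 2 + norm (- (Q x - P (Q x))) ^ 2"
    by (rule norm_add_Pythagorean)
  then have "norm (P x - Q x) ^ 2 = norm (P r) ^ 2 + norm (Q x - P (Q x)) ^ 2"
    by (simp add: r_def lin norm_minus_commute)
  also have "\<dots> \<le> (a * norm r) ^ 2 + (a * norm (Q x)) ^ 2"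
    using 1 2 by (intro add_mono power_mono) auto
  also have "\<dots> = a ^ 2 * (norm r ^ 2 + norm (Q x) ^ 2)"
    by (simp add: power_mult_distrib distrib_left)
  also have "norm r ^ 2 + norm (Q x) ^ 2 = norm x ^ 2"
  proof -
    have "orthogonal r (Q x)"
      using orth_proj(2)[OF W QW] by (simp add: r_def Q_def)
    from norm_add_Pythagorean[OF this] show ?thesis by (simp add: r_def)
  qed
  finally have "norm (P x - Q x) ^ 2 \<le> (a * norm x) ^ 2"
    by (simp add: power_mult_distrib)
  then have "norm (P x - Q x) \<le> a * norm x"
    by (rule power2_le_imp_le) (simp add: a)
  then show "norm (blinfun_apply (orth_proj U - orth_proj W) x) \<le> a * norm x"
    by (simp add: P_def Q_def blinfun.diff_left)
qed

section \<open>Planes and their images under I + A\<close>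

lemma grassmannianD:
  assumes "S \<in> grassmannian d"
  shows "subspace (subspace_of S)" and "dim (subspace_of S) = d" and "orth_proj (subspace_of S) = S"
proof -
  obtain U where "S = orth_proj U" "subspace U" "dim U = d"
    using assms unfolding grassmannian_def by blast
  then show "subspace (subspace_of S)" "dim (subspace_of S) = d" "orth_proj (subspace_of S) = S"
    by (simp_all add: subspace_of_orth_proj)
qed

lemma norm_grassmannian_apply:
  assumes "S \<in> grassmannian d"
  shows "norm (blinfun_apply S x) \<le> norm x"
  using norm_orth_proj_le[OF grassmannianD(1)[OF assms], of x]
  by (simp add: grassmannianD(3)[OF assms])

lemma grassmannian_self_adjoint:
  assumes "S \<in> grassmannian d"
  shows "inner (blinfun_apply S x) y = inner x (blinfun_apply S y)"
  using orth_proj_self_adjoint[OF grassmannianD(1)[OF assms], of x y]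
  by (simp add: grassmannianD(3)[OF assms])

lemma norm_perturbed_ge:
  assumes "norm A \<le> \<alpha>"
  shows "(1 - \<alpha>) * norm s \<le> norm (s + blinfun_apply A s)"
proof -
  have "norm (blinfun_apply A s) \<le> \<alpha> * norm s"
    using norm_blinfun[of A s] assms by (meson dual_order.trans mult_right_mono norm_ge_zero)
  moreover have "norm s \<le> norm (s + blinfun_apply A s) + norm (blinfun_apply A s)"
    by (metis add_diff_cancel_right' norm_triangle_ineq4)
  ultimately show ?thesis by (simp add: algebra_simps)
qed

lemma linear_perturbed: "linear (\<lambda>v. v + blinfun_apply A v)"
  by (intro linearI) (auto simp: blinfun.add_right blinfun.scaleR_right algebra_simps)

lemma perturbed_image_grassmannian:
  assumes S: "S \<in> grassmannian d" and A: "norm A < 1"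
  shows "subspace ((\<lambda>v. v + blinfun_apply A v) ` subspace_of S)"
    and "orth_proj ((\<lambda>v. v + blinfun_apply A v) ` subspace_of S) \<in> grassmannian d"
proof -
  let ?L = "\<lambda>v. v + blinfun_apply A v"
  note U = grassmannianD(1,2)[OF S]
  show sub: "subspace (?L ` subspace_of S)"
    by (rule linear_subspace_image[OF linear_perturbed U(1)])
  have "inj ?L"
    unfolding linear_injective_0[OF linear_perturbed]
  proof (intro allI impI)
    fix v assume "?L v = 0"
    then have "(1 - norm A) * norm v \<le> 0" using norm_perturbed_ge[of A "norm A" v] by simp
    then show "v = 0" using A by (simp add: mult_le_0_iff)
  qed
  then have "dim (?L ` subspace_of S) = d"
    using dim_image_eq[OF linear_perturbed] U(2) by (metis inj_on_subset subset_UNIV)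
  then show "orth_proj (?L ` subspace_of S) \<in> grassmannian d"
    using sub by (auto simp: grassmannian_def)
qed

text \<open>The coefficient of \<open>norm (S - T)\<close> has to be 1 + O(\<alpha>): a fixed factor
  above 1 would compound over the steps regardless of their length. This is the one-sided distance
  that \<open>norm_orth_proj_diff_le\<close> asks for.\<close>

lemma perturbed_image_close:
  assumes S: "S \<in> grassmannian d" and T: "T \<in> grassmannian d"
    and A: "norm A \<le> \<alpha>" and \<alpha>: "\<alpha> \<le> 1/2"
    and x: "x \<in> (\<lambda>v. v + blinfun_apply A v) ` subspace_of S"
    and U: "U = (\<lambda>v. v + blinfun_apply B v) ` subspace_of T" and sub: "subspace U"
  shows "norm (x - blinfun_apply (orth_proj U) x) \<le>
      ((1 + 4 * \<alpha>) * norm (S - T) + 2 * norm (A - B)) * norm x"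
proof -
  obtain s where s: "s \<in> subspace_of S" "x = s + blinfun_apply A s" using x by blast
  have a0: "0 \<le> \<alpha>" using A norm_ge_zero order_trans by blast
  let ?g = "norm (S - T)" and ?e = "norm (A - B)"
  have Ss: "blinfun_apply S s = s"
    using orth_proj_fixes[OF grassmannianD(1)[OF S] s(1)] by (simp add: grassmannianD(3)[OF S])
  let ?t = "blinfun_apply T s"
  \<comment> \<open>Competitor for the closest point of \<open>U\<close>: project s onto the second
    plane, then apply I + B.\<close>
  have "?t + blinfun_apply B ?t \<in> U"
    unfolding U by (auto simp: subspace_of_def)
  from orth_proj_closest[OF sub this, of x]
  have "norm (x - blinfun_apply (orth_proj U) x) \<le> norm (x - (?t + blinfun_apply B ?t))" .
  also have "x - (?t + blinfun_apply B ?t) =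
      blinfun_apply (S - T) s + (blinfun_apply A (blinfun_apply (S - T) s) + blinfun_apply (A - B) ?t)"
    by (simp add: s Ss blinfun.diff_left blinfun.diff_right)
  also have "norm \<dots> \<le> ?g * norm s + (\<alpha> * (?g * norm s) + ?e * norm s)"
  proof -
    have 1: "norm (blinfun_apply (S - T) s) \<le> ?g * norm s" by (rule norm_blinfun)
    have "norm (blinfun_apply A (blinfun_apply (S - T) s)) \<le> norm A * norm (blinfun_apply (S - T) s)"
      by (rule norm_blinfun)
    also have "\<dots> \<le> \<alpha> * (?g * norm s)"
      using 1 A a0 by (intro mult_mono) auto
    finally have 2: "norm (blinfun_apply A (blinfun_apply (S - T) s)) \<le> \<alpha> * (?g * norm s)" .
    have "norm (blinfun_apply (A - B) ?t) \<le> ?e * norm ?t" by (rule norm_blinfun)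
    also have "\<dots> \<le> ?e * norm s"
      using norm_grassmannian_apply[OF T] by (intro mult_left_mono) auto
    finally have 3: "norm (blinfun_apply (A - B) ?t) \<le> ?e * norm s" .
    show ?thesis
      using 1 2 3 by (intro norm_triangle_le add_mono) auto
  qed
  also have "\<dots> = ((1 + \<alpha>) * ?g + ?e) * norm s" by (simp add: algebra_simps)
  \<comment> \<open>Passing from \<open>norm s\<close> to \<open>norm x\<close> costs 1/(1 -
    \<alpha>). For \<alpha> \<le> 1/2 the quotient (1 + \<alpha>)/(1 - \<alpha>) is at most 1 + 4
    \<alpha>, and 1/(1 - \<alpha>) is at most 2.\<close>
  also have "\<dots> \<le> (((1 + 4 * \<alpha>) * ?g + 2 * ?e) * (1 - \<alpha>)) * norm s"
  proof (rule mult_right_mono)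
    have "(1 + 4 * \<alpha>) * (1 - \<alpha>) - (1 + \<alpha>) = 2 * \<alpha> * (1 - 2 * \<alpha>)"
      by (simp add: algebra_simps)
    also have "\<dots> \<ge> 0" using a0 \<alpha> by simp
    finally have "(1 + \<alpha>) * ?g \<le> ((1 + 4 * \<alpha>) * (1 - \<alpha>)) * ?g" by (intro mult_right_mono) auto
    moreover have "1 * ?e \<le> (2 * (1 - \<alpha>)) * ?e" using \<alpha> by (intro mult_right_mono) auto
    ultimately show "(1 + \<alpha>) * ?g + ?e \<le> ((1 + 4 * \<alpha>) * ?g + 2 * ?e) * (1 - \<alpha>)"
      by (simp add: algebra_simps)
  qed simp
  also have "\<dots> = ((1 + 4 * \<alpha>) * ?g + 2 * ?e) * ((1 - \<alpha>) * norm s)" by simp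
  also have "\<dots> \<le> ((1 + 4 * \<alpha>) * ?g + 2 * ?e) * norm x"
    using norm_perturbed_ge[OF A, of s] a0 by (intro mult_left_mono) (auto simp: s)
  finally show ?thesis .
qed

text \<open>Plane and linear map vary at once: two points under one field give the Lipschitz bound
  of \<open>push_point\<close>, one plane under two fields gives the comparison in
  \<open>push_forward_stability\<close>. The hypotheses are symmetric, so
  \<open>perturbed_image_close\<close> serves in both directions.\<close>

lemma orth_proj_perturbed_diff:
  assumes S: "S \<in> grassmannian d" and T: "T \<in> grassmannian d"
    and A: "norm A \<le> \<alpha>" and B: "norm B \<le> \<alpha>" and \<alpha>: "\<alpha> \<le> 1/2"
  shows "norm (orth_proj ((\<lambda>v. v + blinfun_apply A v) ` subspace_of S)
      - orth_proj ((\<lambda>v. v + blinfun_apply B v) ` subspace_of T))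
    \<le> (1 + 4 * \<alpha>) * norm (S - T) + 2 * norm (A - B)"
proof (rule norm_orth_proj_diff_le)
  show US: "subspace ((\<lambda>v. v + blinfun_apply A v) ` subspace_of S)"
    and UT: "subspace ((\<lambda>v. v + blinfun_apply B v) ` subspace_of T)"
    using perturbed_image_grassmannian(1)[OF S, of A] perturbed_image_grassmannian(1)[OF T, of B]
      A B \<alpha> by auto
  have "0 \<le> \<alpha>" using A norm_ge_zero order_trans by blast
  then show "0 \<le> (1 + 4 * \<alpha>) * norm (S - T) + 2 * norm (A - B)" by simp
  show "norm (x - blinfun_apply (orth_proj ((\<lambda>v. v + blinfun_apply B v) ` subspace_of T)) x)
      \<le> ((1 + 4 * \<alpha>) * norm (S - T) + 2 * norm (A - B)) * norm x"
    if "x \<in> (\<lambda>v. v + blinfun_apply A v) ` subspace_of S" for x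
    by (rule perturbed_image_close[OF S T A \<alpha> that refl UT])
  show "norm (x - blinfun_apply (orth_proj ((\<lambda>v. v + blinfun_apply A v) ` subspace_of S)) x)
      \<le> ((1 + 4 * \<alpha>) * norm (S - T) + 2 * norm (A - B)) * norm x"
    if "x \<in> (\<lambda>v. v + blinfun_apply B v) ` subspace_of T" for x
    using perturbed_image_close[OF T S B \<alpha> that refl US] by (simp add: norm_minus_commute)
qed

section \<open>The tangential Jacobian\<close>

lemma abs_prod_add_one_le:
  fixes x :: "'i \<Rightarrow> real"
  assumes "finite I" "\<And>i. i \<in> I \<Longrightarrow> \<bar>x i\<bar> \<le> e" "e \<le> 1" "0 \<le> e"
  shows "\<bar>\<Prod>i\<in>I. 1 + x i\<bar> \<le> 2 ^ card I"
    and "\<bar>(\<Prod>i\<in>I. 1 + x i) - 1\<bar> \<le> 2 ^ card I * e"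
    and "\<bar>(\<Prod>i\<in>I. 1 + x i) - 1 - (\<Sum>i\<in>I. x i)\<bar> \<le> 2 ^ card I * e\<^sup>2"
proof -
  let ?p = "\<lambda>I. \<Prod>i\<in>I. 1 + x i"
  \<comment> \<open>Proved together because each bound feeds the next: inserting i adds
    \<open>x i\<close> times the product to the first remainder, and \<open>x i\<close> times the
    first remainder to the second.\<close>
  have "\<bar>?p I\<bar> \<le> 2 ^ card I \<and> \<bar>?p I - 1\<bar> \<le> 2 ^ card I * e \<and>
      \<bar>?p I - 1 - (\<Sum>i\<in>I. x i)\<bar> \<le> 2 ^ card I * e\<^sup>2"
    using assms(1,2)
  proof (induction I rule: finite_induct)
    case (insert i I)
    then have IH: "\<bar>?p I\<bar> \<le> 2 ^ card I" "\<bar>?p I - 1\<bar> \<le> 2 ^ card I * e"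
        "\<bar>?p I - 1 - (\<Sum>i\<in>I. x i)\<bar> \<le> 2 ^ card I * e\<^sup>2" by auto
    have xi: "\<bar>x i\<bar> \<le> e" using insert.prems by simp
    have "\<bar>(1 + x i) * ?p I\<bar> \<le> 2 * 2 ^ card I"
      unfolding abs_mult using IH(1) xi assms(3) by (intro mult_mono) auto
    moreover have "\<bar>(1 + x i) * ?p I - 1\<bar> \<le> 2 * 2 ^ card I * e"
    proof -
      have "\<bar>x i * ?p I\<bar> \<le> e * 2 ^ card I"
        unfolding abs_mult using IH(1) xi assms(4) by (intro mult_mono) auto
      moreover have "(1 + x i) * ?p I - 1 = (?p I - 1) + x i * ?p I" by (simp add: algebra_simps)
      ultimately show ?thesis using IH(2) by (simp add: mult.commute)
    qed
    moreover have "\<bar>(1 + x i) * ?p I - 1 - (x i + (\<Sum>i\<in>I. x i))\<bar> \<le> 2 * 2 ^ card I * e\<^sup>2"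
    proof -
      have "\<bar>x i * (?p I - 1)\<bar> \<le> e * (2 ^ card I * e)"
        unfolding abs_mult using IH(2) xi assms(4) by (intro mult_mono) auto
      moreover have "(1 + x i) * ?p I - 1 - (x i + (\<Sum>i\<in>I. x i)) =
          (?p I - 1 - (\<Sum>i\<in>I. x i)) + x i * (?p I - 1)" by (simp add: algebra_simps)
      ultimately show ?thesis using IH(3) by (simp add: power2_eq_square mult_ac)
    qed
    ultimately show ?case using insert.hyps by simp
  qed (use assms(4) in auto)
  then show "\<bar>?p I\<bar> \<le> 2 ^ card I" "\<bar>?p I - 1\<bar> \<le> 2 ^ card I * e"
      "\<bar>?p I - 1 - (\<Sum>i\<in>I. x i)\<bar> \<le> 2 ^ card I * e\<^sup>2" by auto
qed

text \<open>Halving puts all factors into [-1, 1], where the difference of products is at most the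
  sum of the differences; scaling back costs \<open>2 ^ card I\<close>.\<close>

lemma abs_prod_diff_le:
  fixes a b :: "'i \<Rightarrow> real" and e :: real
  assumes "finite I" "\<And>i. i \<in> I \<Longrightarrow> \<bar>a i\<bar> \<le> 2" "\<And>i. i \<in> I \<Longrightarrow> \<bar>b i\<bar> \<le> 2"
    and "\<And>i. i \<in> I \<Longrightarrow> \<bar>a i - b i\<bar> \<le> e"
  shows "\<bar>(\<Prod>i\<in>I. a i) - (\<Prod>i\<in>I. b i)\<bar> \<le> 2 ^ card I * real (card I) * e"
proof -
  have e: "(\<Sum>i\<in>I. \<bar>a i / 2 - b i / 2\<bar>) \<le> (\<Sum>i\<in>I. e)"
    using assms(4) by (intro sum_mono) (force simp: diff_divide_distrib[symmetric])
  have half: "(\<Prod>i\<in>I. c i) = 2 ^ card I * (\<Prod>i\<in>I. c i / 2)" for c :: "'i \<Rightarrow> real"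
    by (simp add: prod_dividef)
  have "\<bar>(\<Prod>i\<in>I. a i / 2) - (\<Prod>i\<in>I. b i / 2)\<bar> \<le> (\<Sum>i\<in>I. \<bar>a i / 2 - b i / 2\<bar>)"
    using norm_prod_diff[of I "\<lambda>i. a i / 2" "\<lambda>i. b i / 2"] assms(2,3) by fastforce
  also have "\<dots> \<le> card I * e" using e by simp
  finally have "2 ^ card I * \<bar>(\<Prod>i\<in>I. a i / 2) - (\<Prod>i\<in>I. b i / 2)\<bar> \<le> 2 ^ card I * (card I * e)"
    by simp
  then show ?thesis
    unfolding half[of a] half[of b] right_diff_distrib[symmetric] abs_mult by (simp add: mult.assoc)
qed

text \<open>Read off the Leibniz formula: \<open>fact n\<close> permutations, each changing by at
  most 2^n n times the change of the entries, or contributing at most 2^n times the squared size in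
  the expansion at the identity. The factor n + 1 covers both cases and keeps the constant at least
  1 for n = 0.\<close>

definition det_const :: "nat \<Rightarrow> real" where
  "det_const n = fact n * (2 ^ n * (real n + 1))"

lemma det_const_ge_1: "det_const n \<ge> 1"
proof -
  have "1 * (1 * 1) \<le> det_const n"
    unfolding det_const_def by (intro mult_mono) (auto simp: fact_ge_1)
  then show ?thesis by simp
qed

lemma card_permutes_upt: "card {p. p permutes {0..<n::nat}} = fact n"
  by (simp add: card_permutations)

lemma abs_signof: "\<bar>signof p :: real\<bar> = 1"
  by (simp add: sign_def)

lemma abs_det_diff_le:
  fixes E F :: "real mat" and e :: real
  assumes "E \<in> carrier_mat n n" "F \<in> carrier_mat n n"
    and "\<And>i j. i < n \<Longrightarrow> j < n \<Longrightarrow> \<bar>E $$ (i, j)\<bar> \<le> 2"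
    and "\<And>i j. i < n \<Longrightarrow> j < n \<Longrightarrow> \<bar>F $$ (i, j)\<bar> \<le> 2"
    and "\<And>i j. i < n \<Longrightarrow> j < n \<Longrightarrow> \<bar>E $$ (i, j) - F $$ (i, j)\<bar> \<le> e" and "0 \<le> e"
  shows "\<bar>Determinant.det E - Determinant.det F\<bar> \<le> det_const n * e"
proof -
  let ?P = "{p. p permutes {0..<n}}"
  have "\<bar>Determinant.det E - Determinant.det F\<bar> =
      \<bar>\<Sum>p\<in>?P. signof p * ((\<Prod>i = 0..<n. E $$ (i, p i)) - (\<Prod>i = 0..<n. F $$ (i, p i)))\<bar>"
    unfolding det_def'[OF assms(1)] det_def'[OF assms(2)] by (simp add: sum_subtractf right_diff_distrib)
  also have "\<dots> \<le> (\<Sum>p\<in>?P. 2 ^ n * real n * e)"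
  proof (rule order.trans[OF sum_abs sum_mono])
    fix p assume "p \<in> ?P"
    then have p: "p i < n" if "i < n" for i
      using permutes_in_image[of p "{0..<n}" i] that by auto
    have "\<bar>(\<Prod>i = 0..<n. E $$ (i, p i)) - (\<Prod>i = 0..<n. F $$ (i, p i))\<bar>
        \<le> 2 ^ card {0..<n} * real (card {0..<n}) * e"
      by (rule abs_prod_diff_le) (use assms p in auto)
    then show "\<bar>signof p * ((\<Prod>i = 0..<n. E $$ (i, p i)) - (\<Prod>i = 0..<n. F $$ (i, p i)))\<bar>
        \<le> 2 ^ n * real n * e"
      unfolding abs_mult abs_signof by simp
  qed
  also have "\<dots> = fact n * (2 ^ n * real n * e)" by (simp add: card_permutes_upt)
  also have "\<dots> \<le> det_const n * e"
    using assms(6) by (simp add: det_const_def algebra_simps)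
  finally show ?thesis .
qed

text \<open>Only the identity permutation contributes below second order. Any other permutation
  moves some i and, being injective, moves \<open>p i\<close> as well, so its product contains two
  off-diagonal factors of size e.\<close>

lemma abs_det_expansion_le:
  fixes E :: "real mat"
  assumes E: "E \<in> carrier_mat n n"
    and e: "\<And>i j. i < n \<Longrightarrow> j < n \<Longrightarrow> \<bar>E $$ (i, j)\<bar> \<le> e" "0 \<le> e" "e \<le> 1"
  shows "\<bar>Determinant.det (1\<^sub>m n + E) - 1 - (\<Sum>i = 0..<n. E $$ (i, i))\<bar> \<le> det_const n * e\<^sup>2"
proof -
  let ?P = "{p. p permutes {0..<n}}"
  let ?M = "1\<^sub>m n + E"
  let ?t = "\<lambda>p. signof p * (\<Prod>i = 0..<n. ?M $$ (i, p i)) :: real"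
  have M: "?M \<in> carrier_mat n n" using E by simp
  have finP: "finite ?P" by (simp add: finite_permutations)
  have idP: "id \<in> ?P" by (simp add: permutes_id)
  have "Determinant.det ?M = ?t id + (\<Sum>p\<in>?P - {id}. ?t p)"
    unfolding det_def'[OF M] using sum.remove[OF finP idP, of ?t] by simp
  moreover have "?t id = (\<Prod>i = 0..<n. 1 + E $$ (i, i))"
    using E by (auto simp: sign_id intro!: prod.cong)
  moreover have "\<bar>(\<Prod>i = 0..<n. 1 + E $$ (i, i)) - 1 - (\<Sum>i = 0..<n. E $$ (i, i))\<bar> \<le> 2 ^ n * e\<^sup>2"
    using abs_prod_add_one_le(3)[of "{0..<n}" "\<lambda>i. E $$ (i, i)" e] e by simp
  moreover have "\<bar>\<Sum>p\<in>?P - {id}. ?t p\<bar> \<le> (\<Sum>p\<in>?P - {id}. 2 ^ n * e\<^sup>2)"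
  proof (rule order.trans[OF sum_abs sum_mono])
    fix p assume p: "p \<in> ?P - {id}"
    then have pn: "p i < n" if "i < n" for i
      using permutes_in_image[of p "{0..<n}" i] that by auto
    obtain i where i: "p i \<noteq> i" using p by (metis DiffD2 eq_id_iff insertI1)
    then have "i < n" using p by (auto simp: permutes_def)
    define j where "j = p i"
    have j: "j < n" "p j \<noteq> j" "j \<noteq> i"
      using i pn[OF \<open>i < n\<close>] p permutes_inj[of p "{0..<n}"] by (auto simp: j_def inj_def)
    have le2: "\<bar>?M $$ (k, l)\<bar> \<le> 2" if "k < n" "l < n" for k l
      using e(1)[OF that] e(3) E that by auto
    have lee: "\<bar>?M $$ (k, p k)\<bar> \<le> e" if "k < n" "p k \<noteq> k" for k
      using e(1)[OF that(1) pn[OF that(1)]] E that pn[OF that(1)] by auto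
    have "(\<Prod>k = 0..<n. \<bar>?M $$ (k, p k)\<bar>) =
        \<bar>?M $$ (i, p i)\<bar> * (\<bar>?M $$ (j, p j)\<bar> * (\<Prod>k\<in>{0..<n} - {i} - {j}. \<bar>?M $$ (k, p k)\<bar>))"
      using \<open>i < n\<close> j by (subst prod.remove[of _ i], simp, simp, subst prod.remove[of _ j]) auto
    also have "\<dots> \<le> e * (e * 2 ^ n)"
    proof (intro mult_mono)
      have "(\<Prod>k\<in>{0..<n} - {i} - {j}. \<bar>?M $$ (k, p k)\<bar>) \<le> (\<Prod>k\<in>{0..<n} - {i} - {j}. 2)"
        using pn le2 by (intro prod_mono) auto
      also have "\<dots> \<le> 2 ^ n"
        unfolding prod_constant by (rule power_increasing) (auto intro: order.trans[OF card_mono[of "{0..<n}"]])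
      finally show "(\<Prod>k\<in>{0..<n} - {i} - {j}. \<bar>?M $$ (k, p k)\<bar>) \<le> 2 ^ n" .
    qed (use lee[OF \<open>i < n\<close> i] lee[OF j(1,2)] e(2) in \<open>auto intro!: mult_nonneg_nonneg prod_nonneg\<close>)
    finally have "(\<Prod>k = 0..<n. \<bar>?M $$ (k, p k)\<bar>) \<le> 2 ^ n * e\<^sup>2" by (simp add: power2_eq_square mult_ac)
    then show "\<bar>?t p\<bar> \<le> 2 ^ n * e\<^sup>2"
      unfolding abs_mult abs_signof by (simp add: abs_prod)
  qed
  moreover have "(\<Sum>p\<in>?P - {id}. 2 ^ n * e\<^sup>2) + 2 ^ n * e\<^sup>2 = fact n * (2 ^ n * e\<^sup>2)"
    using sum.remove[OF finP idP, of "\<lambda>_. 2 ^ n * e\<^sup>2"]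
    unfolding sum_constant card_permutes_upt by simp
  moreover have "fact n * (2 ^ n * e\<^sup>2) \<le> det_const n * e\<^sup>2"
    by (simp add: det_const_def algebra_simps)
  ultimately show ?thesis by linarith
qed

text \<open>Sylvester's identity. \<open>R\<close> is unipotent, and multiplying \<open>N\<close> by
  it on the right or on the left clears the upper right block, leaving \<open>1 + Q * P\<close> or
  \<open>1 + P * Q\<close> on the diagonal.\<close>

lemma det_one_add_mult_commute:
  fixes P Q :: "real mat"
  assumes P: "P \<in> carrier_mat d n" and Q: "Q \<in> carrier_mat n d"
  shows "Determinant.det (1\<^sub>m d + P * Q) = Determinant.det (1\<^sub>m n + Q * P)"
proof -
  define N where "N = four_block_mat (1\<^sub>m d) (- P) Q (1\<^sub>m n)"
  define R where "R = four_block_mat (1\<^sub>m d) P (0\<^sub>m n d) (1\<^sub>m n)"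
  have c: "- P \<in> carrier_mat d n" "1\<^sub>m d \<in> carrier_mat d d" "1\<^sub>m n \<in> carrier_mat n n"
      "0\<^sub>m n d \<in> carrier_mat n d" using P by auto
  have N: "N \<in> carrier_mat (d + n) (d + n)" and R: "R \<in> carrier_mat (d + n) (d + n)"
    unfolding N_def R_def by auto
  have detR: "Determinant.det R = 1"
    unfolding R_def using P by (subst det_four_block_mat_lower_left_zero[where n = d and m = n]) auto
  have "N * R = four_block_mat (1\<^sub>m d) (0\<^sub>m d n) Q (1\<^sub>m n + Q * P)"
    unfolding N_def R_def
    by (subst mult_four_block_mat[OF c(2,1) Q c(3) c(2) P c(4) c(3)])
      (use P Q in \<open>auto intro!: arg_cong4[where f = four_block_mat] simp: comm_add_mat[where nr = n]\<close>)
  then have "Determinant.det (N * R) = Determinant.det (1\<^sub>m n + Q * P)"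
    using P Q by (simp add: det_four_block_mat_upper_right_zero[where n = d and m = n])
  moreover have "R * N = four_block_mat (1\<^sub>m d + P * Q) (0\<^sub>m d n) Q (1\<^sub>m n)"
    unfolding N_def R_def
    by (subst mult_four_block_mat[OF c(2) P c(4) c(3) c(2,1) Q c(3)])
      (use P Q in \<open>auto intro!: arg_cong4[where f = four_block_mat]\<close>)
  then have "Determinant.det (R * N) = Determinant.det (1\<^sub>m d + P * Q)"
    using P Q by (simp add: det_four_block_mat_upper_right_zero[where n = d and m = n])
  ultimately show ?thesis
    using det_mult[OF N R] det_mult[OF R N] detR by simp
qed


section \<open>The Jacobian as a determinant in a fixed basis\<close>

definition basis_enum :: "nat \<Rightarrow> 'a::euclidean_space" where
  "basis_enum = (SOME e. bij_betw e {0..<DIM('a)} Basis)"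

lemma bij_betw_basis_enum: "bij_betw (basis_enum :: nat \<Rightarrow> 'a::euclidean_space) {0..<DIM('a)} Basis"
  unfolding basis_enum_def
  by (rule someI_ex[of "\<lambda>e. bij_betw e {0..<DIM('a)} Basis"]) (rule ex_bij_betw_nat_finite[OF finite_Basis])

lemma sum_basis_enum: "(\<Sum>k = 0..<DIM('a). g (basis_enum k)) = (\<Sum>b\<in>Basis. g (b::'a::euclidean_space))"
  using bij_betw_basis_enum by (rule sum.reindex_bij_betw)

lemma norm_basis_enum: "k < DIM('a) \<Longrightarrow> norm (basis_enum k :: 'a::euclidean_space) = 1"
  using bij_betwE[OF bij_betw_basis_enum[where 'a = 'a]] by (simp add: norm_Basis)

text \<open>\<open>strain A\<close> is the bilinear form of \<open>(I + A)\<^sup>t (I + A) - I\<close>.\<close>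

definition strain :: "('a::euclidean_space \<Rightarrow>\<^sub>L 'a) \<Rightarrow> 'a \<Rightarrow> 'a \<Rightarrow> real" where
  "strain A x y = inner x (blinfun_apply A y) + inner (blinfun_apply A x) y
     + inner (blinfun_apply A x) (blinfun_apply A y)"

lemma strain_sum_right:
  "strain A x (\<Sum>i\<in>I. c i *\<^sub>R v i) = (\<Sum>i\<in>I. c i * strain A x (v i))"
  by (simp add: strain_def blinfun.sum_right blinfun.scaleR_right inner_sum_right sum.distrib
      sum_distrib_left distrib_left)

lemma strain_sum_left:
  "strain A (\<Sum>i\<in>I. c i *\<^sub>R v i) x = (\<Sum>i\<in>I. c i * strain A (v i) x)"
  by (simp add: strain_def blinfun.sum_right blinfun.scaleR_right inner_sum_left sum.distrib
      sum_distrib_left distrib_left)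

lemma abs_strain_le:
  assumes "norm A \<le> \<alpha>" "\<alpha> \<le> 1"
  shows "\<bar>strain A x y\<bar> \<le> 3 * \<alpha> * (norm x * norm y)"
proof -
  have a0: "0 \<le> \<alpha>" using assms norm_ge_zero order_trans by blast
  have n: "norm (blinfun_apply A z) \<le> \<alpha> * norm z" for z
    using norm_blinfun[of A z] assms(1) by (meson dual_order.trans mult_right_mono norm_ge_zero)
  have "\<bar>inner x (blinfun_apply A y)\<bar> \<le> norm x * (\<alpha> * norm y)"
    by (rule order.trans[OF Cauchy_Schwarz_ineq2 mult_left_mono[OF n]]) simp
  moreover have "\<bar>inner (blinfun_apply A x) y\<bar> \<le> (\<alpha> * norm x) * norm y"
    by (rule order.trans[OF Cauchy_Schwarz_ineq2 mult_right_mono[OF n]]) simp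
  moreover have "\<bar>inner (blinfun_apply A x) (blinfun_apply A y)\<bar> \<le> (1 * norm x) * (\<alpha> * norm y)"
  proof (rule order.trans[OF Cauchy_Schwarz_ineq2 mult_mono[OF _ n]])
    show "norm (blinfun_apply A x) \<le> 1 * norm x"
      using n[of x] assms(2) by (meson dual_order.trans mult_right_mono norm_ge_zero)
  qed auto
  ultimately show ?thesis unfolding strain_def by (simp add: algebra_simps)
qed

lemma abs_strain_diff_le:
  assumes "norm A \<le> 1" "norm B \<le> 1"
  shows "\<bar>strain A x y - strain B x y\<bar> \<le> 4 * norm (A - B) * (norm x * norm y)"
proof -
  let ?e = "norm (A - B)"
  have n: "norm (blinfun_apply (A - B) z) \<le> ?e * norm z" for z by (rule norm_blinfun)
  have nA: "norm (blinfun_apply A z) \<le> norm z" for z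
    using norm_blinfun[of A z] mult_right_mono[OF assms(1), of "norm z"] by simp
  have nB: "norm (blinfun_apply B z) \<le> norm z" for z
    using norm_blinfun[of B z] mult_right_mono[OF assms(2), of "norm z"] by simp
  have "strain A x y - strain B x y = inner x (blinfun_apply (A - B) y)
      + inner (blinfun_apply (A - B) x) y + inner (blinfun_apply A x) (blinfun_apply (A - B) y)
      + inner (blinfun_apply (A - B) x) (blinfun_apply B y)"
    by (simp add: strain_def blinfun.diff_left inner_diff_left inner_diff_right)
  moreover have "\<bar>inner x (blinfun_apply (A - B) y)\<bar> \<le> norm x * (?e * norm y)"
    by (rule order.trans[OF Cauchy_Schwarz_ineq2 mult_left_mono[OF n]]) simp
  moreover have "\<bar>inner (blinfun_apply (A - B) x) y\<bar> \<le> (?e * norm x) * norm y"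
    by (rule order.trans[OF Cauchy_Schwarz_ineq2 mult_right_mono[OF n]]) simp
  moreover have "\<bar>inner (blinfun_apply A x) (blinfun_apply (A - B) y)\<bar> \<le> norm x * (?e * norm y)"
    by (rule order.trans[OF Cauchy_Schwarz_ineq2 mult_mono[OF nA n]]) auto
  moreover have "\<bar>inner (blinfun_apply (A - B) x) (blinfun_apply B y)\<bar> \<le> (?e * norm x) * norm y"
    by (rule order.trans[OF Cauchy_Schwarz_ineq2 mult_mono[OF n nB]]) auto
  ultimately show ?thesis by (simp add: algebra_simps)
qed

text \<open>The plane sits in one slot only, so the matrix is linear in S (and in general not
  symmetric); estimates in S then need no choice of a basis of the plane.\<close>

definition strain_mat :: "('a::euclidean_space \<Rightarrow>\<^sub>L 'a) \<Rightarrow> ('a \<Rightarrow>\<^sub>L 'a) \<Rightarrow> real mat" where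
  "strain_mat A S = Matrix.mat DIM('a) DIM('a)
     (\<lambda>(k, l). strain A (blinfun_apply S (basis_enum k)) (basis_enum l))"

lemma strain_mat_carrier:
  "strain_mat A (S :: 'a::euclidean_space \<Rightarrow>\<^sub>L 'a) \<in> carrier_mat DIM('a) DIM('a)"
  by (simp add: strain_mat_def)

lemma orthonormal_basis_expansion:
  assumes S: "S \<in> grassmannian d" and s: "orthonormal_basis d (subspace_of S) s"
  shows "(\<Sum>i<d. inner x (s i) *\<^sub>R s i) = blinfun_apply S x"
proof -
  let ?z = "blinfun_apply S x - (\<Sum>i<d. inner x (s i) *\<^sub>R s i)"
  have sub: "subspace (subspace_of S)" using grassmannianD(1)[OF S] .
  have span: "span (s ` {..<d}) = subspace_of S"
    and on: "\<And>i j. i < d \<Longrightarrow> j < d \<Longrightarrow> inner (s i) (s j) = (if i = j then 1 else 0)"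
    using s by (auto simp: orthonormal_basis_def)
  have si: "s i \<in> subspace_of S" if "i < d" for i
    using span that by (metis imageI lessThan_iff span_base)
  have zS: "?z \<in> subspace_of S"
    using sub si by (intro subspace_diff subspace_sum subspace_scale) (auto simp: subspace_of_def)
  have "orthogonal ?z (s j)" if j: "j < d" for j
  proof -
    have "inner (blinfun_apply S x) (s j) = inner x (s j)"
      using grassmannian_self_adjoint[OF S, of x "s j"]
        orth_proj_fixes[OF sub si[OF j]] grassmannianD(3)[OF S] by simp
    moreover have "inner (\<Sum>i<d. inner x (s i) *\<^sub>R s i) (s j) = (\<Sum>i<d. if i = j then inner x (s j) else 0)"
      unfolding inner_sum_left using on j by (intro sum.cong) auto
    ultimately show ?thesis using j by (simp add: orthogonal_def inner_diff_left)
  qed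
  then have "orthogonal ?z y" if "y \<in> s ` {..<d}" for y using that by auto
  then have "orthogonal ?z ?z"
    using orthogonal_to_span[of ?z "s ` {..<d}" ?z] zS span by blast
  then show ?thesis by (simp add: orthogonal_def)
qed

text \<open>The Gram matrix of the images of the chosen basis is I + P Q, where \<open>P\<close>
  holds the strains against the fixed basis and \<open>Q\<close> the coordinates of the chosen one.
  Commuting the factors moves the chosen vectors into an inner sum.\<close>

lemma tangential_jacobian_eq:
  fixes S :: "'a::euclidean_space \<Rightarrow>\<^sub>L 'a"
  assumes S: "S \<in> grassmannian d"
    and f: "frechet_derivative f (at x) = (\<lambda>v. v + blinfun_apply A v)"
  shows "tangential_jacobian d f x S =
    sqrt (Determinant.det (1\<^sub>m DIM('a) + strain_mat A S))"
proof -
  let ?n = "DIM('a)"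
  let ?e = "basis_enum :: nat \<Rightarrow> 'a"
  define s where "s = (SOME s. orthonormal_basis d (subspace_of S) s)"
  have s: "orthonormal_basis d (subspace_of S) s"
    unfolding s_def by (rule someI_ex[OF orthonormal_basis_exists[OF grassmannianD(1,2)[OF S]]])
  have on: "\<And>i j. i < d \<Longrightarrow> j < d \<Longrightarrow> inner (s i) (s j) = (if i = j then 1 else 0)"
    using s by (auto simp: orthonormal_basis_def)
  define P where "P = Matrix.mat d ?n (\<lambda>(i, k). strain A (s i) (?e k))"
  define Q where "Q = Matrix.mat ?n d (\<lambda>(k, j). inner (?e k) (s j))"
  have P: "P \<in> carrier_mat d ?n" and Q: "Q \<in> carrier_mat ?n d" by (simp_all add: P_def Q_def)
  have exp: "(\<Sum>k = 0..<?n. inner (?e k) y *\<^sub>R ?e k) = y" for y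
    using sum_basis_enum[of "\<lambda>b. inner b y *\<^sub>R b"] euclidean_representation[of y] by (simp add: inner_commute)
  have "Matrix.mat d d (\<lambda>(i, j). inner (s i + blinfun_apply A (s i)) (s j + blinfun_apply A (s j)))
      = 1\<^sub>m d + P * Q" (is "?G = _")
  proof (rule eq_matI)
    fix i j assume "i < dim_row (1\<^sub>m d + P * Q)" "j < dim_col (1\<^sub>m d + P * Q)"
    then have ij: "i < d" "j < d" using P Q by auto
    have "(P * Q) $$ (i, j) = (\<Sum>k = 0..<?n. inner (?e k) (s j) * strain A (s i) (?e k))"
      using ij by (simp add: P_def Q_def scalar_prod_def mult.commute)
    also have "\<dots> = strain A (s i) (s j)"
      unfolding strain_sum_right[symmetric] exp ..
    finally show "?G $$ (i, j) = (1\<^sub>m d + P * Q) $$ (i, j)"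
      using ij P Q on by (simp add: strain_def inner_add_left inner_add_right)
  qed (use P Q in auto)
  \<comment> \<open>Summing over the basis of the plane reproduces the projection S, so the choice
    disappears.\<close>
  moreover have "strain_mat A S = Q * P"
  proof (rule eq_matI)
    fix k l assume "k < dim_row (Q * P)" "l < dim_col (Q * P)"
    then have kl: "k < ?n" "l < ?n" using P Q by auto
    have "(Q * P) $$ (k, l) = (\<Sum>i<d. inner (?e k) (s i) * strain A (s i) (?e l))"
      using kl by (simp add: P_def Q_def scalar_prod_def atLeast0LessThan)
    also have "\<dots> = strain A (blinfun_apply S (?e k)) (?e l)"
      unfolding strain_sum_left[symmetric] orthonormal_basis_expansion[OF S s] ..
    finally show "strain_mat A S $$ (k, l) = (Q * P) $$ (k, l)"
      using kl by (simp add: strain_mat_def)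
  qed (use P Q strain_mat_carrier[of A S] in auto)
  ultimately show ?thesis
    using det_one_add_mult_commute[OF P Q]
    unfolding tangential_jacobian_def Let_def f s_def[symmetric] by simp
qed

lemma abs_strain_mat_le:
  fixes S :: "'a::euclidean_space \<Rightarrow>\<^sub>L 'a"
  assumes "S \<in> grassmannian d" "norm A \<le> \<alpha>" "\<alpha> \<le> 1" "k < DIM('a)" "l < DIM('a)"
  shows "\<bar>strain_mat A S $$ (k, l)\<bar> \<le> 3 * \<alpha>"
proof -
  have a0: "0 \<le> \<alpha>" using assms(2) norm_ge_zero order_trans by blast
  have "norm (blinfun_apply S (basis_enum k)) * norm (basis_enum l :: 'a) \<le> 1"
    using norm_grassmannian_apply[OF assms(1), of "basis_enum k"]
      norm_basis_enum[OF assms(4)] norm_basis_enum[OF assms(5)] by simp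
  then show ?thesis
    using abs_strain_le[OF assms(2,3), of "blinfun_apply S (basis_enum k)" "basis_enum l"] assms(4,5) a0
    by (simp add: strain_mat_def) (smt (verit) mult_left_le)
qed

lemma abs_strain_mat_diff_le:
  fixes S :: "'a::euclidean_space \<Rightarrow>\<^sub>L 'a"
  assumes S: "S \<in> grassmannian d" and T: "T \<in> grassmannian d"
    and A: "norm A \<le> \<alpha>" and B: "norm B \<le> \<alpha>" and \<alpha>: "\<alpha> \<le> 1" and kl: "k < DIM('a)" "l < DIM('a)"
  shows "\<bar>strain_mat A S $$ (k, l) - strain_mat B T $$ (k, l)\<bar> \<le> 3 * \<alpha> * norm (S - T) + 4 * norm (A - B)"
proof -
  let ?k = "basis_enum k :: 'a" and ?l = "basis_enum l :: 'a"
  have a0: "0 \<le> \<alpha>" using A norm_ge_zero order_trans by blast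
  have n1: "norm ?k = 1" "norm ?l = 1" using norm_basis_enum kl by auto
  have "\<bar>strain A (blinfun_apply (S - T) ?k) ?l\<bar> \<le> 3 * \<alpha> * (norm (blinfun_apply (S - T) ?k) * norm ?l)"
    by (rule abs_strain_le[OF A \<alpha>])
  also have "\<dots> \<le> 3 * \<alpha> * norm (S - T)"
    using norm_blinfun[of "S - T" ?k] a0 n1 by (intro mult_left_mono) auto
  finally have 1: "\<bar>strain A (blinfun_apply (S - T) ?k) ?l\<bar> \<le> 3 * \<alpha> * norm (S - T)" .
  have "\<bar>strain A (blinfun_apply T ?k) ?l - strain B (blinfun_apply T ?k) ?l\<bar>
      \<le> 4 * norm (A - B) * (norm (blinfun_apply T ?k) * norm ?l)"
    by (rule abs_strain_diff_le) (use A B \<alpha> in auto)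
  also have "\<dots> \<le> 4 * norm (A - B) * 1"
    using norm_grassmannian_apply[OF T, of ?k] n1 by (intro mult_left_mono) auto
  finally have 2: "\<bar>strain A (blinfun_apply T ?k) ?l - strain B (blinfun_apply T ?k) ?l\<bar> \<le> 4 * norm (A - B)"
    by simp
  have "strain A (blinfun_apply S ?k) ?l =
      strain A (blinfun_apply (S - T) ?k) ?l + strain A (blinfun_apply T ?k) ?l"
    by (simp add: strain_def blinfun.diff_left blinfun.diff_right inner_diff_left inner_diff_right)
  then show ?thesis using 1 2 kl by (simp add: strain_mat_def)
qed


section \<open>Size and Lipschitz bounds of the Jacobian\<close>

definition jac_const :: "'a::euclidean_space itself \<Rightarrow> real" where
  "jac_const _ = det_const DIM('a)"

lemma jac_const_ge_1: "jac_const TYPE('a::euclidean_space) \<ge> 1"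
  by (simp add: jac_const_def det_const_ge_1)

text \<open>The threshold for \<alpha> keeps the determinant within 3/4 of 1, hence at least 1/4,
  and on [1/4, \<infinity>) the square root is 1-Lipschitz. The Jacobian therefore inherits the
  bounds of the determinant.\<close>

lemma perturbation_size:
  assumes a0: "0 \<le> \<alpha>" and \<alpha>: "\<alpha> \<le> 1 / (4 * jac_const TYPE('a::euclidean_space))"
  shows "\<alpha> \<le> 1/4" "jac_const TYPE('a) * (3 * \<alpha>) \<le> 3/4"
proof -
  have C: "jac_const TYPE('a) \<ge> 1" by (rule jac_const_ge_1)
  have *: "jac_const TYPE('a) * \<alpha> \<le> 1/4"
    using mult_left_mono[OF \<alpha>, of "jac_const TYPE('a)"] C by simp
  moreover have "1 * \<alpha> \<le> jac_const TYPE('a) * \<alpha>" using C a0 by (intro mult_right_mono) auto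
  ultimately show "\<alpha> \<le> 1/4" by simp
  have "jac_const TYPE('a) * (3 * \<alpha>) = 3 * (jac_const TYPE('a) * \<alpha>)" by simp
  then show "jac_const TYPE('a) * (3 * \<alpha>) \<le> 3/4" using * by linarith
qed

lemma abs_sqrt_diff_le:
  assumes "1/4 \<le> a" "1/4 \<le> b"
  shows "\<bar>sqrt a - sqrt b\<bar> \<le> \<bar>a - b\<bar>"
proof -
  have half: "1/2 \<le> sqrt c" if "1/4 \<le> c" for c
    using real_le_rsqrt[of "1/2" c] that by (simp add: power2_eq_square)
  have "a - b = (sqrt a - sqrt b) * (sqrt a + sqrt b)"
    using assms by (simp add: algebra_simps)
  then have "\<bar>a - b\<bar> = \<bar>sqrt a - sqrt b\<bar> * (sqrt a + sqrt b)"
    using half[OF assms(1)] half[OF assms(2)] by (simp add: abs_mult)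
  moreover have "\<bar>sqrt a - sqrt b\<bar> * 1 \<le> \<bar>sqrt a - sqrt b\<bar> * (sqrt a + sqrt b)"
    using half[OF assms(1)] half[OF assms(2)] by (intro mult_left_mono) auto
  ultimately show ?thesis by simp
qed

text \<open>The identity tr(A S) = tr(S A) for self-adjoint S: both linear terms of the strain have
  the same trace, the divergence of A along the plane.\<close>

lemma sum_Basis_inner_commute:
  fixes A S :: "'a::euclidean_space \<Rightarrow>\<^sub>L 'a"
  assumes S: "S \<in> grassmannian d"
  shows "(\<Sum>b\<in>Basis. inner (blinfun_apply A (blinfun_apply S b)) b)
    = (\<Sum>b\<in>Basis. inner (blinfun_apply S b) (blinfun_apply A b))"
proof -
  have "inner (blinfun_apply A (blinfun_apply S b)) b
      = (\<Sum>c\<in>Basis. inner (blinfun_apply A c) b * inner (blinfun_apply S c) b)" for b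
  proof -
    have "blinfun_apply A (blinfun_apply S b) =
        blinfun_apply A (\<Sum>c\<in>Basis. inner (blinfun_apply S b) c *\<^sub>R c)"
      by (simp add: euclidean_representation)
    then have "inner (blinfun_apply A (blinfun_apply S b)) b
        = (\<Sum>c\<in>Basis. inner (blinfun_apply S b) c * inner (blinfun_apply A c) b)"
      by (simp add: blinfun.sum_right blinfun.scaleR_right inner_sum_left)
    moreover have "inner (blinfun_apply S b) c = inner (blinfun_apply S c) b" for c
      using grassmannian_self_adjoint[OF S, of b c] by (simp add: inner_commute)
    ultimately show ?thesis by (simp add: mult.commute)
  qed
  then have "(\<Sum>b\<in>Basis. inner (blinfun_apply A (blinfun_apply S b)) b)
      = (\<Sum>c\<in>Basis. \<Sum>b\<in>Basis. inner (blinfun_apply A c) b * inner (blinfun_apply S c) b)"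
    by (simp only:) (rule sum.swap)
  then show ?thesis unfolding euclidean_inner[symmetric] by (simp only: inner_commute)
qed

context
  fixes \<alpha> :: real and A S :: "'a::euclidean_space \<Rightarrow>\<^sub>L 'a" and f :: "'a \<Rightarrow> 'a" and x :: 'a and d :: nat
  assumes \<alpha>_small: "\<alpha> \<le> 1 / (4 * jac_const TYPE('a))"
    and S: "S \<in> grassmannian d" and A: "norm A \<le> \<alpha>"
    and f: "frechet_derivative f (at x) = (\<lambda>v. v + blinfun_apply A v)"
begin

lemma \<alpha>: "0 \<le> \<alpha>" "\<alpha> \<le> 1/4" "jac_const TYPE('a) * (3 * \<alpha>) \<le> 3/4"
  using order.trans[OF norm_ge_zero A] perturbation_size[OF _ \<alpha>_small] by auto

lemma abs_det_strain_le:
  "\<bar>Determinant.det (1\<^sub>m DIM('a) + strain_mat A S) - 1\<bar> \<le> jac_const TYPE('a) * (3 * \<alpha>)"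
proof -
  have "\<bar>Determinant.det (1\<^sub>m DIM('a) + strain_mat A S) - Determinant.det (1\<^sub>m DIM('a))\<bar>
      \<le> det_const DIM('a) * (3 * \<alpha>)"
    using abs_strain_mat_le[OF S A] \<alpha>(1,2) strain_mat_carrier[of A S]
    by (intro abs_det_diff_le) (fastforce simp: abs_le_iff)+
  then show ?thesis by (simp add: jac_const_def)
qed

lemma tangential_jacobian_near_1:
  "\<bar>tangential_jacobian d f x S - 1\<bar> \<le> jac_const TYPE('a) * (3 * \<alpha>)" "0 \<le> tangential_jacobian d f x S"
proof -
  let ?D = "Determinant.det (1\<^sub>m DIM('a) + strain_mat A S)"
  have D: "1/4 \<le> ?D" using abs_det_strain_le \<alpha>(3) by linarith
  have "\<bar>sqrt ?D - sqrt 1\<bar> \<le> \<bar>?D - 1\<bar>" by (rule abs_sqrt_diff_le[OF D]) simp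
  then show "\<bar>tangential_jacobian d f x S - 1\<bar> \<le> jac_const TYPE('a) * (3 * \<alpha>)"
    using abs_det_strain_le tangential_jacobian_eq[OF S f] by simp
  show "0 \<le> tangential_jacobian d f x S"
    using D tangential_jacobian_eq[OF S f] by simp
qed

text \<open>The concave bound sqrt D \<le> 1 + (D - 1)/2 turns the trace 2 tr(S A) into the
  divergence with coefficient exactly 1, and an upper bound is all that the mass estimate uses. The
  remainder is n \<alpha>^2 from the quadratic part of the strain and 9 \<open>jac_const\<close>
  \<alpha>^2 from the determinant, halved and rounded up.\<close>

lemma tangential_jacobian_le:
  "tangential_jacobian d f x S \<le> 1 + (\<Sum>b\<in>Basis. inner (blinfun_apply S b) (blinfun_apply A b))
     + (DIM('a) + 5 * jac_const TYPE('a)) * \<alpha>\<^sup>2"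
proof -
  let ?n = "DIM('a)"
  let ?D = "Determinant.det (1\<^sub>m ?n + strain_mat A S)"
  have D: "1/4 \<le> ?D" using abs_det_strain_le \<alpha>(3) by linarith
  have J: "tangential_jacobian d f x S \<le> 1 + (?D - 1) / 2"
  proof -
    have "?D \<le> (1 + (?D - 1) / 2)\<^sup>2"
      using zero_le_power2[of "?D - 1"] by (simp add: power2_eq_square field_simps)
    moreover have "0 \<le> 1 + (?D - 1) / 2" using D by argo
    ultimately have "sqrt ?D \<le> 1 + (?D - 1) / 2" using D by (intro real_le_lsqrt) auto
    then show ?thesis using tangential_jacobian_eq[OF S f] by simp
  qed
  have "\<bar>?D - 1 - (\<Sum>k = 0..<?n. strain_mat A S $$ (k, k))\<bar> \<le> det_const ?n * (3 * \<alpha>)\<^sup>2"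
    using abs_strain_mat_le[OF S A] \<alpha>(1,2)
    by (intro abs_det_expansion_le strain_mat_carrier) auto
  then have "?D - 1 \<le> (\<Sum>k = 0..<?n. strain_mat A S $$ (k, k)) + 9 * jac_const TYPE('a) * \<alpha>\<^sup>2"
    by (simp add: jac_const_def power_mult_distrib)
  also have "(\<Sum>k = 0..<?n. strain_mat A S $$ (k, k)) = (\<Sum>b\<in>Basis. strain A (blinfun_apply S b) b)"
    by (subst sum_basis_enum[symmetric]) (simp add: strain_mat_def)
  also have "\<dots> = 2 * (\<Sum>b\<in>Basis. inner (blinfun_apply S b) (blinfun_apply A b))
      + (\<Sum>b\<in>Basis. inner (blinfun_apply A (blinfun_apply S b)) (blinfun_apply A b))"
    by (simp add: strain_def sum.distrib sum_Basis_inner_commute[OF S])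
  also have "(\<Sum>b\<in>Basis. inner (blinfun_apply A (blinfun_apply S b)) (blinfun_apply A b)) \<le> (\<Sum>b\<in>(Basis::'a set). \<alpha>\<^sup>2)"
  proof (rule sum_mono)
    fix b :: 'a assume b: "b \<in> Basis"
    have n: "norm (blinfun_apply A z) \<le> \<alpha>" if "norm z \<le> 1" for z
      using norm_blinfun[of A z] mult_mono[OF A that] \<alpha>(1) by simp
    have "inner (blinfun_apply A (blinfun_apply S b)) (blinfun_apply A b)
        \<le> norm (blinfun_apply A (blinfun_apply S b)) * norm (blinfun_apply A b)"
      by (rule norm_cauchy_schwarz)
    also have "\<dots> \<le> \<alpha> * \<alpha>"
      using norm_grassmannian_apply[OF S, of b] b \<alpha>(1) by (intro mult_mono n) auto
    finally show "inner (blinfun_apply A (blinfun_apply S b)) (blinfun_apply A b) \<le> \<alpha>\<^sup>2"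
      by (simp add: power2_eq_square)
  qed
  finally have "?D - 1 \<le> 2 * (\<Sum>b\<in>Basis. inner (blinfun_apply S b) (blinfun_apply A b)) + ?n * \<alpha>\<^sup>2
      + 9 * jac_const TYPE('a) * \<alpha>\<^sup>2" by simp
  moreover have "0 \<le> ?n * \<alpha>\<^sup>2" "0 \<le> jac_const TYPE('a) * \<alpha>\<^sup>2"
    using jac_const_ge_1[where 'a = 'a] by auto
  moreover have "u \<le> 1 + t + (a + 5 * b)"
    if "v - 1 \<le> 2 * t + a + 9 * b" "0 \<le> a" "0 \<le> b" "u \<le> 1 + (v - 1) / 2" for u v t a b :: real
    using that by argo
  ultimately show ?thesis using J unfolding distrib_right mult.assoc by blast
qed

end

text \<open>The matrix is linear in the plane with size 3 \<alpha>, so turning the plane changes the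
  Jacobian by O(\<alpha>) only. This keeps the loss per step proportional to its length.\<close>

lemma abs_tangential_jacobian_diff_le:
  fixes A B S T :: "'a::euclidean_space \<Rightarrow>\<^sub>L 'a"
  assumes \<alpha>: "\<alpha> \<le> 1 / (4 * jac_const TYPE('a))"
    and S: "S \<in> grassmannian d" and T: "T \<in> grassmannian d"
    and A: "norm A \<le> \<alpha>" and B: "norm B \<le> \<alpha>"
    and f: "frechet_derivative f (at x) = (\<lambda>v. v + blinfun_apply A v)"
    and g: "frechet_derivative g (at y) = (\<lambda>v. v + blinfun_apply B v)"
  shows "\<bar>tangential_jacobian d f x S - tangential_jacobian d g y T\<bar>
    \<le> jac_const TYPE('a) * (3 * \<alpha> * norm (S - T) + 4 * norm (A - B))"
proof -
  let ?n = "DIM('a)"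
  let ?D = "Determinant.det (1\<^sub>m ?n + strain_mat A S)"
  let ?E = "Determinant.det (1\<^sub>m ?n + strain_mat B T)"
  note p = order.trans[OF norm_ge_zero A] perturbation_size[OF order.trans[OF norm_ge_zero A] \<alpha>]
  have "1/4 \<le> ?D" using abs_det_strain_le[OF \<alpha> S A f] p(3) by linarith
  moreover have "1/4 \<le> ?E" using abs_det_strain_le[OF \<alpha> T B g] p(3) by linarith
  ultimately have "\<bar>sqrt ?D - sqrt ?E\<bar> \<le> \<bar>?D - ?E\<bar>" by (rule abs_sqrt_diff_le)
  also have "\<dots> \<le> det_const ?n * (3 * \<alpha> * norm (S - T) + 4 * norm (A - B))"
  proof (rule abs_det_diff_le)
    fix i j assume ij: "i < ?n" "j < ?n"
    have c: "strain_mat A S \<in> carrier_mat ?n ?n" "strain_mat B T \<in> carrier_mat ?n ?n"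
      by (rule strain_mat_carrier)+
    show "\<bar>(1\<^sub>m ?n + strain_mat A S) $$ (i, j)\<bar> \<le> 2"
      using abs_strain_mat_le[OF S A _ ij] p(1,2) c ij by auto
    show "\<bar>(1\<^sub>m ?n + strain_mat B T) $$ (i, j)\<bar> \<le> 2"
      using abs_strain_mat_le[OF T B _ ij] p(1,2) c ij by auto
    show "\<bar>(1\<^sub>m ?n + strain_mat A S) $$ (i, j) - (1\<^sub>m ?n + strain_mat B T) $$ (i, j)\<bar>
        \<le> 3 * \<alpha> * norm (S - T) + 4 * norm (A - B)"
      using abs_strain_mat_diff_le[OF S T A B _ ij] p(1,2) c ij by auto
  qed (use p(1) strain_mat_carrier[of A S] strain_mat_carrier[of B T] in auto)
  finally show ?thesis
    using tangential_jacobian_eq[OF S f] tangential_jacobian_eq[OF T g] by (simp add: jac_const_def)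
qed

section \<open>The bounded Lipschitz distance of varifolds\<close>

abbreviation plane_bundle :: "nat \<Rightarrow> ('a \<times> ('a::euclidean_space \<Rightarrow>\<^sub>L 'a)) set" where
  "plane_bundle d \<equiv> UNIV \<times> grassmannian d"

text \<open>Records what the estimates pass from node to node: the sigma-algebra, which makes
  continuous functions on the bundle measurable, and the mass.\<close>

definition varifold_of_mass :: "nat \<Rightarrow> real \<Rightarrow> 'a::euclidean_space varifold \<Rightarrow> bool" where
  "varifold_of_mass d m V \<longleftrightarrow>
     sets V = sets (restrict_space borel (plane_bundle d)) \<and> emeasure V (space V) \<le> ennreal m"

lemma sum_dist_nonneg: "0 \<le> sum_dist p q"
  by (simp add: sum_dist_def)

text \<open>Lipschitz bounds are stated in the sum metric, continuity in the product topology; the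
  sum metric is at most twice the product metric.\<close>

lemma continuous_on_sum_dist_lipschitz:
  fixes g :: "'a::metric_space \<times> 'b::metric_space \<Rightarrow> 'c::metric_space"
  assumes "\<And>p q. p \<in> X \<Longrightarrow> q \<in> X \<Longrightarrow> dist (g p) (g q) \<le> L * sum_dist p q" "0 \<le> L"
  shows "continuous_on X g"
proof (rule lipschitz_on_continuous_on)
  show "(L * 2)-lipschitz_on X g"
  proof (rule lipschitz_onI)
    fix p q assume pq: "p \<in> X" "q \<in> X"
    have "sum_dist p q \<le> 2 * dist p q"
      unfolding sum_dist_def using dist_fst_le[of p q] dist_snd_le[of p q] by simp
    then have "L * sum_dist p q \<le> L * (2 * dist p q)" using assms(2) by (rule mult_left_mono)
    then show "dist (g p) (g q) \<le> L * 2 * dist p q" using assms(1)[OF pq] by simp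
  qed (use assms(2) in simp)
qed

lemma varifold_measurable:
  assumes "sets V = sets (restrict_space borel X)" "continuous_on X g"
  shows "g \<in> borel_measurable V"
  unfolding measurable_cong_sets[OF assms(1) refl]
  by (rule borel_measurable_continuous_on_restrict[OF assms(2)])

lemma space_varifold:
  assumes "varifold_of_mass d m V"
  shows "space V = plane_bundle d"
proof -
  have "sets V = sets (restrict_space borel (plane_bundle d))"
    using assms by (simp add: varifold_of_mass_def)
  from sets_eq_imp_space_eq[OF this] show ?thesis by (simp add: space_restrict_space)
qed

lemma varifold_of_massD:
  assumes "varifold_of_mass d m V"
  shows "sets V = sets (restrict_space borel (plane_bundle d))"
    and "finite_measure V" and "0 \<le> m \<Longrightarrow> measure V (space V) \<le> m"
proof -
  show "sets V = sets (restrict_space borel (plane_bundle d))"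
    using assms by (simp add: varifold_of_mass_def)
  have le: "emeasure V (space V) \<le> ennreal m" using assms by (simp add: varifold_of_mass_def)
  then show "finite_measure V"
    by (intro finite_measureI) (auto simp: top_unique)
  show "measure V (space V) \<le> m" if "0 \<le> m"
    unfolding measure_def using enn2real_mono[OF le] that by simp
qed

lemma varifold_of_mass_mono:
  assumes "varifold_of_mass d m V" "m \<le> m'"
  shows "varifold_of_mass d m' V"
  using assms(1) ennreal_leI[OF assms(2)] unfolding varifold_of_mass_def by (metis order.trans)

lemma varifold_fst_snd_measurable:
  fixes V :: "'a::euclidean_space varifold"
  assumes "varifold_of_mass d m V"
  shows "fst \<in> V \<rightarrow>\<^sub>M borel" and "snd \<in> V \<rightarrow>\<^sub>M borel"
  by (rule varifold_measurable[OF varifold_of_massD(1)[OF assms]],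
      rule continuous_on_fst continuous_on_snd, rule continuous_on_id)+

lemma emeasure_weight_UNIV:
  fixes V :: "'a::euclidean_space varifold"
  assumes "sets V = sets (restrict_space borel (plane_bundle d))"
  shows "emeasure (weight V) UNIV = emeasure V (space V)"
proof -
  have "fst \<in> V \<rightarrow>\<^sub>M borel"
    by (rule varifold_measurable[OF assms continuous_on_fst[OF continuous_on_id]])
  then show ?thesis unfolding weight_def by (subst emeasure_distr) auto
qed

lemma varifold_integrable_bounded:
  fixes g :: "_ \<Rightarrow> 'b::{banach, second_countable_topology}"
  assumes V: "varifold_of_mass d m V" and g: "g \<in> borel_measurable V"
    and B: "\<And>p. p \<in> plane_bundle d \<Longrightarrow> norm (g p) \<le> B"
  shows "integrable V g"
proof -
  interpret finite_measure V using varifold_of_massD(2)[OF V] .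
  show ?thesis
    using g B by (intro integrable_const_bound[of _ B] AE_I2) (auto simp: space_varifold[OF V])
qed

lemma varifold_integral_norm_bound:
  fixes g :: "_ \<Rightarrow> 'b::{banach, second_countable_topology}"
  assumes V: "varifold_of_mass d m V" and m: "0 \<le> m" and B0: "0 \<le> B"
    and B: "\<And>p. p \<in> plane_bundle d \<Longrightarrow> norm (g p) \<le> B"
  shows "norm (LINT p|V. g p) \<le> B * m"
\<comment> \<open>A non-integrable \<open>g\<close> has integral 0 by convention, which is within
  the bound.\<close>
proof (cases "integrable V g")
  case True
  interpret finite_measure V using varifold_of_massD(2)[OF V] .
  have "norm (LINT p|V. g p) \<le> (LINT p|V. norm (g p))"
    by (rule integral_norm_bound)
  also have "\<dots> \<le> (LINT p|V. B)"
    using True B by (intro integral_mono) (auto simp: space_varifold[OF V])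
  also have "\<dots> = B * measure V (space V)" by simp
  also have "\<dots> \<le> B * m"
    using varifold_of_massD(3)[OF V m] B0 by (rule mult_left_mono)
  finally show ?thesis .
qed (use m B0 in \<open>simp add: not_integrable_integral_eq\<close>)

section \<open>Test functions and the distance\<close>

definition bl_test :: "nat \<Rightarrow> ('a::euclidean_space \<times> ('a \<Rightarrow>\<^sub>L 'a) \<Rightarrow> real) \<Rightarrow> bool" where
  "bl_test d \<phi> \<longleftrightarrow>
     continuous_on (plane_bundle d) \<phi> \<and>
     (\<forall>p\<in>plane_bundle d. 0 \<le> \<phi> p) \<and> (\<forall>p\<in>plane_bundle d. \<bar>\<phi> p\<bar> \<le> 1) \<and>
     (\<forall>p\<in>plane_bundle d. \<forall>q\<in>plane_bundle d. \<bar>\<phi> p - \<phi> q\<bar> \<le> sum_dist p q)"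

lemma varifold_dist_eq:
  "varifold_dist d V W = Sup {\<bar>(LINT p|V. \<phi> p) - (LINT p|W. \<phi> p)\<bar> | \<phi>. bl_test d \<phi>}"
  by (simp add: varifold_dist_def bounded_lipschitz_dist_def bl_test_def)

lemma varifold_dist_le:
  assumes "\<And>\<phi>. bl_test d \<phi> \<Longrightarrow> \<bar>(LINT p|V. \<phi> p) - (LINT p|W. \<phi> p)\<bar> \<le> B"
  shows "varifold_dist d V W \<le> B"
proof -
  have "bl_test d (\<lambda>_. 0)" by (simp add: bl_test_def sum_dist_nonneg)
  then show ?thesis
    unfolding varifold_dist_eq using assms by (intro cSup_least) auto
qed

lemma varifold_dist_upper:
  assumes V: "varifold_of_mass d m V" and W: "varifold_of_mass d m' W" and m: "0 \<le> m" "0 \<le> m'"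
    and \<phi>: "bl_test d \<phi>"
  shows "\<bar>(LINT p|V. \<phi> p) - (LINT p|W. \<phi> p)\<bar> \<le> varifold_dist d V W"
  unfolding varifold_dist_eq
proof (rule cSup_upper)
  \<comment> \<open>A real \<open>Sup\<close> dominates its elements only if the set is bounded; the
    masses provide the bound \<open>m + m'\<close>.\<close>
  show "bdd_above {\<bar>(LINT p|V. \<phi> p) - (LINT p|W. \<phi> p)\<bar> | \<phi>. bl_test d \<phi>}"
  proof (rule bdd_aboveI, clarify)
    fix \<phi> :: "'a \<times> ('a \<Rightarrow>\<^sub>L 'a) \<Rightarrow> real" assume "bl_test d \<phi>"
    then have b: "norm (\<phi> p) \<le> 1" if "p \<in> plane_bundle d" for p
      using that by (auto simp: bl_test_def)
    have "norm (LINT p|V. \<phi> p) \<le> 1 * m" "norm (LINT p|W. \<phi> p) \<le> 1 * m'"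
      by (rule varifold_integral_norm_bound[OF V m(1) _ b] varifold_integral_norm_bound[OF W m(2) _ b]; simp)+
    then show "\<bar>(LINT p|V. \<phi> p) - (LINT p|W. \<phi> p)\<bar> \<le> m + m'" by simp
  qed
qed (use \<phi> in blast)

lemma varifold_dist_nonneg:
  assumes "varifold_of_mass d m V" "varifold_of_mass d m' W" "0 \<le> m" "0 \<le> m'"
  shows "0 \<le> varifold_dist d V W"
  using varifold_dist_upper[OF assms, of "\<lambda>_. 0"] by (simp add: bl_test_def sum_dist_nonneg)

lemma varifold_integral_diff_le:
  assumes V: "varifold_of_mass d m V" and W: "varifold_of_mass d m' W" and m: "0 \<le> m" "0 \<le> m'"
    and L: "0 < L"
    and g: "\<And>p. p \<in> plane_bundle d \<Longrightarrow> 0 \<le> g p"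
      "\<And>p. p \<in> plane_bundle d \<Longrightarrow> g p \<le> L"
      "\<And>p q. p \<in> plane_bundle d \<Longrightarrow> q \<in> plane_bundle d \<Longrightarrow>
        \<bar>g p - g q\<bar> \<le> L * sum_dist p q"
  shows "\<bar>(LINT p|V. g p) - (LINT p|W. g p)\<bar> \<le> L * varifold_dist d V W"
proof -
  have "bl_test d (\<lambda>p. g p / L)"
    unfolding bl_test_def
  proof (intro conjI ballI)
    show lip: "\<bar>g p / L - g q / L\<bar> \<le> sum_dist p q"
      if "p \<in> plane_bundle d" "q \<in> plane_bundle d" for p q
      using g(3)[OF that] L by (simp add: diff_divide_distrib[symmetric] field_simps)
    show "continuous_on (plane_bundle d) (\<lambda>p. g p / L)"
      by (rule continuous_on_sum_dist_lipschitz[where L = 1]) (use lip in \<open>simp_all add: dist_real_def\<close>)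
  qed (use g(1,2) L in auto)
  from varifold_dist_upper[OF V W m this]
  have "\<bar>((LINT p|V. g p) - (LINT p|W. g p)) / L\<bar> \<le> varifold_dist d V W"
    by (simp add: diff_divide_distrib)
  then show ?thesis using L by (simp add: abs_div field_simps)
qed

text \<open>The distance tests with nonnegative functions, so a signed \<open>g\<close> is split
  into its positive and negative part; this is the factor 2.\<close>

lemma varifold_integral_signed_diff_le:
  assumes V: "varifold_of_mass d m V" and W: "varifold_of_mass d m' W" and m: "0 \<le> m" "0 \<le> m'"
    and L: "0 < L"
    and g: "\<And>p. p \<in> plane_bundle d \<Longrightarrow> \<bar>g p\<bar> \<le> L"
      "\<And>p q. p \<in> plane_bundle d \<Longrightarrow> q \<in> plane_bundle d \<Longrightarrow>
        \<bar>g p - g q\<bar> \<le> L * sum_dist p q"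
  shows "\<bar>(LINT p|V. g p) - (LINT p|W. g p)\<bar> \<le> 2 * L * varifold_dist d V W"
proof -
  let ?a = "\<lambda>p. max (g p) 0" and ?b = "\<lambda>p. max (- g p) 0"
  have a: "\<bar>(LINT p|V. ?a p) - (LINT p|W. ?a p)\<bar> \<le> L * varifold_dist d V W"
  proof (rule varifold_integral_diff_le[OF V W m L])
    show "?a p \<le> L" if "p \<in> plane_bundle d" for p using g(1)[OF that] L by simp
    show "\<bar>?a p - ?a q\<bar> \<le> L * sum_dist p q"
      if "p \<in> plane_bundle d" "q \<in> plane_bundle d" for p q
      by (rule order.trans[OF _ g(2)[OF that]]) (simp add: max_def abs_minus_commute)
  qed simp
  have b: "\<bar>(LINT p|V. ?b p) - (LINT p|W. ?b p)\<bar> \<le> L * varifold_dist d V W"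
  proof (rule varifold_integral_diff_le[OF V W m L])
    show "?b p \<le> L" if "p \<in> plane_bundle d" for p using g(1)[OF that] L by simp
    show "\<bar>?b p - ?b q\<bar> \<le> L * sum_dist p q"
      if "p \<in> plane_bundle d" "q \<in> plane_bundle d" for p q
      by (rule order.trans[OF _ g(2)[OF that]]) (simp add: max_def abs_minus_commute)
  qed simp
  have cont: "continuous_on (plane_bundle d) g"
    by (rule continuous_on_sum_dist_lipschitz[where L = L]) (use g(2) L in \<open>simp_all add: dist_real_def\<close>)
  have split: "(LINT p|U. g p) = (LINT p|U. ?a p) - (LINT p|U. ?b p)"
    if U: "varifold_of_mass d n U" for U n
  proof -
    have "g \<in> borel_measurable U"
      by (rule varifold_measurable[OF varifold_of_massD(1)[OF U] cont])
    moreover have "norm (?a p) \<le> L" "norm (?b p) \<le> L" if "p \<in> plane_bundle d" for p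
      using g(1)[OF that] L by auto
    ultimately have "integrable U ?a" "integrable U ?b"
      by (auto intro!: varifold_integrable_bounded[OF U, where B = L])
    then have "(LINT p|U. ?a p) - (LINT p|U. ?b p) = (LINT p|U. ?a p - ?b p)" by simp
    also have "(\<lambda>p. ?a p - ?b p) = g" by (auto simp: max_def)
    finally show ?thesis by simp
  qed
  show ?thesis using a b unfolding split[OF V] split[OF W] by linarith
qed

section \<open>Push-forward under a small perturbation of the identity\<close>

text \<open>One step, separated from how its field arises. \<open>K2\<close> matters because a plane
  over x is moved by \<open>Dh x\<close>, so pushed planes vary with the base point. The smallness
  of \<open>\<tau> * K\<close> is the threshold of the Jacobian estimates; it also makes \<tau> h a
  contraction.\<close>

locale perturbation_field =
  fixes h :: "'a::euclidean_space \<Rightarrow> 'a" and Dh :: "'a \<Rightarrow> ('a \<Rightarrow>\<^sub>L 'a)" and K K2 \<tau> :: real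
  assumes h_deriv: "(h has_derivative blinfun_apply (Dh x)) (at x)"
    and norm_Dh: "norm (Dh x) \<le> K"
    and Dh_lipschitz: "norm (Dh x - Dh y) \<le> K2 * norm (x - y)"
    and K2_nonneg: "0 \<le> K2"
    and \<tau>_nonneg: "0 \<le> \<tau>"
    and \<tau>_small: "\<tau> * K \<le> 1 / (4 * jac_const TYPE('a))"
begin

definition step :: "'a \<Rightarrow> 'a" where "step x = x + \<tau> *\<^sub>R h x"

definition push_point :: "'a \<times> ('a \<Rightarrow>\<^sub>L 'a) \<Rightarrow> 'a \<times> ('a \<Rightarrow>\<^sub>L 'a)" where
  "push_point p = (step (fst p),
     orth_proj ((\<lambda>v. v + blinfun_apply (\<tau> *\<^sub>R Dh (fst p)) v) ` subspace_of (snd p)))"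

definition jac :: "nat \<Rightarrow> 'a \<times> ('a \<Rightarrow>\<^sub>L 'a) \<Rightarrow> real" where
  "jac d p = tangential_jacobian d step (fst p) (snd p)"

lemma K_nonneg: "0 \<le> K"
  using norm_Dh norm_ge_zero order_trans by blast

lemma \<tau>K: "0 \<le> \<tau> * K" "\<tau> * K \<le> 1/4" "jac_const TYPE('a) * (3 * (\<tau> * K)) \<le> 3/4"
  using perturbation_size[OF _ \<tau>_small] K_nonneg \<tau>_nonneg by auto

lemma continuous_on_Dh: "continuous_on UNIV Dh"
  by (rule lipschitz_on_continuous_on[of K2], rule lipschitz_onI)
    (use Dh_lipschitz K2_nonneg in \<open>auto simp: dist_norm\<close>)

lemma norm_\<tau>Dh: "norm (\<tau> *\<^sub>R Dh x) \<le> \<tau> * K"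
  using norm_Dh[of x] \<tau>_nonneg by (simp add: mult_left_mono)

lemma step_deriv: "(step has_derivative (\<lambda>v. v + blinfun_apply (\<tau> *\<^sub>R Dh x) v)) (at x)"
  unfolding step_def[abs_def]
  by (auto intro!: derivative_eq_intros h_deriv simp: blinfun.scaleR_left)

lemma frechet_step: "frechet_derivative step (at x) = (\<lambda>v. v + blinfun_apply (\<tau> *\<^sub>R Dh x) v)"
  using frechet_derivative_at[OF step_deriv] by simp

lemma h_lipschitz: "norm (h x - h y) \<le> K * norm (x - y)"
  by (rule differentiable_bound[of UNIV h "\<lambda>x. blinfun_apply (Dh x)"])
    (use h_deriv norm_Dh in \<open>auto simp: norm_blinfun.rep_eq[symmetric] intro: has_derivative_at_withinI\<close>)

lemma norm_\<tau>h_diff: "norm (\<tau> *\<^sub>R h x - \<tau> *\<^sub>R h y) \<le> \<tau> * K * norm (x - y)"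
  using mult_left_mono[OF h_lipschitz[of x y] \<tau>_nonneg] \<tau>_nonneg
  by (simp add: scaleR_diff_right[symmetric] mult.assoc)

lemma step_lower: "norm (x - y) / 2 \<le> norm (step x - step y)"
proof -
  have "norm (x - y) \<le> norm (step x - step y) + norm (\<tau> *\<^sub>R h x - \<tau> *\<^sub>R h y)"
    by (rule order.trans[OF _ norm_triangle_ineq4]) (simp add: step_def)
  moreover have "\<tau> * K * norm (x - y) \<le> 1/4 * norm (x - y)" using \<tau>K by (intro mult_right_mono) auto
  ultimately show ?thesis using norm_\<tau>h_diff[of x y] norm_ge_zero[of "x - y"] by argo
qed

lemma bij_step: "bij step"
proof (rule bijI)
  show "inj step"
    using step_lower by (intro injI) (metis diff_self half_gt_zero_iff norm_zero not_le right_minus_eq zero_less_norm_iff)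
  show "surj step"
    unfolding surj_def
  proof
    fix z
    \<comment> \<open>Solving \<open>step x = z\<close> means finding a fixed point of this map,
      which contracts by the factor \<open>\<tau> * K\<close>, at most 1/4.\<close>
    have "\<exists>!x. (\<lambda>x. z - \<tau> *\<^sub>R h x) x = x"
    proof (rule banach_fix_type)
      show "\<forall>x y. dist (z - \<tau> *\<^sub>R h x) (z - \<tau> *\<^sub>R h y) \<le> (\<tau> * K) * dist x y"
        using norm_\<tau>h_diff by (simp add: dist_norm norm_minus_commute)
    qed (use \<tau>K in auto)
    then obtain x where "z - \<tau> *\<^sub>R h x = x" by blast
    then have "step x = z" by (simp add: step_def algebra_simps)
    then show "\<exists>x. z = step x" by blast
  qed
qed

lemma C1_diffeo_step: "C1_diffeo step"
  unfolding C1_diffeo_def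
proof (intro conjI)
  show "bij step" by (rule bij_step)
  define A where "A = (\<lambda>x. id_blinfun + \<tau> *\<^sub>R Dh x)"
  let ?g = "inv_into UNIV step"
  have Aapp: "blinfun_apply (A x) v = v + blinfun_apply (\<tau> *\<^sub>R Dh x) v" for x v
    by (simp add: A_def blinfun.add_left)
  have diff: "step differentiable_on UNIV"
    using step_deriv by (auto simp: differentiable_on_def differentiable_def)
  show "C_k 1 step"
    using diff continuous_on_Dh by (auto simp: frechet_step intro!: continuous_intros)
  have gs: "?g (step x) = x" and sg: "step (?g z) = z" for x z
    using bij_step by (auto simp: bij_def inv_f_f surj_f_inv_f)
  have glip: "norm (?g z - ?g w) \<le> 2 * norm (z - w)" for z w
    using step_lower[of "?g z" "?g w"] sg by simp
  have gcont: "continuous_on UNIV ?g"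
    by (rule lipschitz_on_continuous_on[of 2], rule lipschitz_onI) (use glip in \<open>auto simp: dist_norm\<close>)
  have low: "norm v / 2 \<le> norm (blinfun_apply (A x) v)" for x v
  proof -
    have "1/2 * norm v \<le> (1 - \<tau> * K) * norm v" using \<tau>K by (intro mult_right_mono) auto
    then show ?thesis using norm_perturbed_ge[OF norm_\<tau>Dh, of v x] by (simp add: Aapp)
  qed
  have "\<exists>B. B o\<^sub>L A x = id_blinfun \<and> A x o\<^sub>L B = id_blinfun \<and> norm B \<le> 2" for x
  proof -
    have lin: "linear (blinfun_apply (A x))"
      by (simp add: blinfun.bounded_linear_right bounded_linear.linear)
    moreover have "inj (blinfun_apply (A x))"
      unfolding linear_injective_0[OF lin] using low[of _ x] by (metis divide_le_0_iff norm_le_zero_iff norm_zero not_numeral_le_zero)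
    ultimately obtain B where B: "linear B" "\<And>v. B (blinfun_apply (A x) v) = v" "\<And>v. blinfun_apply (A x) (B v) = v"
      using linear_injective_isomorphism by metis
    then have Bb: "blinfun_apply (Blinfun B) = B"
      by (simp add: bounded_linear_Blinfun_apply linear_conv_bounded_linear)
    have "norm (Blinfun B) \<le> 2"
      using low[of "B _" x] B(3) by (intro norm_blinfun_bound) (auto simp: Bb mult.commute)
    moreover have "Blinfun B o\<^sub>L A x = id_blinfun" "A x o\<^sub>L Blinfun B = id_blinfun"
      using B by (auto intro!: blinfun_eqI simp del: plus_blinfun.rep_eq simp: Bb)
    ultimately show ?thesis by blast
  qed
  then obtain B where B: "\<And>x. B x o\<^sub>L A x = id_blinfun" "\<And>x. A x o\<^sub>L B x = id_blinfun" "\<And>x. norm (B x) \<le> 2"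
    by metis
  have Bl: "blinfun_apply (B x) (blinfun_apply (A x) w) = w" for x w
    using fun_cong[OF arg_cong[OF B(1)[of x], of blinfun_apply], of w] by simp
  have Br: "blinfun_apply (A x) (blinfun_apply (B x) w) = w" for x w
    using fun_cong[OF arg_cong[OF B(2)[of x], of blinfun_apply], of w] by simp
  have gderiv: "(?g has_derivative blinfun_apply (B (?g z))) (at z)" for z
  proof (rule has_derivative_inverse_basic[where f = step and f' = "blinfun_apply (A (?g z))" and T = UNIV])
    show "(step has_derivative blinfun_apply (A (?g z))) (at (?g z))"
      using step_deriv[of "?g z"] by (simp add: Aapp[abs_def] fun_eq_iff has_derivative_eq_rhs)
    show "blinfun_apply (B (?g z)) \<circ> blinfun_apply (A (?g z)) = id"
      by (simp add: fun_eq_iff Bl)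
    show "continuous (at z) ?g" using gcont by (simp add: continuous_on_eq_continuous_at)
  qed (auto simp: blinfun.bounded_linear_right sg)
  have Bdiff: "norm (B x - B y) \<le> 4 * \<tau> * K2 * norm (x - y)" for x y
  proof -
    \<comment> \<open>Resolvent identity: together with the uniform bound 2 on the inverses, it
      transfers the Lipschitz continuity of \<open>Dh\<close> to the inverse derivative.\<close>
    have "B x - B y = (B x o\<^sub>L (A y - A x)) o\<^sub>L B y"
    proof (rule blinfun_eqI)
      fix v
      show "blinfun_apply (B x - B y) v = blinfun_apply ((B x o\<^sub>L (A y - A x)) o\<^sub>L B y) v"
        by (simp add: blinfun.diff_left blinfun.diff_right Bl Br)
    qed
    then have "norm (B x - B y) \<le> norm (B x) * norm (A y - A x) * norm (B y)"
      using order.trans[OF norm_blinfun_compose mult_right_mono[OF norm_blinfun_compose norm_ge_zero]] by simp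
    also have "\<dots> \<le> 2 * (\<tau> * (K2 * norm (x - y))) * 2"
    proof (intro mult_mono B(3))
      have "norm (A y - A x) = \<tau> * norm (Dh y - Dh x)"
        using \<tau>_nonneg by (simp add: A_def scaleR_diff_right[symmetric])
      also have "\<dots> \<le> \<tau> * (K2 * norm (x - y))"
        using Dh_lipschitz[of y x] \<tau>_nonneg by (intro mult_left_mono) (auto simp: norm_minus_commute)
      finally show "norm (A y - A x) \<le> \<tau> * (K2 * norm (x - y))" .
    qed (use \<tau>_nonneg K2_nonneg in auto)
    finally show ?thesis by simp
  qed
  have "continuous_on UNIV B"
    by (rule lipschitz_on_continuous_on[of "4 * \<tau> * K2"], rule lipschitz_onI)
      (use Bdiff K2_nonneg \<tau>_nonneg in \<open>auto simp: dist_norm\<close>)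
  then have "continuous_on UNIV (\<lambda>z. B (?g z))"
    by (rule continuous_on_compose2[OF _ gcont]) auto
  moreover have "frechet_derivative ?g (at z) = blinfun_apply (B (?g z))" for z
    using frechet_derivative_at[OF gderiv] by simp
  moreover have "?g differentiable_on UNIV"
    using gderiv by (auto simp: differentiable_on_def differentiable_def)
  ultimately show "C_k 1 ?g"
    by (auto intro!: continuous_intros)
qed

section \<open>Transport of points, planes and mass\<close>

lemma push_point_in:
  assumes "p \<in> plane_bundle d"
  shows "push_point p \<in> plane_bundle d"
proof -
  have "norm (\<tau> *\<^sub>R Dh (fst p)) < 1" using norm_\<tau>Dh[of "fst p"] \<tau>K(2) by linarith
  then show ?thesis
    using perturbed_image_grassmannian(2)[of "snd p" d] assms by (auto simp: push_point_def)
qed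

lemma push_point_lipschitz:
  assumes "p \<in> plane_bundle d" "q \<in> plane_bundle d"
  shows "sum_dist (push_point p) (push_point q) \<le> (1 + \<tau> * (4 * K + 2 * K2)) * sum_dist p q"
proof -
  obtain x S y T where p: "p = (x, S)" and q: "q = (y, T)" by fastforce
  let ?a = "norm (x - y)" and ?b = "norm (S - T)"
  have "norm (step x - step y) \<le> ?a + \<tau> * K * ?a"
    using norm_triangle_le[of "x - y" "\<tau> *\<^sub>R h x - \<tau> *\<^sub>R h y" "?a + \<tau> * K * ?a"] norm_\<tau>h_diff[of x y]
    by (simp add: step_def algebra_simps)
  moreover have "norm (snd (push_point p) - snd (push_point q))
      \<le> (1 + 4 * (\<tau> * K)) * ?b + 2 * norm (\<tau> *\<^sub>R Dh x - \<tau> *\<^sub>R Dh y)"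
    unfolding push_point_def p q fst_conv snd_conv
    by (rule orth_proj_perturbed_diff[OF _ _ norm_\<tau>Dh norm_\<tau>Dh]) (use assms p q \<tau>K in auto)
  moreover have "norm (\<tau> *\<^sub>R Dh x - \<tau> *\<^sub>R Dh y) \<le> \<tau> * (K2 * ?a)"
    using mult_left_mono[OF Dh_lipschitz[of x y] \<tau>_nonneg] \<tau>_nonneg
    by (simp add: scaleR_diff_right[symmetric])
  ultimately have "sum_dist (push_point p) (push_point q)
      \<le> ?a + \<tau> * K * ?a + ((1 + 4 * (\<tau> * K)) * ?b + 2 * (\<tau> * (K2 * ?a)))"
    by (simp add: sum_dist_def push_point_def p q dist_norm)
  also have "\<dots> \<le> (1 + \<tau> * (4 * K + 2 * K2)) * (?a + ?b)"
  proof -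
    have "0 \<le> \<tau> * K * ?a" "0 \<le> \<tau> * K2 * ?b" using \<tau>K(1) \<tau>_nonneg K2_nonneg by auto
    then show ?thesis by (simp add: algebra_simps)
  qed
  finally show ?thesis by (simp add: sum_dist_def p q dist_norm)
qed

lemma jac_bounds:
  assumes "p \<in> plane_bundle d"
  shows "0 \<le> jac d p" "\<bar>jac d p - 1\<bar> \<le> jac_const TYPE('a) * (3 * (\<tau> * K))" "\<bar>jac d p\<bar> \<le> 7/4"
proof -
  have S: "snd p \<in> grassmannian d" using assms by auto
  note J = tangential_jacobian_near_1[OF \<tau>_small S norm_\<tau>Dh frechet_step, of "fst p", folded jac_def]
  show "0 \<le> jac d p" "\<bar>jac d p - 1\<bar> \<le> jac_const TYPE('a) * (3 * (\<tau> * K))" using J by auto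
  then show "\<bar>jac d p\<bar> \<le> 7/4" using \<tau>K(3) by linarith
qed

lemma jac_lipschitz:
  assumes "p \<in> plane_bundle d" "q \<in> plane_bundle d"
  shows "\<bar>jac d p - jac d q\<bar> \<le> \<tau> * (jac_const TYPE('a) * (3 * K + 4 * K2)) * sum_dist p q"
proof -
  let ?C = "jac_const TYPE('a)"
  obtain x S y T where p: "p = (x, S)" and q: "q = (y, T)" by fastforce
  let ?a = "norm (x - y)" and ?b = "norm (S - T)"
  have "\<bar>jac d p - jac d q\<bar> \<le> ?C * (3 * (\<tau> * K) * ?b + 4 * norm (\<tau> *\<^sub>R Dh x - \<tau> *\<^sub>R Dh y))"
    unfolding jac_def p q fst_conv snd_conv
    by (rule abs_tangential_jacobian_diff_le[OF \<tau>_small _ _ norm_\<tau>Dh norm_\<tau>Dh frechet_step frechet_step])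
      (use assms p q in auto)
  also have "\<dots> \<le> ?C * (\<tau> * (3 * K + 4 * K2) * (?a + ?b))"
  proof (rule mult_left_mono)
    have "norm (\<tau> *\<^sub>R Dh x - \<tau> *\<^sub>R Dh y) \<le> \<tau> * (K2 * ?a)"
      using mult_left_mono[OF Dh_lipschitz[of x y] \<tau>_nonneg] \<tau>_nonneg
      by (simp add: scaleR_diff_right[symmetric])
    moreover have "0 \<le> \<tau> * K * ?a" "0 \<le> \<tau> * K2 * ?b" using \<tau>K(1) \<tau>_nonneg K2_nonneg by auto
    ultimately show "3 * (\<tau> * K) * ?b + 4 * norm (\<tau> *\<^sub>R Dh x - \<tau> *\<^sub>R Dh y)
        \<le> \<tau> * (3 * K + 4 * K2) * (?a + ?b)" by (simp add: algebra_simps)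
  qed (use jac_const_ge_1[where 'a = 'a] in simp)
  finally show ?thesis by (simp add: sum_dist_def p q dist_norm mult_ac)
qed

lemma continuous_on_push_point: "continuous_on (plane_bundle d) push_point"
proof -
  have "continuous_on (plane_bundle d) (\<lambda>p. (fst (push_point p), snd (push_point p)))"
  proof (rule continuous_on_Pair; rule continuous_on_sum_dist_lipschitz[where L = "1 + \<tau> * (4 * K + 2 * K2)"])
    fix p q :: "'a \<times> ('a \<Rightarrow>\<^sub>L 'a)"
    assume "p \<in> plane_bundle d" "q \<in> plane_bundle d"
    note L = push_point_lipschitz[OF this]
    show "dist (fst (push_point p)) (fst (push_point q)) \<le> (1 + \<tau> * (4 * K + 2 * K2)) * sum_dist p q"
      by (rule order.trans[OF _ L]) (simp add: sum_dist_def)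
    show "dist (snd (push_point p)) (snd (push_point q)) \<le> (1 + \<tau> * (4 * K + 2 * K2)) * sum_dist p q"
      by (rule order.trans[OF _ L]) (simp add: sum_dist_def)
  qed (use \<tau>_nonneg K_nonneg K2_nonneg in auto)
  then show ?thesis by simp
qed

lemma continuous_on_jac: "continuous_on (plane_bundle d) (jac d)"
proof (rule continuous_on_sum_dist_lipschitz)
  show "dist (jac d p) (jac d q) \<le> \<tau> * (jac_const TYPE('a) * (3 * K + 4 * K2)) * sum_dist p q"
    if "p \<in> plane_bundle d" "q \<in> plane_bundle d" for p q
    using jac_lipschitz[OF that] by (simp add: dist_real_def)
  show "0 \<le> \<tau> * (jac_const TYPE('a) * (3 * K + 4 * K2))"
    using \<tau>_nonneg K_nonneg K2_nonneg jac_const_ge_1[where 'a = 'a] by simp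
qed

lemma push_forward_step:
  "push_forward d step V = distr (density V (\<lambda>p. ennreal (jac d p)))
     (restrict_space borel (plane_bundle d)) push_point"
  by (simp add: push_forward_def push_point_def[abs_def] jac_def[abs_def] case_prod_unfold frechet_step)

lemma jac_measurable:
  assumes "varifold_of_mass d m V"
  shows "jac d \<in> borel_measurable V"
  by (rule varifold_measurable[OF varifold_of_massD(1)[OF assms] continuous_on_jac])

lemma jac_integrable:
  assumes "varifold_of_mass d m V"
  shows "integrable V (jac d)"
  by (rule varifold_integrable_bounded[OF assms jac_measurable[OF assms], where B = "7/4"])
    (simp only: real_norm_def jac_bounds(3))

lemma push_point_measurable:
  assumes "varifold_of_mass d m V"
  shows "push_point \<in> V \<rightarrow>\<^sub>M restrict_space borel (plane_bundle d)"
proof (rule measurable_restrict_space2)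
  show "push_point \<in> borel_measurable V"
    by (rule varifold_measurable[OF varifold_of_massD(1)[OF assms] continuous_on_push_point])
  show "push_point \<in> space V \<rightarrow> plane_bundle d"
    unfolding space_varifold[OF assms] using push_point_in by blast
qed

lemma integral_push_forward_step:
  fixes \<phi> :: "_ \<Rightarrow> real"
  assumes V: "varifold_of_mass d m V" and \<phi>: "continuous_on (plane_bundle d) \<phi>"
  shows "(LINT p|push_forward d step V. \<phi> p) = (LINT p|V. jac d p * \<phi> (push_point p))"
proof -
  have \<phi>m: "\<phi> \<in> borel_measurable (restrict_space borel (plane_bundle d))"
    by (rule borel_measurable_continuous_on_restrict[OF \<phi>])
  have pm: "push_point \<in> density V (\<lambda>p. ennreal (jac d p)) \<rightarrow>\<^sub>M restrict_space borel (plane_bundle d)"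
    using push_point_measurable[OF V] by simp
  have "(LINT p|push_forward d step V. \<phi> p) = (LINT p|density V (\<lambda>p. ennreal (jac d p)). \<phi> (push_point p))"
    unfolding push_forward_step by (rule integral_distr[OF pm \<phi>m])
  also have "\<dots> = (LINT p|V. jac d p *\<^sub>R \<phi> (push_point p))"
  proof (rule integral_density)
    show "(\<lambda>p. \<phi> (push_point p)) \<in> borel_measurable V"
      by (rule measurable_compose[OF push_point_measurable[OF V] \<phi>m])
    show "AE p in V. 0 \<le> jac d p"
      by (rule AE_I2) (simp add: space_varifold[OF V] jac_bounds)
  qed (rule jac_measurable[OF V])
  finally show ?thesis by simp
qed

lemma push_forward_step_mass:
  assumes V: "varifold_of_mass d m V" and m': "(LINT p|V. jac d p) \<le> m'"
  shows "varifold_of_mass d m' (push_forward d step V)"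
proof -
  let ?R = "restrict_space borel (plane_bundle d)"
  let ?D = "density V (\<lambda>p. ennreal (jac d p))"
  have pm: "push_point \<in> ?D \<rightarrow>\<^sub>M ?R" using push_point_measurable[OF V] by simp
  have jm: "(\<lambda>p. ennreal (jac d p)) \<in> borel_measurable V" using jac_measurable[OF V] by simp
  have "emeasure (push_forward d step V) (space (push_forward d step V)) = emeasure ?D (space ?D)"
    unfolding push_forward_step
    using emeasure_distr[OF pm sets.top] measurable_space[OF pm]
    by (simp add: vimage_def Int_def) (metis (no_types, lifting) Collect_cong Collect_mem_eq space_density)
  also have "\<dots> = (\<integral>\<^sup>+p. ennreal (jac d p) * indicator (space V) p \<partial>V)"
    using emeasure_density[OF jm sets.top] by simp
  also have "\<dots> = (\<integral>\<^sup>+p. ennreal (jac d p) \<partial>V)"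
    by (rule nn_integral_cong) simp
  also have "\<dots> = ennreal (LINT p|V. jac d p)"
  proof (rule nn_integral_eq_integral)
    show "integrable V (jac d)"
      by (rule jac_integrable[OF V])
    show "AE p in V. 0 \<le> jac d p"
      by (rule AE_I2) (simp add: space_varifold[OF V] jac_bounds)
  qed
  also have "\<dots> \<le> ennreal m'" using m' by (rule ennreal_leI)
  finally show ?thesis
    by (simp add: varifold_of_mass_def push_forward_step)
qed

end

text \<open>The passage from V to W keeps the field h, and the passage from h to k keeps W. The
  first pulls the test function back to \<open>F\<close>, whose bounds exceed 1 by a multiple of
  \<tau>; the second compares \<open>F\<close> with \<open>G\<close> pointwise and pays the mass of
  W.\<close>

lemma push_forward_stability:
  fixes h k :: "'a::euclidean_space \<Rightarrow> 'a"
  assumes h: "perturbation_field h Dh K K2 \<tau>" and k: "perturbation_field k Dk K K2 \<tau>"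
    and V: "varifold_of_mass d m V" and W: "varifold_of_mass d m W" and m: "0 \<le> m"
    and hk: "\<And>x. norm (h x - k x) \<le> D" "\<And>x. norm (Dh x - Dk x) \<le> D"
  shows "varifold_dist d (push_forward d (perturbation_field.step h \<tau>) V)
      (push_forward d (perturbation_field.step k \<tau>) W)
    \<le> (1 + 13 * jac_const TYPE('a) * (\<tau> * (K + K2))) * varifold_dist d V W
      + 10 * jac_const TYPE('a) * (\<tau> * D) * m"
proof -
  interpret h: perturbation_field h Dh K K2 \<tau> by fact
  interpret k: perturbation_field k Dk K K2 \<tau> by fact
  let ?C = "jac_const TYPE('a)"
  let ?L = "1 + 13 * ?C * (\<tau> * (K + K2))"
  have C: "?C \<ge> 1" by (rule jac_const_ge_1)
  have D0: "0 \<le> D" using hk(1) norm_ge_zero order_trans by blast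
  have nn: "0 \<le> \<tau>" "0 \<le> K" "0 \<le> K2" "0 \<le> \<tau> * K" "0 \<le> \<tau> * K2"
    using h.\<tau>_nonneg h.K_nonneg h.K2_nonneg by auto
  have CK: "\<tau> * K \<le> ?C * (\<tau> * K)" "\<tau> * K2 \<le> ?C * (\<tau> * K2)"
    using mult_right_mono[OF C nn(4)] mult_right_mono[OF C nn(5)] by auto
  show ?thesis
  proof (rule varifold_dist_le)
    fix \<phi> :: "'a \<times> ('a \<Rightarrow>\<^sub>L 'a) \<Rightarrow> real" assume \<phi>: "bl_test d \<phi>"
    then have cont: "continuous_on (plane_bundle d) \<phi>" by (simp add: bl_test_def)
    have \<phi>0: "0 \<le> \<phi> p" "\<phi> p \<le> 1" if "p \<in> plane_bundle d" for p
      using \<phi> that unfolding bl_test_def by (meson abs_le_D1)+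
    have \<phi>L: "\<bar>\<phi> p - \<phi> q\<bar> \<le> sum_dist p q"
      if "p \<in> plane_bundle d" "q \<in> plane_bundle d" for p q
      using \<phi> that unfolding bl_test_def by blast
    define F where "F p = h.jac d p * \<phi> (h.push_point p)" for p
    define G where "G p = k.jac d p * \<phi> (k.push_point p)" for p
    have Fc: "continuous_on (plane_bundle d) F"
      unfolding F_def by (rule continuous_on_mult[OF h.continuous_on_jac
            continuous_on_compose2[OF cont h.continuous_on_push_point image_subsetI[OF h.push_point_in]]])
    have Gc: "continuous_on (plane_bundle d) G"
      unfolding G_def by (rule continuous_on_mult[OF k.continuous_on_jac
            continuous_on_compose2[OF cont k.continuous_on_push_point image_subsetI[OF k.push_point_in]]])
    have split: "\<bar>a * b - a' * b'\<bar> \<le> \<bar>a\<bar> * \<bar>b - b'\<bar> + \<bar>a - a'\<bar>" if "0 \<le> b'" "b' \<le> 1" for a b a' b' :: real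
    proof -
      have "a * b - a' * b' = a * (b - b') + (a - a') * b'" by (simp add: algebra_simps)
      moreover have "\<bar>(a - a') * b'\<bar> \<le> \<bar>a - a'\<bar>" using that by (simp add: abs_mult mult_left_le)
      ultimately show ?thesis by (metis abs_mult abs_triangle_ineq add_left_mono order.trans)
    qed
    have 1: "\<bar>(LINT p|V. F p) - (LINT p|W. F p)\<bar> \<le> ?L * varifold_dist d V W"
    proof (rule varifold_integral_diff_le[OF V W m m])
      have "0 \<le> ?C * (\<tau> * (K + K2))" using C nn by simp
      then show "0 < ?L" by simp
      fix p :: "'a \<times> ('a \<Rightarrow>\<^sub>L 'a)" assume p: "p \<in> plane_bundle d"
      note \<phi>p = \<phi>0[OF h.push_point_in[OF p]] and jp = h.jac_bounds[OF p]
      show "0 \<le> F p" unfolding F_def using \<phi>p jp by simp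
      have "F p \<le> h.jac d p * 1" unfolding F_def using \<phi>p jp by (intro mult_left_mono) auto
      also have "\<dots> \<le> 1 + ?C * (3 * (\<tau> * K))" using jp(2) by linarith
      also have "\<dots> \<le> ?L"
      proof -
        have "0 \<le> ?C * (\<tau> * K)" "0 \<le> ?C * (\<tau> * K2)" using C nn by auto
        then show ?thesis by (simp add: algebra_simps)
      qed
      finally show "F p \<le> ?L" .
      fix q :: "'a \<times> ('a \<Rightarrow>\<^sub>L 'a)" assume q: "q \<in> plane_bundle d"
      let ?s = "sum_dist p q"
      have s0: "0 \<le> ?s" by (rule sum_dist_nonneg)
      note \<phi>q = \<phi>0[OF h.push_point_in[OF q]]
      have "\<bar>F p - F q\<bar> \<le> \<bar>h.jac d p\<bar> * \<bar>\<phi> (h.push_point p) - \<phi> (h.push_point q)\<bar> + \<bar>h.jac d p - h.jac d q\<bar>"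
        unfolding F_def by (rule split[OF \<phi>q])
      also have "\<dots> \<le> (1 + ?C * (3 * (\<tau> * K))) * ((1 + \<tau> * (4 * K + 2 * K2)) * ?s)
          + \<tau> * (?C * (3 * K + 4 * K2)) * ?s"
      proof (intro add_mono mult_mono h.jac_lipschitz p q)
        show "\<bar>h.jac d p\<bar> \<le> 1 + ?C * (3 * (\<tau> * K))" using jp by linarith
        show "\<bar>\<phi> (h.push_point p) - \<phi> (h.push_point q)\<bar> \<le> (1 + \<tau> * (4 * K + 2 * K2)) * ?s"
          by (rule order.trans[OF \<phi>L[OF h.push_point_in[OF p] h.push_point_in[OF q]] h.push_point_lipschitz[OF p q]])
        show "0 \<le> 1 + ?C * (3 * (\<tau> * K))" using C nn by simp
      qed simp
      also have "\<dots> = ((1 + ?C * (3 * (\<tau> * K))) * (1 + \<tau> * (4 * K + 2 * K2))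
          + \<tau> * (?C * (3 * K + 4 * K2))) * ?s" by (simp add: distrib_right)
      \<comment> \<open>The cross term is made linear in \<tau> by bounding one of its factors by
        3/4. The coefficients of \<tau> K then add up to 3 C + 7 + 3 C, at most 13 C; those of
        \<tau> K2 are smaller.\<close>
      also have "\<dots> \<le> ?L * ?s"
      proof (rule mult_right_mono[OF _ s0])
        have "(?C * (3 * (\<tau> * K))) * (\<tau> * (4 * K + 2 * K2)) \<le> 3/4 * (\<tau> * (4 * K + 2 * K2))"
          using h.\<tau>K(3) nn by (intro mult_right_mono) auto
        then have "(1 + ?C * (3 * (\<tau> * K))) * (1 + \<tau> * (4 * K + 2 * K2))
            \<le> 1 + 3 * (?C * (\<tau> * K)) + 7 * (\<tau> * K) + (7/2) * (\<tau> * K2)"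
          by (simp add: algebra_simps)
        moreover have "\<tau> * (?C * (3 * K + 4 * K2)) = 3 * (?C * (\<tau> * K)) + 4 * (?C * (\<tau> * K2))"
          by (simp add: algebra_simps)
        moreover have "?L = 1 + 13 * (?C * (\<tau> * K)) + 13 * (?C * (\<tau> * K2))" by (simp add: algebra_simps)
        ultimately show "(1 + ?C * (3 * (\<tau> * K))) * (1 + \<tau> * (4 * K + 2 * K2))
            + \<tau> * (?C * (3 * K + 4 * K2)) \<le> ?L"
          using CK nn by linarith
      qed
      finally show "\<bar>F p - F q\<bar> \<le> ?L * ?s" .
    qed
    have FG: "\<bar>F p - G p\<bar> \<le> 10 * ?C * (\<tau> * D)" if p: "p \<in> plane_bundle d" for p
    proof -
      obtain x S where xS: "p = (x, S)" by fastforce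
      have S: "S \<in> grassmannian d" using p xS by auto
      have nd: "norm (\<tau> *\<^sub>R Dh x - \<tau> *\<^sub>R Dk x) \<le> \<tau> * D"
        using mult_left_mono[OF hk(2)[of x] nn(1)] nn(1) by (simp add: scaleR_diff_right[symmetric])
      have "\<bar>\<phi> (h.push_point p) - \<phi> (k.push_point p)\<bar> \<le> sum_dist (h.push_point p) (k.push_point p)"
        by (rule \<phi>L[OF h.push_point_in[OF p] k.push_point_in[OF p]])
      also have "\<dots> \<le> \<tau> * D + ((1 + 4 * (\<tau> * K)) * norm (S - S) + 2 * norm (\<tau> *\<^sub>R Dh x - \<tau> *\<^sub>R Dk x))"
        unfolding sum_dist_def
      proof (rule add_mono)
        show "dist (fst (h.push_point p)) (fst (k.push_point p)) \<le> \<tau> * D"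
          using mult_left_mono[OF hk(1)[of x] nn(1)] nn(1)
          by (simp add: h.push_point_def k.push_point_def xS h.step_def k.step_def dist_norm
              scaleR_diff_right[symmetric])
        show "dist (snd (h.push_point p)) (snd (k.push_point p))
            \<le> (1 + 4 * (\<tau> * K)) * norm (S - S) + 2 * norm (\<tau> *\<^sub>R Dh x - \<tau> *\<^sub>R Dk x)"
          unfolding h.push_point_def k.push_point_def xS fst_conv snd_conv dist_norm
          by (rule orth_proj_perturbed_diff[OF S S h.norm_\<tau>Dh k.norm_\<tau>Dh]) (use h.\<tau>K in simp)
      qed
      finally have \<phi>d: "\<bar>\<phi> (h.push_point p) - \<phi> (k.push_point p)\<bar> \<le> 3 * (\<tau> * D)" using nd by simp
      have "\<bar>h.jac d p - k.jac d p\<bar> \<le>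
          ?C * (3 * (\<tau> * K) * norm (S - S) + 4 * norm (\<tau> *\<^sub>R Dh x - \<tau> *\<^sub>R Dk x))"
        unfolding h.jac_def k.jac_def xS fst_conv snd_conv
        by (rule abs_tangential_jacobian_diff_le[OF h.\<tau>_small S S h.norm_\<tau>Dh k.norm_\<tau>Dh
              h.frechet_step k.frechet_step])
      also have "\<dots> \<le> ?C * (4 * (\<tau> * D))" using nd C by (intro mult_left_mono) auto
      finally have jd: "\<bar>h.jac d p - k.jac d p\<bar> \<le> ?C * (4 * (\<tau> * D))" .
      have "\<bar>F p - G p\<bar> \<le> \<bar>h.jac d p\<bar> * \<bar>\<phi> (h.push_point p) - \<phi> (k.push_point p)\<bar> + \<bar>h.jac d p - k.jac d p\<bar>"
        unfolding F_def G_def by (rule split[OF \<phi>0[OF k.push_point_in[OF p]]])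
      also have "\<dots> \<le> 7/4 * (3 * (\<tau> * D)) + ?C * (4 * (\<tau> * D))"
        by (intro add_mono mult_mono h.jac_bounds(3) p \<phi>d jd) auto
      \<comment> \<open>The pushed points differ by 3 \<tau> D, once for the base point and twice
        for the plane; with the Jacobian at most 7/4 this gives 21/4 + 4 \<le> 10.\<close>
      also have "\<dots> \<le> 10 * ?C * (\<tau> * D)"
      proof -
        have "7/4 * (3 * t) + u * 4 \<le> 10 * u" if "t \<le> u" "0 \<le> t" for t u :: real
          using that by argo
        from this[of "\<tau> * D" "?C * (\<tau> * D)"] show ?thesis
          using mult_right_mono[OF C, of "\<tau> * D"] nn(1) D0 by (simp add: mult_ac)
      qed
      finally show ?thesis .
    qed
    have "integrable W F" "integrable W G"
    proof -
      have n: "norm (F p) \<le> 7/4 * 1" "norm (G p) \<le> 7/4 * 1" if p: "p \<in> plane_bundle d" for p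
        unfolding F_def G_def real_norm_def abs_mult
        using \<phi>0[OF h.push_point_in[OF p]] \<phi>0[OF k.push_point_in[OF p]]
        by (intro mult_mono h.jac_bounds(3)[OF p] k.jac_bounds(3)[OF p]; simp)+
      note meas = varifold_measurable[OF varifold_of_massD(1)[OF W]]
      show "integrable W F" by (rule varifold_integrable_bounded[OF W meas[OF Fc] n(1)])
      show "integrable W G" by (rule varifold_integrable_bounded[OF W meas[OF Gc] n(2)])
    qed
    then have "(LINT p|W. F p) - (LINT p|W. G p) = (LINT p|W. F p - G p)" by simp
    moreover have "norm (LINT p|W. F p - G p) \<le> 10 * ?C * (\<tau> * D) * m"
      by (rule varifold_integral_norm_bound[OF W m]) (use FG C nn(1) D0 in auto)
    ultimately have 2: "\<bar>(LINT p|W. F p) - (LINT p|W. G p)\<bar> \<le> 10 * ?C * (\<tau> * D) * m" by simp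
    show "\<bar>(LINT p|push_forward d h.step V. \<phi> p) - (LINT p|push_forward d k.step W. \<phi> p)\<bar>
      \<le> ?L * varifold_dist d V W + 10 * ?C * (\<tau> * D) * m"
      using 1 2 unfolding h.integral_push_forward_step[OF V cont] k.integral_push_forward_step[OF W cont]
        F_def[symmetric] G_def[symmetric] by linarith
  qed
qed

section \<open>The mollification kernel\<close>

text \<open>Two bounds on the gradient for two purposes. \<open>d\<Phi>_le\<close> is weighted by
  the kernel, so after integration, or division by the smoothed mass, its main term costs only a, of
  order eps^-2; the uniform bound \<open>L1\<close> carries the additional factor eps^-n.
  \<open>L1 \<le> L2\<close> lets \<open>L2\<close> serve as both size and Lipschitz constant of a
  test function.\<close>

locale mollifier =
  fixes \<Phi> :: "'a::euclidean_space \<Rightarrow> real" and d\<Phi> :: "'a \<Rightarrow> 'a" and a b L1 L2 :: real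
  assumes \<Phi>_deriv: "(\<Phi> has_derivative (\<lambda>v. inner (d\<Phi> x) v)) (at x)"
    and \<Phi>_nonneg: "0 \<le> \<Phi> x" and \<Phi>_le: "\<Phi> x \<le> L1"
    and \<Phi>_integral: "(LINT x|lborel. \<Phi> x) = 1"
    and \<Phi>_support: "norm x \<ge> 1 \<Longrightarrow> \<Phi> x = 0"
    and d\<Phi>_support: "norm x \<ge> 1 \<Longrightarrow> d\<Phi> x = 0"
    and \<Phi>_even: "\<Phi> (- x) = \<Phi> x"
    and d\<Phi>_le: "norm (d\<Phi> x) \<le> a * \<Phi> x + b"
    and d\<Phi>_le_L1: "norm (d\<Phi> x) \<le> L1"
    and d\<Phi>_lipschitz: "norm (d\<Phi> x - d\<Phi> y) \<le> L2 * norm (x - y)"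
    and constants: "0 \<le> a" "0 \<le> b" "0 < L1" "L1 \<le> L2"

section \<open>Gradients and Lipschitz constants\<close>

lemma inner_grad:
  assumes "f differentiable (at x)"
  shows "inner (grad f x) v = frechet_derivative f (at x) v"
proof -
  have lin: "linear (frechet_derivative f (at x))"
    by (rule linear_frechet_derivative[OF assms])
  have "frechet_derivative f (at x) v = frechet_derivative f (at x) (\<Sum>i\<in>Basis. inner v i *\<^sub>R i)"
    by (simp add: euclidean_representation)
  also have "\<dots> = (\<Sum>i\<in>Basis. inner v i * frechet_derivative f (at x) i)"
    by (simp add: linear_sum[OF lin] linear_cmul[OF lin])
  finally show ?thesis
    by (simp add: grad_def inner_sum_left inner_commute[of v] mult.commute)
qed

lemma grad_has_derivative:
  assumes "f differentiable (at x)"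
  shows "(f has_derivative (\<lambda>v. inner (grad f x) v)) (at x)"
proof -
  have "(\<lambda>v. inner (grad f x) v) = frechet_derivative f (at x)"
    by (rule ext) (rule inner_grad[OF assms])
  then show ?thesis using assms by (simp only: frechet_derivative_works)
qed

lemma grad_unique:
  assumes "(f has_derivative (\<lambda>v. inner w v)) (at x)"
  shows "grad f x = w"
proof -
  have "f differentiable (at x)" using assms by (auto simp: differentiable_def)
  from inner_grad[OF this] have "inner (grad f x) v = inner w v" for v
    using fun_cong[OF frechet_derivative_at[OF assms], of v] by simp
  then have "inner (grad f x - w) (grad f x - w) = 0" by (simp add: inner_diff_left)
  then show ?thesis by simp
qed

lemma lipschitz_of_grad_bound:
  fixes f :: "'a::euclidean_space \<Rightarrow> real"
  assumes "\<And>x. (f has_derivative (\<lambda>v. inner (g x) v)) (at x)" "\<And>x. norm (g x) \<le> B"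
  shows "\<bar>f x - f y\<bar> \<le> B * norm (x - y)"
proof -
  have "norm (f x - f y) \<le> B * norm (x - y)"
  proof (rule differentiable_bound[of UNIV f "\<lambda>x v. inner (g x) v"])
    show "onorm (\<lambda>v. inner (g x) v) \<le> B" for x
    proof (rule onorm_le)
      fix v
      have "norm (inner (g x) v) \<le> norm (g x) * norm v" by (simp add: Cauchy_Schwarz_ineq2)
      also have "\<dots> \<le> B * norm v" using assms(2) by (rule mult_right_mono) simp
      finally show "norm (inner (g x) v) \<le> B * norm v" .
    qed
  qed (use assms(1) in \<open>auto intro: has_derivative_at_withinI\<close>)
  then show ?thesis by simp
qed

text \<open>Compactness bounds the gradient on the closed unit ball, and outside it \<open>g\<close>
  vanishes on an open set. It is applied to the components of the gradient of the cutoff, for which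
  no explicit second-order bound is given.\<close>

lemma lipschitz_of_C1_compact_support:
  fixes g :: "'a::euclidean_space \<Rightarrow> real"
  assumes g: "C_k 1 g" and z: "\<And>x. norm x \<ge> 1 \<Longrightarrow> g x = 0"
  shows "\<exists>B\<ge>0. \<forall>x y. \<bar>g x - g y\<bar> \<le> B * norm (x - y)"
proof -
  have diff: "g differentiable (at x)" for x
    using g by (simp add: differentiable_on_def)
  have cont: "continuous_on UNIV (\<lambda>x. grad g x)"
    unfolding grad_def using g by (intro continuous_intros) simp
  have "compact ((\<lambda>x. grad g x) ` cball 0 1)"
    by (rule compact_continuous_image[OF continuous_on_subset[OF cont]]) auto
  then obtain B where B: "0 < B" "\<And>x. norm x \<le> 1 \<Longrightarrow> norm (grad g x) \<le> B"
    using compact_imp_bounded bounded_pos by (metis image_eqI mem_cball_0)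
  have "norm (grad g x) \<le> B" for x
  proof (cases "norm x \<le> 1")
    case False
    have op: "open {x::'a. 1 < norm x}" by (intro open_Collect_less continuous_intros)
    have "((\<lambda>x. 0) has_derivative (\<lambda>v. inner (grad g x) v)) (at x)"
      by (rule has_derivative_transform_within_open[OF grad_has_derivative[OF diff] op])
        (use False z in auto)
    then have "grad (\<lambda>x::'a. 0) x = grad g x" by (rule grad_unique)
    moreover have "grad (\<lambda>x::'a. 0) x = 0" by (rule grad_unique) simp
    ultimately show ?thesis using B by simp
  qed (use B in auto)
  then have "\<bar>g x - g y\<bar> \<le> B * norm (x - y)" for x y
    by (intro lipschitz_of_grad_bound[OF grad_has_derivative[OF diff]])
  then show ?thesis using B(1) by (intro exI[of _ B]) auto
qed

section \<open>The cutoff function\<close>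

locale cutoff =
  fixes \<psi> :: "'a::euclidean_space \<Rightarrow> real"
  assumes \<psi>: "is_cutoff \<psi>"
begin

lemma \<psi>_range: "0 \<le> \<psi> x" "\<psi> x \<le> 1"
  and \<psi>_inner: "norm x \<le> 1/2 \<Longrightarrow> \<psi> x = 1"
  and \<psi>_outer: "norm x \<ge> 1 \<Longrightarrow> \<psi> x = 0"
  and \<psi>_grad: "norm (grad \<psi> x) \<le> 3"
  and \<psi>_radial: "norm x = norm y \<Longrightarrow> \<psi> x = \<psi> y"
  using \<psi> unfolding is_cutoff_def by blast+

lemma \<psi>_C2: "C_k (Suc 1) \<psi>"
  using \<psi> by (simp only: is_cutoff_def C_infinity_def)

lemma \<psi>_differentiable: "\<psi> differentiable (at x)"
  using \<psi>_C2 unfolding C_k.simps(2) differentiable_on_def by simp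

lemma \<psi>_deriv: "(\<psi> has_derivative (\<lambda>v. inner (grad \<psi> x) v)) (at x)"
  by (rule grad_has_derivative[OF \<psi>_differentiable])

lemma continuous_on_\<psi>: "continuous_on UNIV \<psi>"
  by (intro continuous_at_imp_continuous_on ballI has_derivative_continuous[OF \<psi>_deriv])

text \<open>\<open>\<psi>\<close> is extremal wherever it takes the value 0 or 1.\<close>

lemma grad_\<psi>_eq_0:
  assumes "norm x \<le> 1/2 \<or> norm x \<ge> 1"
  shows "grad \<psi> x = 0"
proof -
  have "(\<forall>y\<in>UNIV. \<psi> y \<le> \<psi> x) \<or> (\<forall>y\<in>UNIV. \<psi> x \<le> \<psi> y)"
    using assms
  proof
    assume "norm x \<le> 1/2"
    then show ?thesis using \<psi>_inner \<psi>_range by simp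
  next
    assume "norm x \<ge> 1"
    then show ?thesis using \<psi>_outer \<psi>_range by simp
  qed
  then have "(\<lambda>v. inner (grad \<psi> x) v) = (\<lambda>v. 0)"
    using differential_zero_maxmin[OF UNIV_I open_UNIV \<psi>_deriv] by blast
  from fun_cong[OF this, of "grad \<psi> x"] show ?thesis by simp
qed

lemma \<psi>_lipschitz: "\<bar>\<psi> x - \<psi> y\<bar> \<le> 3 * norm (x - y)"
  by (rule lipschitz_of_grad_bound[OF \<psi>_deriv \<psi>_grad])

lemma grad_\<psi>_lipschitz: "\<exists>B\<ge>0. \<forall>x y. norm (grad \<psi> x - grad \<psi> y) \<le> B * norm (x - y)"
proof -
  have "\<exists>B\<ge>0. \<forall>x y. \<bar>frechet_derivative \<psi> (at x) i - frechet_derivative \<psi> (at y) i\<bar> \<le> B * norm (x - y)" for i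
  proof (rule lipschitz_of_C1_compact_support)
    show "C_k 1 (\<lambda>x. frechet_derivative \<psi> (at x) i)" using \<psi>_C2 C_k.simps(2) by blast
    show "frechet_derivative \<psi> (at x) i = 0" if "norm x \<ge> 1" for x
      using inner_grad[OF \<psi>_differentiable, of x i] grad_\<psi>_eq_0[of x] that by simp
  qed
  then have "\<exists>B. \<forall>i. B i \<ge> 0 \<and>
      (\<forall>x y. \<bar>frechet_derivative \<psi> (at x) i - frechet_derivative \<psi> (at y) i\<bar> \<le> B i * norm (x - y))"
    by (intro choice) blast
  then obtain B where B: "\<And>i. B i \<ge> 0"
      "\<And>i x y. \<bar>frechet_derivative \<psi> (at x) i - frechet_derivative \<psi> (at y) i\<bar> \<le> B i * norm (x - y)"
    by blast
  have "norm (grad \<psi> x - grad \<psi> y) \<le> (\<Sum>i\<in>Basis. B i) * norm (x - y)" for x y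
  proof -
    have "grad \<psi> x - grad \<psi> y =
        (\<Sum>i\<in>Basis. (frechet_derivative \<psi> (at x) i - frechet_derivative \<psi> (at y) i) *\<^sub>R i)"
      by (simp add: grad_def sum_subtractf scaleR_diff_left)
    also have "norm \<dots> \<le> (\<Sum>i\<in>Basis. B i * norm (x - y))"
      by (rule order.trans[OF norm_sum sum_mono]) (use B(2) in auto)
    finally show ?thesis by (simp add: sum_distrib_right)
  qed
  moreover have "(\<Sum>i\<in>(Basis::'a set). B i) \<ge> 0" using B(1) by (intro sum_nonneg) auto
  ultimately show ?thesis by blast
qed

text \<open>The product rule gives 1 + 3, provided one of the two points lies in the unit ball; by
  symmetry only the case of two outer points remains, where both sides of the difference
  vanish.\<close>

lemma \<psi>_id_lipschitz: "norm (\<psi> x *\<^sub>R x - \<psi> y *\<^sub>R y) \<le> 4 * norm (x - y)"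
proof -
  have *: "norm (\<psi> x *\<^sub>R x - \<psi> y *\<^sub>R y) \<le> 4 * norm (x - y)" if "norm y \<le> 1" for x y
  proof -
    have "\<psi> x *\<^sub>R x - \<psi> y *\<^sub>R y = \<psi> x *\<^sub>R (x - y) + (\<psi> x - \<psi> y) *\<^sub>R y"
      by (simp add: algebra_simps)
    also have "norm \<dots> \<le> 1 * norm (x - y) + (3 * norm (x - y)) * 1"
    proof (rule norm_triangle_le[OF add_mono])
      show "norm (\<psi> x *\<^sub>R (x - y)) \<le> 1 * norm (x - y)"
        unfolding norm_scaleR using \<psi>_range[of x] by (intro mult_right_mono) auto
      show "norm ((\<psi> x - \<psi> y) *\<^sub>R y) \<le> (3 * norm (x - y)) * 1"
        unfolding norm_scaleR using \<psi>_lipschitz that by (intro mult_mono) auto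
    qed
    finally show ?thesis by simp
  qed
  show ?thesis
  proof (cases "norm y \<le> 1")
    case False
    show ?thesis
    proof (cases "norm x \<le> 1")
      case True
      then show ?thesis using *[OF True, of y] by (simp add: norm_minus_commute)
    next
      case x: False
      then show ?thesis using False \<psi>_outer by simp
    qed
  qed (use * in blast)
qed

section \<open>The truncated Gaussian and its normalisation\<close>

definition gauss :: "real \<Rightarrow> 'a \<Rightarrow> real" where
  "gauss \<epsilon> x = exp (- (norm x)\<^sup>2 / (2 * \<epsilon>\<^sup>2))"

lemma gauss_deriv: "(gauss \<epsilon> has_derivative (\<lambda>v. inner (- (gauss \<epsilon> x / \<epsilon>\<^sup>2) *\<^sub>R x) v)) (at x)"
proof -
  define c where "c = - 1 / (2 * \<epsilon>\<^sup>2)"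
  \<comment> \<open>\<open>inner x x\<close> is differentiable everywhere, unlike the norm at
    0.\<close>
  have g: "gauss \<epsilon> = (\<lambda>x. exp (c * inner x x))"
    by (simp add: gauss_def fun_eq_iff power2_norm_eq_inner c_def)
  have "((\<lambda>x. exp (c * inner x x)) has_derivative (\<lambda>v. exp (c * inner x x) * (2 * c * inner x v))) (at x)"
    by (auto intro!: derivative_eq_intros simp: inner_commute)
  moreover have "2 * c = - 1 / \<epsilon>\<^sup>2" by (simp add: c_def)
  ultimately show ?thesis by (simp add: g)
qed

lemma gauss_range: "0 < gauss \<epsilon> x" "gauss \<epsilon> x \<le> 1"
  by (auto simp: gauss_def)

text \<open>From t \<le> 1 + t^2/2 \<le> exp(t^2/2). Not sharp in eps, but the resulting Lipschitz
  constant eps^-2 of the Gaussian matches the other terms of the kernel gradient.\<close>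

lemma gauss_norm_le:
  assumes "0 < \<epsilon>" "\<epsilon> < 1"
  shows "gauss \<epsilon> x * norm x \<le> 1"
proof -
  have "2 * \<epsilon>\<^sup>2 \<le> 2" using assms by (simp add: power_le_one)
  then have "(norm x)\<^sup>2 / 2 \<le> (norm x)\<^sup>2 / (2 * \<epsilon>\<^sup>2)"
    using assms by (intro divide_left_mono) auto
  moreover have "norm x \<le> 1 + (norm x)\<^sup>2 / 2"
    using zero_le_power2[of "norm x - 1"] unfolding power2_diff by simp
  ultimately have "norm x \<le> exp ((norm x)\<^sup>2 / (2 * \<epsilon>\<^sup>2))"
    using exp_ge_add_one_self[of "(norm x)\<^sup>2 / (2 * \<epsilon>\<^sup>2)"] by linarith
  then show ?thesis by (simp add: gauss_def exp_minus divide_simps)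
qed

lemma gauss_lipschitz:
  assumes "0 < \<epsilon>" "\<epsilon> < 1"
  shows "\<bar>gauss \<epsilon> x - gauss \<epsilon> y\<bar> \<le> 1 / \<epsilon>\<^sup>2 * norm (x - y)"
proof (rule lipschitz_of_grad_bound[OF gauss_deriv])
  fix x
  have "norm (- (gauss \<epsilon> x / \<epsilon>\<^sup>2) *\<^sub>R x) = (gauss \<epsilon> x * norm x) / \<epsilon>\<^sup>2"
    by (simp add: abs_of_pos[OF gauss_range(1)])
  also have "\<dots> \<le> 1 / \<epsilon>\<^sup>2"
    using gauss_norm_le[OF assms] by (rule divide_right_mono) simp
  finally show "norm (- (gauss \<epsilon> x / \<epsilon>\<^sup>2) *\<^sub>R x) \<le> 1 / \<epsilon>\<^sup>2" .
qed

text \<open>The value of the kernel at the origin.\<close>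

definition norm_const :: "real \<Rightarrow> real" where
  "norm_const \<epsilon> = (2 * pi * \<epsilon>\<^sup>2) powr (- real DIM('a) / 2) / (LINT y|lborel. truncated_gaussian \<psi> \<epsilon> y)"

lemma kernel_eq: "kernel \<psi> \<epsilon> x = norm_const \<epsilon> * (\<psi> x * gauss \<epsilon> x)"
  by (simp add: kernel_def truncated_gaussian_def norm_const_def gauss_def)

lemma gauss_factor:
  assumes "0 < \<epsilon>"
  shows "(2 * pi * \<epsilon>\<^sup>2) powr (- real DIM('a) / 2) = (2 * pi) powr (- real DIM('a) / 2) / \<epsilon> ^ DIM('a)"
proof -
  have "(\<epsilon>\<^sup>2) powr (- real DIM('a) / 2) = \<epsilon> powr (- real DIM('a))"
    using assms by (simp add: powr_powr flip: powr_numeral)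
  also have "\<dots> = 1 / \<epsilon> ^ DIM('a)"
    using assms by (simp add: powr_minus_divide powr_realpow)
  finally show ?thesis using assms by (simp add: powr_mult)
qed

lemma continuous_on_truncated_gaussian: "continuous_on UNIV (truncated_gaussian \<psi> \<epsilon>)"
proof -
  have "continuous_on UNIV (gauss \<epsilon>)"
    by (intro continuous_at_imp_continuous_on ballI has_derivative_continuous[OF gauss_deriv])
  then have "continuous_on UNIV (\<lambda>x. \<psi> x * (2 * pi * \<epsilon>\<^sup>2) powr (- real DIM('a) / 2) * gauss \<epsilon> x)"
    by (intro continuous_intros continuous_on_\<psi>)
  then show ?thesis by (simp add: truncated_gaussian_def[abs_def] gauss_def)
qed

end

lemma integrable_of_compact_support:
  fixes f :: "'a::euclidean_space \<Rightarrow> 'b::{banach, second_countable_topology}"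
  assumes "continuous_on UNIV f" "\<And>x. x \<notin> cball c r \<Longrightarrow> f x = 0"
  shows "integrable lborel f"
proof -
  have "integrable lborel (\<lambda>x. indicator (cball c r) x *\<^sub>R f x)"
    by (rule borel_integrable_compact[OF compact_cball continuous_on_subset[OF assms(1)]]) simp
  also have "(\<lambda>x. indicator (cball c r) x *\<^sub>R f x) = f"
    using assms(2) by (auto simp: indicator_def fun_eq_iff)
  finally show ?thesis .
qed

context cutoff
begin

text \<open>Lower bound for the unnormalised integral from the ball of radius eps/2: there the
  cutoff is 1 and the exponential at least exp(-1/8), and the volume, of order eps^n, cancels the
  prefactor eps^-n. The normalisation is thus controlled by the dimension alone.\<close>

definition mass_const :: real where
  "mass_const = (2 * pi) powr (- real DIM('a) / 2) * exp (- 1 / 8) * (unit_ball_vol (real DIM('a)) / 2 ^ DIM('a))"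

lemma mass_const_pos: "0 < mass_const"
  unfolding mass_const_def by (intro mult_pos_pos divide_pos_pos) auto

lemma truncated_gaussian_mass:
  assumes "0 < \<epsilon>" "\<epsilon> < 1"
  shows "mass_const \<le> (LINT y|lborel. truncated_gaussian \<psi> \<epsilon> y)"
proof -
  let ?q = "(2 * pi * \<epsilon>\<^sup>2) powr (- real DIM('a) / 2)"
  let ?B = "ball (0::'a) (\<epsilon> / 2)"
  have "mass_const = ?q * exp (- 1 / 8) * content ?B"
    unfolding gauss_factor[OF assms(1)] mass_const_def using assms
    by (simp add: content_ball power_divide)
  also have "\<dots> = (LINT y|lborel. (?q * exp (- 1 / 8)) * indicator ?B y)"
    by simp
  also have "\<dots> \<le> (LINT y|lborel. truncated_gaussian \<psi> \<epsilon> y)"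
  proof (rule integral_mono)
    show "integrable lborel (\<lambda>y. (?q * exp (- 1 / 8)) * indicator ?B y)"
      by (intro integrable_mult_right integrable_real_indicator emeasure_lborel_ball_finite) simp
    show "integrable lborel (truncated_gaussian \<psi> \<epsilon>)"
      by (rule integrable_of_compact_support[OF continuous_on_truncated_gaussian, of 0 1])
        (simp add: truncated_gaussian_def \<psi>_outer)
    fix y :: 'a
    show "(?q * exp (- 1 / 8)) * indicator ?B y \<le> truncated_gaussian \<psi> \<epsilon> y"
    proof (cases "y \<in> ?B")
      case True
      then have n: "norm y \<le> \<epsilon> / 2" by simp
      then have "\<psi> y = 1" using assms by (intro \<psi>_inner) simp
      moreover have "(norm y)\<^sup>2 / (2 * \<epsilon>\<^sup>2) \<le> 1 / 8"
      proof -
        have "(norm y)\<^sup>2 \<le> (\<epsilon> / 2)\<^sup>2" using n by (intro power_mono) auto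
        then show ?thesis using assms by (simp add: power_divide field_simps)
      qed
      ultimately show ?thesis using True by (simp add: truncated_gaussian_def mult_left_mono)
    qed (simp add: truncated_gaussian_def \<psi>_range)
  qed
  finally show ?thesis .
qed

definition peak_const :: real where
  "peak_const = (2 * pi) powr (- real DIM('a) / 2) / mass_const"

lemma peak_const_pos: "0 < peak_const"
  unfolding peak_const_def using mass_const_pos by simp

lemma norm_const_bounds:
  assumes "0 < \<epsilon>" "\<epsilon> < 1"
  shows "0 < norm_const \<epsilon>" "norm_const \<epsilon> \<le> peak_const / \<epsilon> ^ DIM('a)"
proof -
  have Z: "0 < (LINT y|lborel. truncated_gaussian \<psi> \<epsilon> y)"
    using truncated_gaussian_mass[OF assms] mass_const_pos by linarith
  then show "0 < norm_const \<epsilon>"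
    unfolding norm_const_def using assms by simp
  show "norm_const \<epsilon> \<le> peak_const / \<epsilon> ^ DIM('a)"
    unfolding norm_const_def gauss_factor[OF assms(1)] peak_const_def
    using truncated_gaussian_mass[OF assms] mass_const_pos assms Z
    by (simp add: divide_simps mult_left_mono)
qed

text \<open>The exponential is the Gaussian at distance 1/2 from the origin, where the gradient of
  the cutoff may start. Its decay absorbs the peak eps^-n, because y^n \<le> n^n exp(y) for y = 1/(8
  eps^2). This is why the additive constant in \<open>d\<Phi>_le\<close> can be independent of
  eps.\<close>

lemma power_gaussian_tail:
  assumes "0 < \<epsilon>" "\<epsilon> < 1"
  shows "1 / \<epsilon> ^ DIM('a) * exp (- 1 / (8 * \<epsilon>\<^sup>2)) \<le> (8 * real DIM('a)) ^ DIM('a)"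
proof -
  let ?N = "DIM('a)"
  define y where "y = 1 / (8 * \<epsilon>\<^sup>2)"
  have y: "0 < y" "1 / \<epsilon>\<^sup>2 = 8 * y" using assms by (simp_all add: y_def)
  have "y / ?N \<le> exp (y / ?N)" using exp_ge_add_one_self[of "y / ?N"] by linarith
  then have "(y / ?N) ^ ?N \<le> exp (y / ?N) ^ ?N" using y by (intro power_mono) auto
  also have "\<dots> = exp y" by (simp flip: exp_of_nat_mult)
  finally have e: "y ^ ?N \<le> ?N ^ ?N * exp y" by (simp add: power_divide divide_simps mult.commute)
  have "1 / \<epsilon> ^ ?N \<le> (1 / \<epsilon>\<^sup>2) ^ ?N"
  proof -
    have "\<epsilon>\<^sup>2 \<le> \<epsilon>" using assms by (simp add: power2_eq_square mult_left_le)
    then have "1 / \<epsilon> \<le> 1 / \<epsilon>\<^sup>2" using assms by (intro divide_left_mono) auto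
    then have "(1 / \<epsilon>) ^ ?N \<le> (1 / \<epsilon>\<^sup>2) ^ ?N" using assms by (intro power_mono) auto
    then show ?thesis by (simp add: power_divide)
  qed
  also have "\<dots> = 8 ^ ?N * y ^ ?N" by (simp add: y(2) power_mult_distrib)
  also have "\<dots> \<le> 8 ^ ?N * (?N ^ ?N * exp y)" using e by (intro mult_left_mono) auto
  finally have "1 / \<epsilon> ^ ?N * exp (- y) \<le> (8 ^ ?N * (?N ^ ?N * exp y)) * exp (- y)"
    by (rule mult_right_mono) simp
  also have "\<dots> = (8 * real ?N) ^ ?N" by (simp add: power_mult_distrib exp_minus)
  finally show ?thesis by (simp add: y_def)
qed

lemma kernel_deriv:
  "(kernel \<psi> \<epsilon> has_derivative (\<lambda>v. inner (norm_const \<epsilon> *\<^sub>R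
     (gauss \<epsilon> x *\<^sub>R grad \<psi> x - (gauss \<epsilon> x / \<epsilon>\<^sup>2) *\<^sub>R (\<psi> x *\<^sub>R x))) v)) (at x)"
  unfolding kernel_eq[abs_def]
  by (auto intro!: derivative_eq_intros \<psi>_deriv gauss_deriv
      simp: inner_diff_left inner_add_left algebra_simps)

lemma grad_kernel:
  "grad (kernel \<psi> \<epsilon>) x = norm_const \<epsilon> *\<^sub>R
     (gauss \<epsilon> x *\<^sub>R grad \<psi> x - (gauss \<epsilon> x / \<epsilon>\<^sup>2) *\<^sub>R (\<psi> x *\<^sub>R x))"
  by (rule grad_unique[OF kernel_deriv])

lemma \<psi>_norm_le: "\<psi> x * norm x \<le> \<psi> x"
  using \<psi>_range[of x] \<psi>_outer[of x] by (cases "norm x \<le> 1") (auto simp: mult_left_le)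

lemma norm_scaleR_diff_le:
  fixes u v :: "'b::real_normed_vector"
  shows "norm (s *\<^sub>R u - t *\<^sub>R v) \<le> \<bar>s\<bar> * norm (u - v) + \<bar>s - t\<bar> * norm v"
proof -
  have "s *\<^sub>R u - t *\<^sub>R v = s *\<^sub>R (u - v) + (s - t) *\<^sub>R v" by (simp add: algebra_simps)
  then show ?thesis by (metis norm_scaleR norm_triangle_ineq)
qed

text \<open>Differentiating the Gaussian produces eps^-2 times x times the kernel, and the norm of x
  is at most 1 where the kernel lives; the other term is the gradient of the cutoff.\<close>

lemma norm_grad_kernel_le:
  assumes e: "0 < \<epsilon>" "\<epsilon> < 1"
  shows "norm (grad (kernel \<psi> \<epsilon>) x) \<le> norm_const \<epsilon> * (gauss \<epsilon> x * norm (grad \<psi> x)) + 1 / \<epsilon>\<^sup>2 * kernel \<psi> \<epsilon> x"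
proof -
  note c = norm_const_bounds[OF e]
  have g: "0 < gauss \<epsilon> x" by (rule gauss_range)
  have "norm ((gauss \<epsilon> x / \<epsilon>\<^sup>2) *\<^sub>R (\<psi> x *\<^sub>R x)) = gauss \<epsilon> x / \<epsilon>\<^sup>2 * (\<psi> x * norm x)"
    using g \<psi>_range[of x] by (simp add: abs_of_pos)
  also have "\<dots> \<le> gauss \<epsilon> x / \<epsilon>\<^sup>2 * \<psi> x"
    using \<psi>_norm_le[of x] g by (intro mult_left_mono) auto
  finally have "norm (gauss \<epsilon> x *\<^sub>R grad \<psi> x - (gauss \<epsilon> x / \<epsilon>\<^sup>2) *\<^sub>R (\<psi> x *\<^sub>R x))
      \<le> gauss \<epsilon> x * norm (grad \<psi> x) + gauss \<epsilon> x / \<epsilon>\<^sup>2 * \<psi> x"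
    using norm_triangle_ineq4[of "gauss \<epsilon> x *\<^sub>R grad \<psi> x" "(gauss \<epsilon> x / \<epsilon>\<^sup>2) *\<^sub>R (\<psi> x *\<^sub>R x)"] g
    by simp
  then have "norm_const \<epsilon> * norm (gauss \<epsilon> x *\<^sub>R grad \<psi> x - (gauss \<epsilon> x / \<epsilon>\<^sup>2) *\<^sub>R (\<psi> x *\<^sub>R x))
      \<le> norm_const \<epsilon> * (gauss \<epsilon> x * norm (grad \<psi> x) + gauss \<epsilon> x / \<epsilon>\<^sup>2 * \<psi> x)"
    using c(1) by (intro mult_left_mono) auto
  then show ?thesis
    unfolding grad_kernel norm_scaleR abs_of_pos[OF c(1)] by (simp add: kernel_eq algebra_simps)
qed

text \<open>The power eps^-4 comes from the Gaussian part, where the Lipschitz constant eps^-2 of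
  \<open>gauss\<close> meets the factor eps^-2 of its derivative; B + 7 + 1 collects all
  coefficients since eps^-2 is at least 1.\<close>

lemma grad_kernel_lipschitz:
  assumes e: "0 < \<epsilon>" "\<epsilon> < 1"
    and B: "0 \<le> B" "\<And>x y. norm (grad \<psi> x - grad \<psi> y) \<le> B * norm (x - y)"
  shows "norm (grad (kernel \<psi> \<epsilon>) x - grad (kernel \<psi> \<epsilon>) y)
    \<le> norm_const \<epsilon> * ((B + 8) / \<epsilon> ^ 4) * norm (x - y)"
proof -
  note c = norm_const_bounds[OF e]
  let ?d = "norm (x - y)"
  let ?r = "1 / \<epsilon>\<^sup>2"
  have r: "1 \<le> ?r" using e by (simp add: power_le_one)
  have glip: "\<bar>gauss \<epsilon> x - gauss \<epsilon> y\<bar> \<le> ?r * ?d" by (rule gauss_lipschitz[OF e])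
  have g1: "\<bar>gauss \<epsilon> x\<bar> \<le> 1" using gauss_range[of \<epsilon> x] by simp
  have 1: "norm (gauss \<epsilon> x *\<^sub>R grad \<psi> x - gauss \<epsilon> y *\<^sub>R grad \<psi> y) \<le> 1 * (B * ?d) + (?r * ?d) * 3"
    by (rule order.trans[OF norm_scaleR_diff_le])
      (intro add_mono mult_mono g1 glip B \<psi>_grad; use B(1) in simp)
  have "norm (\<psi> y *\<^sub>R y) \<le> 1" using \<psi>_norm_le[of y] \<psi>_range[of y] by simp
  then have 2: "norm (gauss \<epsilon> x *\<^sub>R (\<psi> x *\<^sub>R x) - gauss \<epsilon> y *\<^sub>R (\<psi> y *\<^sub>R y)) \<le> 1 * (4 * ?d) + (?r * ?d) * 1"
    by (intro order.trans[OF norm_scaleR_diff_le] add_mono mult_mono g1 glip \<psi>_id_lipschitz) auto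
  let ?u = "gauss \<epsilon> x *\<^sub>R grad \<psi> x - (gauss \<epsilon> x / \<epsilon>\<^sup>2) *\<^sub>R (\<psi> x *\<^sub>R x)"
  let ?v = "gauss \<epsilon> y *\<^sub>R grad \<psi> y - (gauss \<epsilon> y / \<epsilon>\<^sup>2) *\<^sub>R (\<psi> y *\<^sub>R y)"
  have "?u - ?v = (gauss \<epsilon> x *\<^sub>R grad \<psi> x - gauss \<epsilon> y *\<^sub>R grad \<psi> y)
      - ?r *\<^sub>R (gauss \<epsilon> x *\<^sub>R (\<psi> x *\<^sub>R x) - gauss \<epsilon> y *\<^sub>R (\<psi> y *\<^sub>R y))"
    by (simp add: scaleR_diff_right)
  also have "norm \<dots> \<le> (1 * (B * ?d) + (?r * ?d) * 3) + ?r * (1 * (4 * ?d) + (?r * ?d) * 1)"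
  proof (rule order.trans[OF norm_triangle_ineq4 add_mono[OF 1]])
    show "norm (?r *\<^sub>R (gauss \<epsilon> x *\<^sub>R (\<psi> x *\<^sub>R x) - gauss \<epsilon> y *\<^sub>R (\<psi> y *\<^sub>R y)))
        \<le> ?r * (1 * (4 * ?d) + (?r * ?d) * 1)"
      unfolding norm_scaleR using r by (intro mult_mono 2) auto
  qed
  also have "\<dots> = (B + 7 * ?r + ?r * ?r) * ?d" by (simp add: algebra_simps)
  also have "\<dots> \<le> ((B + 8) * (?r * ?r)) * ?d"
  proof (rule mult_right_mono)
    have "1 * 1 \<le> ?r * ?r" using r by (intro mult_mono) auto
    then have "B * 1 \<le> B * (?r * ?r)" using B(1) by (intro mult_left_mono) auto
    moreover have "?r * 1 \<le> ?r * ?r" using r by (intro mult_left_mono) auto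
    moreover have "u + 7 * s + q \<le> v + 8 * q" if "u * 1 \<le> v" "s * 1 \<le> q" for u v s q :: real
      using that by simp
    ultimately show "B + 7 * ?r + ?r * ?r \<le> (B + 8) * (?r * ?r)" unfolding distrib_right by blast
  qed simp
  finally have "norm_const \<epsilon> * norm (?u - ?v) \<le> norm_const \<epsilon> * (((B + 8) * (?r * ?r)) * ?d)"
    using c(1) by (intro mult_left_mono) auto
  moreover have "?r * ?r = 1 / \<epsilon> ^ 4" by (simp add: power4_eq_xxxx power2_eq_square)
  ultimately show ?thesis
    unfolding grad_kernel scaleR_diff_right[symmetric] norm_scaleR abs_of_pos[OF c(1)] by (simp add: mult.assoc)
qed

lemma kernel_mollifier:
  "\<exists>C>0. \<forall>\<epsilon>. 0 < \<epsilon> \<longrightarrow> \<epsilon> < 1 \<longrightarrow> mollifier (kernel \<psi> \<epsilon>) (grad (kernel \<psi> \<epsilon>)) (1 / \<epsilon>\<^sup>2) C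
     (C / \<epsilon> ^ (DIM('a) + 2)) (C / \<epsilon> ^ (DIM('a) + 4))"
proof -
  let ?N = "DIM('a)"
  obtain B where B: "0 \<le> B" "\<And>x y. norm (grad \<psi> x - grad \<psi> y) \<le> B * norm (x - y)"
    using grad_\<psi>_lipschitz by blast
  \<comment> \<open>\<open>b0\<close> is the bound 3 for the gradient of the cutoff times the
    Gaussian tail. \<open>C\<close> serves as additive constant, as bound for kernel and gradient
    (which asks for 4 \<open>peak_const\<close>), and for the Lipschitz constant of the
    gradient.\<close>
  define b0 where "b0 = 3 * peak_const * (8 * real ?N) ^ ?N"
  define C where "C = b0 + peak_const * (B + 8)"
  have b0: "0 \<le> b0" using peak_const_pos by (simp add: b0_def)
  have pB: "0 \<le> peak_const * B" using peak_const_pos B(1) by simp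
  have C: "0 < C" "b0 \<le> C" "4 * peak_const \<le> C" "peak_const * (B + 8) \<le> C"
    using b0 pB peak_const_pos by (auto simp: C_def algebra_simps add_nonneg_pos)
  have "mollifier (kernel \<psi> \<epsilon>) (grad (kernel \<psi> \<epsilon>)) (1 / \<epsilon>\<^sup>2) C (C / \<epsilon> ^ (?N + 2)) (C / \<epsilon> ^ (?N + 4))"
    if e: "0 < \<epsilon>" "\<epsilon> < 1" for \<epsilon>
  proof
    note c = norm_const_bounds[OF e]
    have r: "1 \<le> 1 / \<epsilon>\<^sup>2" using e by (simp add: power_le_one)
    have \<Phi>c: "kernel \<psi> \<epsilon> x \<le> norm_const \<epsilon>" for x
    proof -
      have "\<psi> x * gauss \<epsilon> x \<le> 1 * 1"
        by (intro mult_mono \<psi>_range gauss_range) (simp_all add: less_imp_le gauss_range)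
      then have "norm_const \<epsilon> * (\<psi> x * gauss \<epsilon> x) \<le> norm_const \<epsilon> * 1"
        using c(1) by (intro mult_left_mono) auto
      then show ?thesis by (simp add: kernel_eq)
    qed
    have big: "norm_const \<epsilon> * (4 / \<epsilon>\<^sup>2) \<le> C / \<epsilon> ^ (?N + 2)"
    proof -
      have "norm_const \<epsilon> * (4 / \<epsilon>\<^sup>2) \<le> peak_const / \<epsilon> ^ ?N * (4 / \<epsilon>\<^sup>2)"
        using c(2) by (intro mult_right_mono) auto
      also have "\<dots> = (4 * peak_const) / \<epsilon> ^ (?N + 2)"
        by (simp add: power_add power2_eq_square mult.commute mult.left_commute)
      also have "\<dots> \<le> C / \<epsilon> ^ (?N + 2)" using C(3) e by (intro divide_right_mono) auto
      finally show ?thesis .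
    qed
    have \<Phi>0: "0 \<le> kernel \<psi> \<epsilon> x" for x
      unfolding kernel_eq using c(1) \<psi>_range(1)[of x] gauss_range(1)[of \<epsilon> x] by simp
    fix x y :: 'a
    show "(kernel \<psi> \<epsilon> has_derivative (\<lambda>v. inner (grad (kernel \<psi> \<epsilon>) x) v)) (at x)"
      unfolding grad_kernel by (rule kernel_deriv)
    show "0 \<le> kernel \<psi> \<epsilon> x" by (rule \<Phi>0)
    have "norm_const \<epsilon> * 1 \<le> norm_const \<epsilon> * (4 / \<epsilon>\<^sup>2)"
      using r c(1) by (intro mult_left_mono) auto
    then show "kernel \<psi> \<epsilon> x \<le> C / \<epsilon> ^ (?N + 2)"
      using \<Phi>c[of x] big by linarith
    show "(LINT x|lborel. kernel \<psi> \<epsilon> x) = 1"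
      using truncated_gaussian_mass[OF e] mass_const_pos unfolding kernel_def by simp
    show "kernel \<psi> \<epsilon> x = 0" "grad (kernel \<psi> \<epsilon>) x = 0" if "norm x \<ge> 1"
      using that by (simp_all add: kernel_eq grad_kernel \<psi>_outer grad_\<psi>_eq_0)
    show "kernel \<psi> \<epsilon> (- x) = kernel \<psi> \<epsilon> x"
      using \<psi>_radial[of "- x" x] by (simp add: kernel_eq gauss_def)
    show "norm (grad (kernel \<psi> \<epsilon>) x) \<le> 1 / \<epsilon>\<^sup>2 * kernel \<psi> \<epsilon> x + C"
    proof -
      have "norm_const \<epsilon> * (gauss \<epsilon> x * norm (grad \<psi> x)) \<le> b0"
      proof (cases "norm x \<le> 1/2")
        case False
        have "(1/2)\<^sup>2 \<le> (norm x)\<^sup>2" using False by (intro power_mono) auto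
        then have "1 / (8 * \<epsilon>\<^sup>2) \<le> (norm x)\<^sup>2 / (2 * \<epsilon>\<^sup>2)"
          using e by (simp add: power2_eq_square field_simps)
        then have "gauss \<epsilon> x \<le> exp (- 1 / (8 * \<epsilon>\<^sup>2))" by (simp add: gauss_def)
        then have "norm_const \<epsilon> * (gauss \<epsilon> x * norm (grad \<psi> x))
            \<le> peak_const / \<epsilon> ^ ?N * (exp (- 1 / (8 * \<epsilon>\<^sup>2)) * 3)"
          using c gauss_range(1)[of \<epsilon> x] peak_const_pos e by (intro mult_mono \<psi>_grad) auto
        also have "\<dots> = 3 * peak_const * (1 / \<epsilon> ^ ?N * exp (- 1 / (8 * \<epsilon>\<^sup>2)))" by simp
        also have "\<dots> \<le> b0"
          unfolding b0_def using power_gaussian_tail[OF e] peak_const_pos by (intro mult_left_mono) auto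
        finally show ?thesis .
      qed (simp add: grad_\<psi>_eq_0 b0)
      then show ?thesis using norm_grad_kernel_le[OF e, of x] C(2) by linarith
    qed
    show "norm (grad (kernel \<psi> \<epsilon>) x) \<le> C / \<epsilon> ^ (?N + 2)"
    proof -
      have "gauss \<epsilon> x * norm (grad \<psi> x) \<le> 1 * 3"
        using gauss_range[of \<epsilon> x] by (intro mult_mono \<psi>_grad) auto
      then have "norm_const \<epsilon> * (gauss \<epsilon> x * norm (grad \<psi> x)) \<le> norm_const \<epsilon> * (3 * (1 / \<epsilon>\<^sup>2))"
        using r c(1) by (intro mult_left_mono) linarith+
      moreover have "1 / \<epsilon>\<^sup>2 * kernel \<psi> \<epsilon> x \<le> 1 / \<epsilon>\<^sup>2 * norm_const \<epsilon>"
        using \<Phi>c[of x] by (intro mult_left_mono) auto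
      ultimately have "norm (grad (kernel \<psi> \<epsilon>) x) \<le> norm_const \<epsilon> * (3 * (1 / \<epsilon>\<^sup>2)) + 1 / \<epsilon>\<^sup>2 * norm_const \<epsilon>"
        using norm_grad_kernel_le[OF e, of x] by linarith
      also have "\<dots> = norm_const \<epsilon> * (4 / \<epsilon>\<^sup>2)" by simp
      finally show ?thesis using big by linarith
    qed
    have "norm (grad (kernel \<psi> \<epsilon>) x - grad (kernel \<psi> \<epsilon>) y) \<le> norm_const \<epsilon> * ((B + 8) / \<epsilon> ^ 4) * norm (x - y)"
      by (rule grad_kernel_lipschitz[OF e B])
    also have "\<dots> \<le> C / \<epsilon> ^ (?N + 4) * norm (x - y)"
    proof (rule mult_right_mono)
      have "norm_const \<epsilon> * ((B + 8) / \<epsilon> ^ 4) \<le> peak_const / \<epsilon> ^ ?N * ((B + 8) / \<epsilon> ^ 4)"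
        using c(2) B(1) by (intro mult_right_mono) auto
      also have "\<dots> = (peak_const * (B + 8)) / \<epsilon> ^ (?N + 4)" by (simp add: power_add)
      also have "\<dots> \<le> C / \<epsilon> ^ (?N + 4)" using C(4) e by (intro divide_right_mono) auto
      finally show "norm_const \<epsilon> * ((B + 8) / \<epsilon> ^ 4) \<le> C / \<epsilon> ^ (?N + 4)" .
    qed simp
    finally show "norm (grad (kernel \<psi> \<epsilon>) x - grad (kernel \<psi> \<epsilon>) y) \<le> C / \<epsilon> ^ (?N + 4) * norm (x - y)" .
  next
    show "C / \<epsilon> ^ (?N + 2) \<le> C / \<epsilon> ^ (?N + 4)"
      using e C(1) by (intro divide_left_mono power_decreasing) auto
  qed (use C e in auto)
  then show ?thesis using C(1) by blast
qed

end

section \<open>Convolution with a mollifier\<close>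

definition ball_vol :: "'a::euclidean_space itself \<Rightarrow> real" where
  "ball_vol _ = content (cball (0::'a) 1)"

lemma content_unit_cball: "content (cball (x::'a::euclidean_space) 1) = ball_vol TYPE('a)"
  by (simp add: ball_vol_def content_cball)

lemma ball_vol_nonneg: "0 \<le> ball_vol TYPE('a::euclidean_space)"
  by (simp add: ball_vol_def)

text \<open>Differences of convolution integrands at two base points live on two unit balls, so
  their integrals are controlled by the supremum with a volume that ignores the distance of the
  points.\<close>

lemma norm_integral_two_balls_le:
  fixes f :: "'a::euclidean_space \<Rightarrow> 'b::{banach, second_countable_topology}"
  assumes f: "integrable lborel f"
    and le: "\<And>y. norm (f y) \<le> c" and z: "\<And>y. y \<notin> cball x 1 \<union> cball x' 1 \<Longrightarrow> f y = 0"
  shows "norm (LINT y|lborel. f y) \<le> c * (2 * ball_vol TYPE('a))"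
proof -
  have i: "integrable lborel (\<lambda>y. c * indicator (cball z 1) y)" for z :: 'a
    by (intro integrable_mult_right integrable_real_indicator emeasure_lborel_cball_finite) simp
  have c: "0 \<le> c" using le[of undefined] norm_ge_zero order_trans by blast
  have "norm (LINT y|lborel. f y) \<le> (LINT y|lborel. c * indicator (cball x 1) y + c * indicator (cball x' 1) y)"
  proof (rule Bochner_Integration.integral_norm_bound_integral[OF f])
    show "integrable lborel (\<lambda>y. c * indicator (cball x 1) y + c * indicator (cball x' 1) y)"
      by (intro Bochner_Integration.integrable_add i)
    show "norm (f y) \<le> c * indicator (cball x 1) y + c * indicator (cball x' 1) y" for y
    proof (cases "y \<in> cball x 1 \<union> cball x' 1")
      case True
      then show ?thesis using le[of y] c by (auto simp: indicator_def)
    next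
      case False
      then show ?thesis using z[OF False] by (auto simp: indicator_def)
    qed
  qed
  also have "\<dots> = (LINT y|lborel. c * indicator (cball x 1) y) + (LINT y|lborel. c * indicator (cball x' 1) y)"
    by (rule Bochner_Integration.integral_add[OF i i])
  also have "\<dots> = c * (2 * ball_vol TYPE('a))"
    by (simp add: content_unit_cball)
  finally show ?thesis .
qed

section \<open>Convolution of a vector field and its derivative\<close>

context mollifier
begin

lemma L2_pos: "0 < L2"
  using constants by linarith

lemma \<Phi>_lipschitz: "\<bar>\<Phi> x - \<Phi> y\<bar> \<le> L1 * norm (x - y)"
  by (rule lipschitz_of_grad_bound[OF \<Phi>_deriv d\<Phi>_le_L1])

lemma continuous_on_\<Phi>: "continuous_on S \<Phi>"
  by (intro continuous_at_imp_continuous_on ballI has_derivative_continuous[OF \<Phi>_deriv])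

lemma continuous_on_d\<Phi>: "continuous_on S d\<Phi>"
  by (rule lipschitz_on_continuous_on[of L2], rule lipschitz_onI)
    (use d\<Phi>_lipschitz L2_pos in \<open>auto simp: dist_norm\<close>)

text \<open>Mean value inequality for \<Phi> minus its linear part at x, on the ball of radius
  \<open>norm v\<close>, where the gradient of that difference is at most
  \<open>L2 * norm v\<close>.\<close>

lemma \<Phi>_taylor: "\<bar>\<Phi> (x + v) - \<Phi> x - inner (d\<Phi> x) v\<bar> \<le> L2 * norm v * norm v"
proof -
  let ?g = "\<lambda>z. \<Phi> z - inner (d\<Phi> x) z"
  have "norm (?g (x + v) - ?g x) \<le> (L2 * norm v) * norm ((x + v) - x)"
  proof (rule differentiable_bound[of "cball x (norm v)" ?g "\<lambda>z v. inner (d\<Phi> z - d\<Phi> x) v"])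
    show "(?g has_derivative (\<lambda>v. inner (d\<Phi> z - d\<Phi> x) v)) (at z within cball x (norm v))" for z
      unfolding inner_diff_left
      by (rule has_derivative_at_withinI, rule has_derivative_diff[OF \<Phi>_deriv])
        (rule has_derivative_inner_right[OF has_derivative_ident])
    show "onorm (\<lambda>v. inner (d\<Phi> z - d\<Phi> x) v) \<le> L2 * norm v" if "z \<in> cball x (norm v)" for z
    proof (rule onorm_le)
      fix w
      have "norm (inner (d\<Phi> z - d\<Phi> x) w) \<le> norm (d\<Phi> z - d\<Phi> x) * norm w" by (simp add: Cauchy_Schwarz_ineq2)
      also have "norm (d\<Phi> z - d\<Phi> x) \<le> L2 * norm v"
      proof (rule order.trans[OF d\<Phi>_lipschitz mult_left_mono])
        show "norm (z - x) \<le> norm v" using that by (simp add: dist_norm norm_minus_commute)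
      qed (use L2_pos in simp)
      finally show "norm (inner (d\<Phi> z - d\<Phi> x) w) \<le> L2 * norm v * norm w" by (simp add: mult_right_mono)
    qed
  qed (auto simp: dist_norm)
  then show ?thesis by (simp add: inner_add_right)
qed

lemma integral_\<Phi>_shift: "(LINT y|lborel. \<Phi> (x - y)) = 1"
proof -
  have m: "\<Phi> \<in> borel_measurable borel"
    by (rule borel_measurable_continuous_onI[OF continuous_on_\<Phi>])
  have "(LINT y|lborel. \<Phi> (x - y)) = (LINT y|lborel. \<Phi> (- x + y))"
    using \<Phi>_even[of "x - y" for y] by (simp add: algebra_simps)
  also have "\<dots> = (LINT y|distr lborel borel ((+) (- x)). \<Phi> y)"
    by (subst integral_distr) (use m in auto)
  also have "\<dots> = 1" by (simp add: lborel_distr_plus \<Phi>_integral)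
  finally show ?thesis .
qed

text \<open>A function that is not integrable has integral 0 by convention, but this one has
  integral 1.\<close>

lemma integrable_\<Phi>_shift: "integrable lborel (\<lambda>y. \<Phi> (x - y))"
  using integral_\<Phi>_shift[of x] not_integrable_integral_eq by fastforce

definition conv :: "('a \<Rightarrow> 'a) \<Rightarrow> 'a \<Rightarrow> 'a" where
  "conv w x = (LINT y|lborel. \<Phi> (x - y) *\<^sub>R w y)"

text \<open>\<open>Blinfun\<close> denotes the intended operator only for a bounded linear argument;
  \<open>Dconv_apply\<close> supplies this for continuous w.\<close>

definition Dconv :: "('a \<Rightarrow> 'a) \<Rightarrow> 'a \<Rightarrow> 'a \<Rightarrow>\<^sub>L 'a" where
  "Dconv w x = Blinfun (\<lambda>v. LINT y|lborel. inner (d\<Phi> (x - y)) v *\<^sub>R w y)"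

context
  fixes w :: "'a \<Rightarrow> 'a"
  assumes w: "continuous_on UNIV w"
begin

lemma conv_integrable: "integrable lborel (\<lambda>y. \<Phi> (x - y) *\<^sub>R w y)"
proof (rule integrable_of_compact_support[of _ x 1])
  show "continuous_on UNIV (\<lambda>y. \<Phi> (x - y) *\<^sub>R w y)"
    by (intro continuous_intros w continuous_on_compose2[OF continuous_on_\<Phi>[of UNIV]]) auto
qed (simp add: \<Phi>_support dist_norm)

lemma Dconv_integrable: "integrable lborel (\<lambda>y. inner (d\<Phi> (x - y)) v *\<^sub>R w y)"
proof (rule integrable_of_compact_support[of _ x 1])
  show "continuous_on UNIV (\<lambda>y. inner (d\<Phi> (x - y)) v *\<^sub>R w y)"
    by (intro continuous_intros w continuous_on_compose2[OF continuous_on_d\<Phi>[of UNIV]]) auto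
qed (simp add: d\<Phi>_support dist_norm)

lemma Dconv_apply: "blinfun_apply (Dconv w x) v = (LINT y|lborel. inner (d\<Phi> (x - y)) v *\<^sub>R w y)"
proof -
  have "linear (\<lambda>v. LINT y|lborel. inner (d\<Phi> (x - y)) v *\<^sub>R w y)"
  proof (rule linearI)
    show "(LINT y|lborel. inner (d\<Phi> (x - y)) (u + v) *\<^sub>R w y)
        = (LINT y|lborel. inner (d\<Phi> (x - y)) u *\<^sub>R w y) + (LINT y|lborel. inner (d\<Phi> (x - y)) v *\<^sub>R w y)" for u v
      by (simp add: inner_add_right scaleR_add_left Dconv_integrable)
    show "(LINT y|lborel. inner (d\<Phi> (x - y)) (c *\<^sub>R v) *\<^sub>R w y)
        = c *\<^sub>R (LINT y|lborel. inner (d\<Phi> (x - y)) v *\<^sub>R w y)" for c v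
      by (subst integral_scaleR_right[symmetric]) (simp add: Dconv_integrable)
  qed
  then show ?thesis
    unfolding Dconv_def by (simp add: bounded_linear_Blinfun_apply linear_conv_bounded_linear)
qed

context
  fixes B :: real
  assumes wB: "norm (w y) \<le> B"
begin

lemma B_nonneg: "0 \<le> B"
  using wB[of 0] norm_ge_zero order_trans by blast

lemma norm_conv_le: "norm (conv w x) \<le> B"
proof -
  note i = integrable_\<Phi>_shift[of x]
  have "norm (conv w x) \<le> (LINT y|lborel. B * \<Phi> (x - y))"
    unfolding conv_def
  proof (rule Bochner_Integration.integral_norm_bound_integral[OF conv_integrable])
    show "integrable lborel (\<lambda>y. B * \<Phi> (x - y))" using i by simp
    show "norm (\<Phi> (x - y) *\<^sub>R w y) \<le> B * \<Phi> (x - y)" for y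
      using wB[of y] \<Phi>_nonneg[of "x - y"] by (simp add: mult.commute mult_right_mono)
  qed
  also have "\<dots> = B" using i by (simp add: integral_\<Phi>_shift)
  finally show ?thesis .
qed

text \<open>The kernel part of \<open>d\<Phi>_le\<close> integrates to a because \<Phi> has integral
  1, and the additive part to b times the unit ball's volume. The uniform bound on the gradient
  would have cost an extra eps^-n.\<close>

lemma norm_Dconv_le: "norm (Dconv w x) \<le> (a + b * ball_vol TYPE('a)) * B"
proof (rule norm_blinfun_bound)
  show "0 \<le> (a + b * ball_vol TYPE('a)) * B"
    using constants B_nonneg ball_vol_nonneg[where 'a = 'a] by simp
  fix v :: 'a
  let ?g = "\<lambda>y. (a * \<Phi> (x - y) + b * indicator (cball x 1) y) * (norm v * B)"
  note i = integrable_\<Phi>_shift[of x]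
  have i2: "integrable lborel (\<lambda>y. indicator (cball x 1) y :: real)"
    by (intro integrable_real_indicator emeasure_lborel_cball_finite) simp
  have "norm (blinfun_apply (Dconv w x) v) \<le> (LINT y|lborel. ?g y)"
    unfolding Dconv_apply
  proof (rule Bochner_Integration.integral_norm_bound_integral[OF Dconv_integrable])
    show "integrable lborel ?g" using i i2 by simp
    fix y
    have "norm (d\<Phi> (x - y)) \<le> a * \<Phi> (x - y) + b * indicator (cball x 1) y"
    proof (cases "y \<in> cball x 1")
      case True
      then show ?thesis using d\<Phi>_le[of "x - y"] by simp
    next
      case False
      then show ?thesis using d\<Phi>_support[of "x - y"] \<Phi>_nonneg[of "x - y"] constants by (simp add: dist_norm)
    qed
    then have "norm (d\<Phi> (x - y)) * norm v * norm (w y)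
        \<le> (a * \<Phi> (x - y) + b * indicator (cball x 1) y) * norm v * B"
      using wB[of y] by (intro mult_mono mult_nonneg_nonneg) (auto intro: order.trans[OF norm_ge_zero])
    moreover have "norm (inner (d\<Phi> (x - y)) v *\<^sub>R w y) \<le> norm (d\<Phi> (x - y)) * norm v * norm (w y)"
      by (simp add: Cauchy_Schwarz_ineq2 mult_right_mono)
    ultimately show "norm (inner (d\<Phi> (x - y)) v *\<^sub>R w y) \<le> ?g y" by (simp add: mult.assoc)
  qed
  also have "\<dots> = (a + b * ball_vol TYPE('a)) * B * norm v"
    using i i2 by (simp add: integral_\<Phi>_shift content_unit_cball mult_ac)
  finally show "norm (blinfun_apply (Dconv w x) v) \<le> (a + b * ball_vol TYPE('a)) * B * norm v" .
qed

lemma Dconv_lipschitz: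
  "norm (Dconv w x - Dconv w x') \<le> L2 * (2 * ball_vol TYPE('a)) * B * norm (x - x')"
proof (rule norm_blinfun_bound)
  show "0 \<le> L2 * (2 * ball_vol TYPE('a)) * B * norm (x - x')"
    using L2_pos B_nonneg ball_vol_nonneg[where 'a = 'a] by simp
  fix v :: 'a
  have "blinfun_apply (Dconv w x - Dconv w x') v
      = (LINT y|lborel. inner (d\<Phi> (x - y) - d\<Phi> (x' - y)) v *\<^sub>R w y)"
    by (simp add: blinfun.diff_left Dconv_apply inner_diff_left scaleR_diff_left Dconv_integrable)
  also have "norm \<dots> \<le> (L2 * norm (x - x') * norm v * B) * (2 * ball_vol TYPE('a))"
  proof (rule norm_integral_two_balls_le[where x = x and x' = x'])
    show "integrable lborel (\<lambda>y. inner (d\<Phi> (x - y) - d\<Phi> (x' - y)) v *\<^sub>R w y)"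
      by (simp add: inner_diff_left scaleR_diff_left Dconv_integrable)
    fix y
    show "norm (inner (d\<Phi> (x - y) - d\<Phi> (x' - y)) v *\<^sub>R w y) \<le> L2 * norm (x - x') * norm v * B"
    proof -
      have "\<bar>inner (d\<Phi> (x - y) - d\<Phi> (x' - y)) v\<bar> \<le> norm (d\<Phi> (x - y) - d\<Phi> (x' - y)) * norm v"
        by (rule Cauchy_Schwarz_ineq2)
      also have "\<dots> \<le> L2 * norm (x - x') * norm v"
        using d\<Phi>_lipschitz[of "x - y" "x' - y"] by (intro mult_right_mono) auto
      finally show ?thesis
        unfolding norm_scaleR using wB[of y] L2_pos by (intro mult_mono) auto
    qed
    show "inner (d\<Phi> (x - y) - d\<Phi> (x' - y)) v *\<^sub>R w y = 0" if "y \<notin> cball x 1 \<union> cball x' 1"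
      using that d\<Phi>_support[of "x - y"] d\<Phi>_support[of "x' - y"] by (simp add: dist_norm)
  qed
  finally show "norm (blinfun_apply (Dconv w x - Dconv w x') v)
      \<le> L2 * (2 * ball_vol TYPE('a)) * B * norm (x - x') * norm v" by (simp add: mult_ac)
qed

text \<open>Differentiation under the integral: the Taylor remainder is quadratic uniformly in y and
  supported in two unit balls.\<close>

lemma conv_has_derivative: "(conv w has_derivative blinfun_apply (Dconv w x)) (at x)"
proof (rule has_derivativeI_sandwich[where e = 1])
  let ?C = "L2 * B * (2 * ball_vol TYPE('a))"
  show "bounded_linear (blinfun_apply (Dconv w x))" by (rule blinfun.bounded_linear_right)
  show "((\<lambda>z. ?C * norm (z - x)) \<longlongrightarrow> 0) (at x)"
    by (auto intro!: tendsto_eq_intros)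
  fix z :: 'a assume z: "z \<noteq> x"
  let ?r = "\<lambda>y. \<Phi> (z - y) - \<Phi> (x - y) - inner (d\<Phi> (x - y)) (z - x)"
  have "conv w z - conv w x - blinfun_apply (Dconv w x) (z - x) = (LINT y|lborel. ?r y *\<^sub>R w y)"
    by (simp add: conv_def Dconv_apply scaleR_diff_left conv_integrable Dconv_integrable)
  also have "norm \<dots> \<le> (L2 * norm (z - x) * norm (z - x) * B) * (2 * ball_vol TYPE('a))"
  proof (rule norm_integral_two_balls_le[where x = x and x' = z])
    show "integrable lborel (\<lambda>y. ?r y *\<^sub>R w y)"
      by (simp add: scaleR_diff_left conv_integrable Dconv_integrable)
    fix y
    have "\<bar>?r y\<bar> \<le> L2 * norm (z - x) * norm (z - x)"
      using \<Phi>_taylor[of "x - y" "z - x"] by simp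
    then show "norm (?r y *\<^sub>R w y) \<le> L2 * norm (z - x) * norm (z - x) * B"
      unfolding norm_scaleR using wB[of y] L2_pos by (intro mult_mono) auto
    show "?r y *\<^sub>R w y = 0" if "y \<notin> cball x 1 \<union> cball z 1"
      using that \<Phi>_support[of "x - y"] \<Phi>_support[of "z - y"] d\<Phi>_support[of "x - y"] by (simp add: dist_norm)
  qed
  finally show "norm (conv w z - conv w x - blinfun_apply (Dconv w x) (z - x)) / norm (z - x) \<le> ?C * norm (z - x)"
    using z by (simp add: divide_simps mult_ac)
qed simp

end

end

lemma conv_diff:
  assumes "continuous_on UNIV w" "continuous_on UNIV w'"
  shows "conv w x - conv w' x = conv (\<lambda>y. w y - w' y) x"
    and "Dconv w x - Dconv w' x = Dconv (\<lambda>y. w y - w' y) x"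
proof -
  show "conv w x - conv w' x = conv (\<lambda>y. w y - w' y) x"
    using assms by (simp add: conv_def scaleR_diff_right conv_integrable)
  have c: "continuous_on UNIV (\<lambda>y. w y - w' y)" using assms by (intro continuous_intros)
  show "Dconv w x - Dconv w' x = Dconv (\<lambda>y. w y - w' y) x"
    by (rule blinfun_eqI)
      (use assms in \<open>simp add: blinfun.diff_left Dconv_apply c scaleR_diff_right Dconv_integrable\<close>)
qed

end

section \<open>The approximate mean curvature\<close>

lemma blinfun_apply_Basis_sum:
  fixes S :: "'a::euclidean_space \<Rightarrow>\<^sub>L 'b::real_normed_vector"
  shows "blinfun_apply S u = (\<Sum>i\<in>Basis. inner u i *\<^sub>R blinfun_apply S i)"
  by (subst euclidean_representation[of u, symmetric]) (simp only: blinfun.sum_right blinfun.scaleR_right)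

locale curvature = mollifier \<Phi> d\<Phi> a b L1 L2
  for \<Phi> :: "'a::euclidean_space \<Rightarrow> real" and d\<Phi> :: "'a \<Rightarrow> 'a" and a b L1 L2 :: real +
  fixes e :: real
  assumes e_pos: "0 < e"
begin

definition dens :: "'a varifold \<Rightarrow> 'a \<Rightarrow> real" where
  "dens V y = (LINT p|V. \<Phi> (fst p - y))"

definition fvar :: "'a varifold \<Rightarrow> 'a \<Rightarrow> 'a" where
  "fvar V y = (LINT p|V. blinfun_apply (snd p) (d\<Phi> (fst p - y)))"

definition pre :: "'a varifold \<Rightarrow> 'a \<Rightarrow> 'a" where
  "pre V y = - (fvar V y /\<^sub>R (dens V y + e))"

definition curv :: "'a varifold \<Rightarrow> 'a \<Rightarrow> 'a" where "curv V = conv (pre V)"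

definition Dcurv :: "'a varifold \<Rightarrow> 'a \<Rightarrow> 'a \<Rightarrow>\<^sub>L 'a" where "Dcurv V = Dconv (pre V)"

text \<open>The two summands are the two halves of \<open>d\<Phi>_le\<close> after division by
  \<open>dens V y + e\<close>: a is absorbed by the density, while b times the mass is divided by at
  least e.\<close>

definition pre_bound :: "real \<Rightarrow> real" where "pre_bound m = a + b * m / e"

lemma pre_bound_nonneg: "0 \<le> m \<Longrightarrow> 0 \<le> pre_bound m"
  using constants e_pos by (simp add: pre_bound_def)

lemma variation_integrand_lipschitz:
  assumes "p \<in> plane_bundle d" "q \<in> plane_bundle d"
  shows "norm (blinfun_apply (snd p) (d\<Phi> (fst p - y)) - blinfun_apply (snd q) (d\<Phi> (fst q - y))) \<le> L2 * sum_dist p q"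
proof -
  let ?u = "d\<Phi> (fst p - y)" and ?v = "d\<Phi> (fst q - y)"
  have "blinfun_apply (snd p) ?u - blinfun_apply (snd q) ?v
      = blinfun_apply (snd p) (?u - ?v) + blinfun_apply (snd p - snd q) ?v"
    by (simp add: blinfun.diff_left blinfun.diff_right)
  also have "norm \<dots> \<le> L2 * norm (fst p - fst q) + norm (snd p - snd q) * L2"
  proof (rule norm_triangle_le[OF add_mono])
    have "norm (blinfun_apply (snd p) (?u - ?v)) \<le> norm (?u - ?v)"
      using assms(1) by (auto intro: norm_grassmannian_apply)
    also have "\<dots> \<le> L2 * norm (fst p - fst q)"
      using d\<Phi>_lipschitz[of "fst p - y" "fst q - y"] by simp
    finally show "norm (blinfun_apply (snd p) (?u - ?v)) \<le> L2 * norm (fst p - fst q)" .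
    show "norm (blinfun_apply (snd p - snd q) ?v) \<le> norm (snd p - snd q) * L2"
      using d\<Phi>_le_L1[of "fst q - y"] constants(4)
      by (intro order.trans[OF norm_blinfun] mult_left_mono) auto
  qed
  finally show ?thesis by (simp add: sum_dist_def dist_norm algebra_simps)
qed

lemma norm_variation_integrand_le:
  assumes "p \<in> plane_bundle d"
  shows "norm (blinfun_apply (snd p) (d\<Phi> (fst p - y))) \<le> norm (d\<Phi> (fst p - y))"
    and "norm (blinfun_apply (snd p) (d\<Phi> (fst p - y))) \<le> L1"
proof -
  show *: "norm (blinfun_apply (snd p) (d\<Phi> (fst p - y))) \<le> norm (d\<Phi> (fst p - y))"
    using assms by (auto intro: norm_grassmannian_apply)
  show "norm (blinfun_apply (snd p) (d\<Phi> (fst p - y))) \<le> L1"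
    using * d\<Phi>_le_L1 by (rule order.trans)
qed

context
  fixes d :: nat and m :: real and V :: "'a varifold"
  assumes V: "varifold_of_mass d m V" and m: "0 \<le> m"
begin

lemma density_integrable: "integrable V (\<lambda>p. \<Phi> (fst p - y))"
proof (rule varifold_integrable_bounded[OF V])
  have "continuous_on (plane_bundle d) (\<lambda>p. \<Phi> (fst p - y))"
    by (rule continuous_on_compose2[OF continuous_on_\<Phi>[of UNIV]]) (auto intro!: continuous_intros)
  then show "(\<lambda>p. \<Phi> (fst p - y)) \<in> borel_measurable V"
    by (rule varifold_measurable[OF varifold_of_massD(1)[OF V]])
  show "norm (\<Phi> (fst p - y)) \<le> L1" for p using \<Phi>_nonneg \<Phi>_le by simp
qed

lemma variation_integrable: "integrable V (\<lambda>p. blinfun_apply (snd p) (d\<Phi> (fst p - y)))"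
proof (rule varifold_integrable_bounded[OF V])
  have "continuous_on (plane_bundle d) (\<lambda>p. blinfun_apply (snd p) (d\<Phi> (fst p - y)))"
    by (rule continuous_on_sum_dist_lipschitz[where L = L2])
      (use variation_integrand_lipschitz L2_pos in \<open>simp_all only: dist_norm order.strict_implies_order\<close>)
  then show "(\<lambda>p. blinfun_apply (snd p) (d\<Phi> (fst p - y))) \<in> borel_measurable V"
    by (rule varifold_measurable[OF varifold_of_massD(1)[OF V]])
qed (rule norm_variation_integrand_le(2))

lemma dens_nonneg: "0 \<le> dens V y"
  unfolding dens_def by (rule integral_nonneg_AE) (simp add: \<Phi>_nonneg)

lemma norm_fvar_le: "norm (fvar V y) \<le> a * dens V y + b * m"
proof -
  interpret finite_measure V using varifold_of_massD(2)[OF V] .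
  have "norm (fvar V y) \<le> (LINT p|V. a * \<Phi> (fst p - y) + b)"
    unfolding fvar_def
  proof (rule order.trans[OF integral_norm_bound integral_mono])
    show "integrable V (\<lambda>p. norm (blinfun_apply (snd p) (d\<Phi> (fst p - y))))"
      using variation_integrable by simp
    show "integrable V (\<lambda>p. a * \<Phi> (fst p - y) + b)"
      using density_integrable by simp
    show "norm (blinfun_apply (snd p) (d\<Phi> (fst p - y))) \<le> a * \<Phi> (fst p - y) + b" if "p \<in> space V" for p
      using norm_variation_integrand_le(1)[of p d y] that d\<Phi>_le[of "fst p - y"]
      by (simp add: space_varifold[OF V])
  qed
  also have "\<dots> = a * dens V y + b * measure V (space V)"
    using density_integrable by (simp add: dens_def mult.commute)
  also have "\<dots> \<le> a * dens V y + b * m"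
    using varifold_of_massD(3)[OF V m] constants by (simp add: mult_left_mono)
  finally show ?thesis .
qed

lemma norm_pre_le: "norm (pre V y) \<le> pre_bound m"
proof -
  have D: "0 \<le> dens V y" by (rule dens_nonneg)
  have "norm (pre V y) = norm (fvar V y) / (dens V y + e)"
    using D e_pos by (simp add: pre_def divide_inverse mult.commute)
  also have "\<dots> \<le> (a * dens V y + b * m) / (dens V y + e)"
    using norm_fvar_le D e_pos by (intro divide_right_mono) auto
  also have "\<dots> = a * (dens V y / (dens V y + e)) + b * m / (dens V y + e)"
    by (simp add: add_divide_distrib)
  also have "\<dots> \<le> a * 1 + b * m / e"
    using D e_pos constants m by (intro add_mono mult_left_mono divide_left_mono) auto
  finally show ?thesis by (simp add: pre_bound_def)
qed

lemma continuous_on_dens: "continuous_on UNIV (dens V)"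
proof (rule lipschitz_on_continuous_on, rule lipschitz_onI)
  fix y z
  have "dens V y - dens V z = (LINT p|V. \<Phi> (fst p - y) - \<Phi> (fst p - z))"
    by (simp add: dens_def density_integrable)
  also have "norm \<dots> \<le> L1 * norm (y - z) * m"
  proof (rule varifold_integral_norm_bound[OF V m])
    show "norm (\<Phi> (fst p - y) - \<Phi> (fst p - z)) \<le> L1 * norm (y - z)" for p :: "'a \<times> ('a \<Rightarrow>\<^sub>L 'a)"
      using \<Phi>_lipschitz[of "fst p - y" "fst p - z"] by (simp add: norm_minus_commute)
  qed (use constants in simp)
  finally show "dist (dens V y) (dens V z) \<le> (L1 * m) * dist y z" by (simp add: dist_norm mult_ac)
qed (use constants m in simp)

lemma continuous_on_fvar: "continuous_on UNIV (fvar V)"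
proof (rule lipschitz_on_continuous_on, rule lipschitz_onI)
  fix y z
  have "fvar V y - fvar V z = (LINT p|V. blinfun_apply (snd p) (d\<Phi> (fst p - y)) - blinfun_apply (snd p) (d\<Phi> (fst p - z)))"
    by (simp add: fvar_def variation_integrable)
  also have "norm \<dots> \<le> L2 * norm (y - z) * m"
  proof (rule varifold_integral_norm_bound[OF V m])
    fix p :: "'a \<times> ('a \<Rightarrow>\<^sub>L 'a)" assume p: "p \<in> plane_bundle d"
    have "norm (blinfun_apply (snd p) (d\<Phi> (fst p - y) - d\<Phi> (fst p - z))) \<le> norm (d\<Phi> (fst p - y) - d\<Phi> (fst p - z))"
      using p by (auto intro: norm_grassmannian_apply)
    also have "\<dots> \<le> L2 * norm (y - z)"
      using d\<Phi>_lipschitz[of "fst p - y" "fst p - z"] by (simp add: norm_minus_commute)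
    finally show "norm (blinfun_apply (snd p) (d\<Phi> (fst p - y)) - blinfun_apply (snd p) (d\<Phi> (fst p - z))) \<le> L2 * norm (y - z)"
      by (simp add: blinfun.diff_right)
  qed (use L2_pos in simp)
  finally show "dist (fvar V y) (fvar V z) \<le> (L2 * m) * dist y z" by (simp add: dist_norm mult_ac)
qed (use L2_pos m in simp)

lemma continuous_on_pre: "continuous_on UNIV (pre V)"
proof -
  have "dens V y + e \<noteq> 0" for y using dens_nonneg[of y] e_pos by linarith
  then show ?thesis
    unfolding pre_def[abs_def] by (intro continuous_intros continuous_on_dens continuous_on_fvar) auto
qed

lemma curv_perturbation_field:
  assumes "0 \<le> \<tau>" "\<tau> * ((a + b * ball_vol TYPE('a)) * pre_bound m) \<le> 1 / (4 * jac_const TYPE('a))"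
  shows "perturbation_field (curv V) (Dcurv V) ((a + b * ball_vol TYPE('a)) * pre_bound m)
      (L2 * (2 * ball_vol TYPE('a)) * pre_bound m) \<tau>"
proof
  fix x y
  show "(curv V has_derivative blinfun_apply (Dcurv V x)) (at x)"
    unfolding curv_def Dcurv_def by (rule conv_has_derivative[OF continuous_on_pre norm_pre_le])
  show "norm (Dcurv V x) \<le> (a + b * ball_vol TYPE('a)) * pre_bound m"
    unfolding Dcurv_def by (rule norm_Dconv_le[OF continuous_on_pre norm_pre_le])
  show "norm (Dcurv V x - Dcurv V y) \<le> L2 * (2 * ball_vol TYPE('a)) * pre_bound m * norm (x - y)"
    unfolding Dcurv_def by (rule Dconv_lipschitz[OF continuous_on_pre norm_pre_le])
  show "0 \<le> L2 * (2 * ball_vol TYPE('a)) * pre_bound m"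
    using L2_pos ball_vol_nonneg[where 'a = 'a] pre_bound_nonneg[OF m] by simp
qed (use assms in auto)

text \<open>The derivative of the convolution falls on the kernel, so the divergence of the field
  along S becomes a pairing of \<open>pre V\<close> with the very integrand of
  \<open>fvar\<close>.\<close>

lemma tangential_divergence_curv:
  fixes S :: "'a \<Rightarrow>\<^sub>L 'a"
  shows "(\<Sum>i\<in>Basis. inner (blinfun_apply S i) (blinfun_apply (Dcurv V x) i))
    = (LINT y|lborel. inner (blinfun_apply S (d\<Phi> (x - y))) (pre V y))"
proof -
  note w = continuous_on_pre
  have "(\<Sum>i\<in>Basis. inner (blinfun_apply S i) (blinfun_apply (Dcurv V x) i))
      = (\<Sum>i\<in>Basis. (LINT y|lborel. inner (blinfun_apply S i) (inner (d\<Phi> (x - y)) i *\<^sub>R pre V y)))"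
    unfolding Dcurv_def Dconv_apply[OF w]
    by (intro sum.cong refl integral_inner_right[symmetric] Dconv_integrable[OF w])
  also have "\<dots> = (LINT y|lborel. (\<Sum>i\<in>Basis. inner (blinfun_apply S i) (inner (d\<Phi> (x - y)) i *\<^sub>R pre V y)))"
    by (rule Bochner_Integration.integral_sum[symmetric]) (rule integrable_inner_right[OF Dconv_integrable[OF w]])
  also have "(\<lambda>y. \<Sum>i\<in>Basis. inner (blinfun_apply S i) (inner (d\<Phi> (x - y)) i *\<^sub>R pre V y))
      = (\<lambda>y. inner (blinfun_apply S (d\<Phi> (x - y))) (pre V y))"
  proof
    fix y
    show "(\<Sum>i\<in>Basis. inner (blinfun_apply S i) (inner (d\<Phi> (x - y)) i *\<^sub>R pre V y))
        = inner (blinfun_apply S (d\<Phi> (x - y))) (pre V y)"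
      by (simp add: blinfun_apply_Basis_sum[of S "d\<Phi> (x - y)"] inner_sum_left)
  qed
  finally show ?thesis .
qed

text \<open>Expanding in the basis replaces the operator applied to a moving vector by scalars times
  the operator applied to fixed vectors, and evaluation at a fixed vector is continuous on the
  bundle.\<close>

lemma energy_integrand_measurable:
  "(\<lambda>(p, y). inner (blinfun_apply (snd p) (d\<Phi> (fst p - y))) (pre V y)) \<in> borel_measurable (V \<Otimes>\<^sub>M lborel)"
proof -
  have d: "d\<Phi> \<in> borel_measurable borel"
    by (rule borel_measurable_continuous_onI[OF continuous_on_d\<Phi>])
  have w[measurable]: "pre V \<in> borel_measurable borel"
    by (rule borel_measurable_continuous_onI[OF continuous_on_pre])
  have f: "(\<lambda>z. fst (fst z)) \<in> borel_measurable (V \<Otimes>\<^sub>M lborel)"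
    by (rule measurable_compose[OF measurable_fst varifold_fst_snd_measurable(1)[OF V]])
  have s: "(\<lambda>z. snd z) \<in> borel_measurable (V \<Otimes>\<^sub>M lborel)"
    by (rule measurable_compose[OF measurable_snd]) simp
  have d2[measurable]: "(\<lambda>z. d\<Phi> (fst (fst z) - snd z)) \<in> borel_measurable (V \<Otimes>\<^sub>M lborel)"
    by (rule measurable_compose[OF borel_measurable_diff[OF f s] d])
  have w2[measurable]: "(\<lambda>z. pre V (snd z)) \<in> borel_measurable (V \<Otimes>\<^sub>M lborel)"
    by (rule measurable_compose[OF s w])
  have S: "(\<lambda>z. blinfun_apply (snd (fst z)) i) \<in> borel_measurable (V \<Otimes>\<^sub>M lborel)" for i
  proof -
    have "continuous_on (plane_bundle d) (\<lambda>p. blinfun_apply (snd p) i)"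
      by (intro continuous_intros)
    from varifold_measurable[OF varifold_of_massD(1)[OF V] this]
    show ?thesis by (rule measurable_compose[OF measurable_fst])
  qed
  have "(\<lambda>z. \<Sum>i\<in>Basis. inner (d\<Phi> (fst (fst z) - snd z)) i * inner (blinfun_apply (snd (fst z)) i) (pre V (snd z)))
      \<in> borel_measurable (V \<Otimes>\<^sub>M lborel)"
    by (intro borel_measurable_sum borel_measurable_times borel_measurable_inner d2 w2 S borel_measurable_const)
  also have "(\<lambda>z. \<Sum>i\<in>Basis. inner (d\<Phi> (fst (fst z) - snd z)) i * inner (blinfun_apply (snd (fst z)) i) (pre V (snd z)))
      = (\<lambda>(p, y). inner (blinfun_apply (snd p) (d\<Phi> (fst p - y))) (pre V y))"
  proof (rule ext, clarify)
    fix x :: 'a and S :: "'a \<Rightarrow>\<^sub>L 'a" and y :: 'a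
    show "(\<Sum>i\<in>Basis. inner (d\<Phi> (fst (fst ((x, S), y)) - snd ((x, S), y))) i *
          inner (blinfun_apply (snd (fst ((x, S), y))) i) (pre V (snd ((x, S), y))))
        = inner (blinfun_apply (snd (x, S)) (d\<Phi> (fst (x, S) - y))) (pre V y)"
      by (simp add: blinfun_apply_Basis_sum[of S "d\<Phi> (x - y)"] inner_sum_left)
  qed
  finally show ?thesis .
qed

text \<open>The integral is the first variation of V along its own field. The outer mollification
  uses the same kernel as the smoothed first variation, so exchanging the integrals reproduces
  \<open>fvar V y\<close>, and \<open>pre V y\<close> is a nonpositive multiple of it.\<close>

lemma curv_decreases_mass:
  "(LINT p|V. (\<Sum>i\<in>Basis. inner (blinfun_apply (snd p) i) (blinfun_apply (Dcurv V (fst p)) i))) \<le> 0"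
proof -
  interpret finite_measure V using varifold_of_massD(2)[OF V] .
  interpret pair_sigma_finite V lborel ..
  let ?f = "\<lambda>p y. inner (blinfun_apply (snd p) (d\<Phi> (fst p - y))) (pre V y)"
  let ?c = "L1 * pre_bound m"
  have fi: "integrable lborel (?f p)" for p :: "'a \<times> ('a \<Rightarrow>\<^sub>L 'a)"
  proof (rule integrable_of_compact_support[of _ "fst p" 1])
    show "continuous_on UNIV (?f p)"
      by (intro continuous_intros continuous_on_pre continuous_on_compose2[OF continuous_on_d\<Phi>[of UNIV]]) auto
  qed (simp add: d\<Phi>_support dist_norm)
  have fb: "norm (?f p y) \<le> ?c" if "p \<in> plane_bundle d" for p y
  proof -
    have "norm (?f p y) \<le> norm (blinfun_apply (snd p) (d\<Phi> (fst p - y))) * norm (pre V y)"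
      by (simp add: Cauchy_Schwarz_ineq2)
    also have "\<dots> \<le> ?c"
      using norm_variation_integrand_le(2)[OF that] norm_pre_le constants by (intro mult_mono) auto
    finally show ?thesis .
  qed
  \<comment> \<open>Absolute integrability for Fubini: for each p in the bundle the integrand is
    bounded and lives on the unit ball about \<open>fst p\<close>, so the inner integrals are
    uniformly bounded and V is finite.\<close>
  have "integrable (V \<Otimes>\<^sub>M lborel) (\<lambda>(p, y). ?f p y)"
  proof (rule Fubini_integrable[OF energy_integrand_measurable])
    show "integrable V (\<lambda>p. LINT y|lborel. norm (case (p, y) of (p, y) \<Rightarrow> ?f p y))"
    proof (rule varifold_integrable_bounded[OF V])
      show "(\<lambda>p. LINT y|lborel. norm (case (p, y) of (p, y) \<Rightarrow> ?f p y)) \<in> borel_measurable V"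
        using energy_integrand_measurable by (intro lborel.borel_measurable_lebesgue_integral) (simp add: case_prod_unfold)
      fix p :: "'a \<times> ('a \<Rightarrow>\<^sub>L 'a)" assume p: "p \<in> plane_bundle d"
      show "norm (LINT y|lborel. norm (case (p, y) of (p, y) \<Rightarrow> ?f p y)) \<le> ?c * (2 * ball_vol TYPE('a))"
      proof (rule norm_integral_two_balls_le[where x = "fst p" and x' = "fst p"])
        show "integrable lborel (\<lambda>y. norm (case (p, y) of (p, y) \<Rightarrow> ?f p y))" using fi[of p] by simp
        show "norm (norm (case (p, y) of (p, y) \<Rightarrow> ?f p y)) \<le> ?c" for y using fb[OF p, of y] by simp
        show "norm (case (p, y) of (p, y) \<Rightarrow> ?f p y) = 0" if "y \<notin> cball (fst p) 1 \<union> cball (fst p) 1" for y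
          using that d\<Phi>_support[of "fst p - y"] by (simp add: dist_norm)
      qed
    qed
    show "AE p in V. integrable lborel (\<lambda>y. case (p, y) of (p, y) \<Rightarrow> ?f p y)"
      using fi by simp
  qed
  from Fubini_integral[OF this]
  have "(LINT p|V. (LINT y|lborel. ?f p y)) = (LINT y|lborel. (LINT p|V. ?f p y))" by simp
  also have "\<dots> = (LINT y|lborel. inner (fvar V y) (pre V y))"
    using variation_integrable by (simp add: fvar_def)
  also have "\<dots> = - (LINT y|lborel. - inner (fvar V y) (pre V y))" by simp
  also have "\<dots> \<le> 0"
  proof -
    have "0 \<le> - inner (fvar V y) (pre V y)" for y
      using dens_nonneg[of y] e_pos by (simp add: pre_def)
    then have "0 \<le> (LINT y|lborel. - inner (fvar V y) (pre V y))" by (intro integral_nonneg_AE) simp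
    then show ?thesis by simp
  qed
  finally show ?thesis by (simp add: tangential_divergence_curv)
qed

end

section \<open>Dependence of the field on the varifold\<close>

lemma dens_diff_le:
  assumes V: "varifold_of_mass d m V" and W: "varifold_of_mass d m W" and m: "0 \<le> m"
  shows "\<bar>dens V y - dens W y\<bar> \<le> L1 * varifold_dist d V W"
  unfolding dens_def
proof (rule varifold_integral_diff_le[OF V W m m])
  fix p q :: "'a \<times> ('a \<Rightarrow>\<^sub>L 'a)"
  show "0 \<le> \<Phi> (fst p - y)" "\<Phi> (fst p - y) \<le> L1" by (rule \<Phi>_nonneg \<Phi>_le)+
  have "\<bar>\<Phi> (fst p - y) - \<Phi> (fst q - y)\<bar> \<le> L1 * norm (fst p - fst q)"
    using \<Phi>_lipschitz[of "fst p - y" "fst q - y"] by simp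
  also have "\<dots> \<le> L1 * sum_dist p q"
    using constants by (intro mult_left_mono) (auto simp: sum_dist_def dist_norm)
  finally show "\<bar>\<Phi> (fst p - y) - \<Phi> (fst q - y)\<bar> \<le> L1 * sum_dist p q" .
qed (use constants in auto)

lemma fvar_diff_le:
  assumes V: "varifold_of_mass d m V" and W: "varifold_of_mass d m W" and m: "0 \<le> m"
  shows "norm (fvar V y - fvar W y) \<le> 2 * L2 * varifold_dist d V W"
proof -
  \<comment> \<open>Test functions are scalar. Pairing with the direction of the difference itself
    turns the norm into one scalar integral, without a factor for the number of components.\<close>
  define u where "u = sgn (fvar V y - fvar W y)"
  have u: "norm u \<le> 1" by (simp add: u_def norm_sgn)
  have ip: "inner (fvar U y) u = (LINT p|U. inner (blinfun_apply (snd p) (d\<Phi> (fst p - y))) u)"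
    if "varifold_of_mass d m U" for U
    using variation_integrable[OF that m] by (simp add: fvar_def)
  have "norm (fvar V y - fvar W y) = inner (fvar V y - fvar W y) u"
    by (cases "fvar V y - fvar W y = 0")
      (simp_all add: u_def sgn_div_norm power2_norm_eq_inner[symmetric] power2_eq_square)
  also have "\<dots> \<le> \<bar>inner (fvar V y) u - inner (fvar W y) u\<bar>" by (simp add: inner_diff_left)
  also have "\<dots> \<le> 2 * L2 * varifold_dist d V W"
    unfolding ip[OF V] ip[OF W]
  proof (rule varifold_integral_signed_diff_le[OF V W m m L2_pos])
    have iu: "\<bar>inner z u\<bar> \<le> norm z" for z
      using Cauchy_Schwarz_ineq2[of z u] mult_left_le[OF u, of "norm z"] by simp
    fix p q :: "'a \<times> ('a \<Rightarrow>\<^sub>L 'a)"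
    assume p: "p \<in> plane_bundle d"
    show "\<bar>inner (blinfun_apply (snd p) (d\<Phi> (fst p - y))) u\<bar> \<le> L2"
      using iu norm_variation_integrand_le(2)[OF p, of y] constants(4) by (meson order.trans)
    assume q: "q \<in> plane_bundle d"
    show "\<bar>inner (blinfun_apply (snd p) (d\<Phi> (fst p - y))) u - inner (blinfun_apply (snd q) (d\<Phi> (fst q - y))) u\<bar>
        \<le> L2 * sum_dist p q"
      unfolding inner_diff_left[symmetric] by (rule order.trans[OF iu variation_integrand_lipschitz[OF p q]])
  qed
  finally show ?thesis .
qed

definition stab_bound :: "real \<Rightarrow> real" where
  "stab_bound m = (2 * L2 + pre_bound m * L1) / e"

text \<open>The difference of the two quotients is arranged so that only the denominator of W is
  divided out; the other one stays inside \<open>pre V\<close>, which is bounded by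
  \<open>pre_bound m\<close>. Hence a single factor 1/e in \<open>stab_bound\<close>.\<close>

lemma pre_diff_le:
  assumes V: "varifold_of_mass d m V" and W: "varifold_of_mass d m W" and m: "0 \<le> m"
  shows "norm (pre V y - pre W y) \<le> stab_bound m * varifold_dist d V W"
proof -
  let ?A = "dens V y + e" and ?B = "dens W y + e" and ?\<Delta> = "varifold_dist d V W"
  have A: "0 < ?A" and B: "e \<le> ?B" "0 < ?B"
    using dens_nonneg[OF V m, of y] dens_nonneg[OF W m, of y] e_pos by linarith+
  have \<Delta>: "0 \<le> ?\<Delta>" by (rule varifold_dist_nonneg[OF V W m m])
  have "pre W y - pre V y = (1 / ?B) *\<^sub>R ((fvar V y - fvar W y) + (?A - ?B) *\<^sub>R pre V y)"
  proof -
    have "?A *\<^sub>R pre V y = - fvar V y" using A by (simp add: pre_def)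
    moreover have "?B *\<^sub>R pre W y = - fvar W y" using B by (simp add: pre_def)
    ultimately have "(fvar V y - fvar W y) + (?A - ?B) *\<^sub>R pre V y = ?B *\<^sub>R (pre W y - pre V y)"
      by (simp only: scaleR_diff_left scaleR_diff_right) simp
    then show ?thesis using B by simp
  qed
  also have "norm \<dots> \<le> 1 / e * ((2 * L2 * ?\<Delta>) + (L1 * ?\<Delta>) * pre_bound m)"
    unfolding norm_scaleR
  proof (intro mult_mono norm_triangle_le[OF add_mono])
    show "\<bar>1 / ?B\<bar> \<le> 1 / e" using B e_pos by (simp add: divide_left_mono)
    show "norm (fvar V y - fvar W y) \<le> 2 * L2 * ?\<Delta>" by (rule fvar_diff_le[OF V W m])
    have "\<bar>?A - ?B\<bar> \<le> L1 * ?\<Delta>" using dens_diff_le[OF V W m, of y] by simp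
    then show "norm ((?A - ?B) *\<^sub>R pre V y) \<le> (L1 * ?\<Delta>) * pre_bound m"
      unfolding norm_scaleR using norm_pre_le[OF V m] constants \<Delta> by (intro mult_mono) auto
  qed (use e_pos in auto)
  also have "\<dots> = stab_bound m * ?\<Delta>" by (simp add: stab_bound_def algebra_simps add_divide_distrib)
  finally show ?thesis by (simp add: norm_minus_commute)
qed

lemma curv_diff_le:
  assumes V: "varifold_of_mass d m V" and W: "varifold_of_mass d m W" and m: "0 \<le> m"
  shows "norm (curv V x - curv W x) \<le> stab_bound m * varifold_dist d V W"
    and "norm (Dcurv V x - Dcurv W x) \<le> (a + b * ball_vol TYPE('a)) * (stab_bound m * varifold_dist d V W)"
proof -
  note cV = continuous_on_pre[OF V m] and cW = continuous_on_pre[OF W m]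
  have c: "continuous_on UNIV (\<lambda>y. pre V y - pre W y)" using cV cW by (rule continuous_on_diff)
  show "norm (curv V x - curv W x) \<le> stab_bound m * varifold_dist d V W"
    unfolding curv_def conv_diff(1)[OF cV cW] by (rule norm_conv_le[OF c pre_diff_le[OF V W m]])
  show "norm (Dcurv V x - Dcurv W x) \<le> (a + b * ball_vol TYPE('a)) * (stab_bound m * varifold_dist d V W)"
    unfolding Dcurv_def conv_diff(2)[OF cV cW] by (rule norm_Dconv_le[OF c pre_diff_le[OF V W m]])
qed

end

section \<open>One time step and the flow\<close>

lemma (in perturbation_field) jac_le:
  assumes "p \<in> plane_bundle d"
  shows "jac d p \<le> 1 + \<tau> * (\<Sum>b\<in>Basis. inner (blinfun_apply (snd p) b) (blinfun_apply (Dh (fst p)) b))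
     + (DIM('a) + 5 * jac_const TYPE('a)) * (\<tau> * K)\<^sup>2"
proof -
  have S: "snd p \<in> grassmannian d" using assms by auto
  have "(\<Sum>b\<in>Basis. inner (blinfun_apply (snd p) b) (blinfun_apply (\<tau> *\<^sub>R Dh (fst p)) b))
      = \<tau> * (\<Sum>b\<in>Basis. inner (blinfun_apply (snd p) b) (blinfun_apply (Dh (fst p)) b))"
    by (simp add: blinfun.scaleR_left sum_distrib_left)
  then show ?thesis
    using tangential_jacobian_le[OF \<tau>_small S norm_\<tau>Dh frechet_step, of "fst p"] by (simp add: jac_def)
qed

lemma (in perturbation_field) integral_jac_le:
  assumes V: "varifold_of_mass d m V" and m: "0 \<le> m"
    and div: "(LINT p|V. (\<Sum>b\<in>Basis. inner (blinfun_apply (snd p) b) (blinfun_apply (Dh (fst p)) b))) \<le> 0"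
  shows "(LINT p|V. jac d p) \<le> m + (DIM('a) + 5 * jac_const TYPE('a)) * (\<tau> * K)\<^sup>2 * m"
proof -
  interpret finite_measure V using varifold_of_massD(2)[OF V] .
  let ?g = "\<lambda>p. \<Sum>b\<in>Basis. inner (blinfun_apply (snd p) b) (blinfun_apply (Dh (fst p)) b)"
  let ?c = "1 + (DIM('a) + 5 * jac_const TYPE('a)) * (\<tau> * K)\<^sup>2"
  have gi: "integrable V ?g"
  proof (rule varifold_integrable_bounded[OF V])
    have "continuous_on (plane_bundle d) ?g"
      by (intro continuous_intros continuous_on_compose2[OF continuous_on_Dh]) auto
    then show "?g \<in> borel_measurable V"
      by (rule varifold_measurable[OF varifold_of_massD(1)[OF V]])
    fix p :: "'a \<times> ('a \<Rightarrow>\<^sub>L 'a)" assume p: "p \<in> plane_bundle d"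
    show "norm (?g p) \<le> (\<Sum>b\<in>(Basis::'a set). K)"
    proof (rule order.trans[OF norm_sum sum_mono])
      fix b :: 'a assume b: "b \<in> Basis"
      have "norm (inner (blinfun_apply (snd p) b) (blinfun_apply (Dh (fst p)) b))
          \<le> norm (blinfun_apply (snd p) b) * norm (blinfun_apply (Dh (fst p)) b)"
        by (simp add: Cauchy_Schwarz_ineq2)
      also have "\<dots> \<le> 1 * K"
      proof (rule mult_mono)
        show "norm (blinfun_apply (snd p) b) \<le> 1"
          using p b norm_grassmannian_apply[of "snd p" d b] by auto
        show "norm (blinfun_apply (Dh (fst p)) b) \<le> K"
          using norm_blinfun[of "Dh (fst p)" b] norm_Dh[of "fst p"] b by simp
      qed auto
      finally show "norm (inner (blinfun_apply (snd p) b) (blinfun_apply (Dh (fst p)) b)) \<le> K" by simp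
    qed
  qed
  have "(LINT p|V. jac d p) \<le> (LINT p|V. ?c + \<tau> * ?g p)"
  proof (rule integral_mono)
    show "integrable V (jac d)"
      by (rule jac_integrable[OF V])
    show "integrable V (\<lambda>p. ?c + \<tau> * ?g p)" using gi by simp
    show "jac d p \<le> ?c + \<tau> * ?g p" if "p \<in> space V" for p
      using jac_le[of p d] that by (simp add: space_varifold[OF V])
  qed
  also have "\<dots> = ?c * measure V (space V) + \<tau> * (LINT p|V. ?g p)"
    using gi by (simp add: mult.commute)
  also have "\<dots> \<le> ?c * m + 0"
  proof (rule add_mono)
    show "?c * measure V (space V) \<le> ?c * m"
      using varifold_of_massD(3)[OF V m] jac_const_ge_1[where 'a = 'a] by (intro mult_left_mono) auto
    show "\<tau> * (LINT p|V. ?g p) \<le> 0" using div \<tau>_nonneg by (simp add: mult_nonneg_nonpos)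
  qed
  finally show ?thesis by (simp add: algebra_simps)
qed

lemma step_map_eq: "step_map \<psi> \<epsilon> \<tau> V = perturbation_field.step (mean_curvature \<psi> \<epsilon> V) \<tau>"
  if "perturbation_field (mean_curvature \<psi> \<epsilon> V) Dh K K2 \<tau>"
proof -
  interpret perturbation_field "mean_curvature \<psi> \<epsilon> V" Dh K K2 \<tau> by fact
  show ?thesis by (simp add: fun_eq_iff step_map_def step_def)
qed

lemma mean_curvature_eq_curv:
  fixes \<psi> :: "'a::euclidean_space \<Rightarrow> real"
  assumes K: "curvature (kernel \<psi> \<epsilon>) (grad (kernel \<psi> \<epsilon>)) a b L1 L2 \<epsilon>"
    and V: "varifold_of_mass d m V"
  shows "mean_curvature \<psi> \<epsilon> V = curvature.curv (kernel \<psi> \<epsilon>) (grad (kernel \<psi> \<epsilon>)) \<epsilon> V"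
proof -
  interpret curvature "kernel \<psi> \<epsilon>" "grad (kernel \<psi> \<epsilon>)" a b L1 L2 \<epsilon> by fact
  have "smoothed_weight \<psi> \<epsilon> V y = dens V y" for y
  proof -
    have "(\<lambda>x. kernel \<psi> \<epsilon> (x - y)) \<in> borel_measurable borel"
      by (intro borel_measurable_continuous_onI continuous_on_compose2[OF continuous_on_\<Phi>[of UNIV]] continuous_intros) auto
    then show ?thesis
      unfolding smoothed_weight_def weight_def dens_def
      by (rule integral_distr[OF varifold_fst_snd_measurable(1)[OF V]])
  qed
  then have "pre_mean_curvature \<psi> \<epsilon> V = pre V"
    by (simp add: fun_eq_iff pre_mean_curvature_def pre_def smoothed_first_variation_def fvar_def)
  then show ?thesis
    by (simp add: fun_eq_iff mean_curvature_def curv_def conv_def)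
qed

section \<open>Powers of eps and of the mass\<close>

context
  fixes \<epsilon> m C \<omega> :: real and N :: nat
  assumes e: "0 < \<epsilon>" "\<epsilon> < 1" and m: "1 \<le> m" and C: "0 < C" and \<omega>: "0 \<le> \<omega>"
begin

lemma inverse_power_mono: "i \<le> j \<Longrightarrow> 1 / \<epsilon> ^ i \<le> 1 / \<epsilon> ^ j"
  using e by (intro divide_left_mono power_decreasing) auto

lemma inverse_power_ge_1: "1 \<le> 1 / \<epsilon> ^ i"
  using inverse_power_mono[of 0 i] by simp

lemma pre_bound_estimate: "1 / \<epsilon>\<^sup>2 + C * m / \<epsilon> \<le> (1 + C) * m / \<epsilon> ^ 2"
proof -
  have "1 / \<epsilon>\<^sup>2 \<le> m * (1 / \<epsilon>\<^sup>2)" using m by (simp add: divide_right_mono)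
  moreover have "C * m * (1 / \<epsilon>) \<le> C * m * (1 / \<epsilon>\<^sup>2)"
    using inverse_power_mono[of 1 2] C m by (intro mult_left_mono) auto
  ultimately show ?thesis by (simp add: add_divide_distrib distrib_right)
qed

lemma grad_mass_estimate: "1 / \<epsilon>\<^sup>2 + C * \<omega> \<le> (1 + C * \<omega>) / \<epsilon> ^ 2"
proof -
  have "C * \<omega> * 1 \<le> C * \<omega> * (1 / \<epsilon>\<^sup>2)"
    using inverse_power_ge_1[of 2] C \<omega> by (intro mult_left_mono) auto
  then show ?thesis by (simp add: add_divide_distrib)
qed

lemma field_estimate:
  "(1 / \<epsilon>\<^sup>2 + C * \<omega>) * (1 / \<epsilon>\<^sup>2 + C * m / \<epsilon>) \<le> (1 + C * \<omega>) * (1 + C) * m / \<epsilon> ^ 4"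
proof -
  have "(1 / \<epsilon>\<^sup>2 + C * \<omega>) * (1 / \<epsilon>\<^sup>2 + C * m / \<epsilon>) \<le> ((1 + C * \<omega>) / \<epsilon> ^ 2) * ((1 + C) * m / \<epsilon> ^ 2)"
    using e C m \<omega> by (intro mult_mono pre_bound_estimate grad_mass_estimate) auto
  also have "\<dots> = (1 + C * \<omega>) * (1 + C) * m / \<epsilon> ^ 4" by (simp flip: power_add)
  finally show ?thesis .
qed

lemma second_derivative_estimate:
  "C / \<epsilon> ^ (N + 4) * (2 * \<omega>) * (1 / \<epsilon>\<^sup>2 + C * m / \<epsilon>) \<le> 2 * \<omega> * C * (1 + C) * m / \<epsilon> ^ (N + 6)"
proof -
  have "C / \<epsilon> ^ (N + 4) * (2 * \<omega>) * (1 / \<epsilon>\<^sup>2 + C * m / \<epsilon>)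
      \<le> C / \<epsilon> ^ (N + 4) * (2 * \<omega>) * ((1 + C) * m / \<epsilon> ^ 2)"
    using e C \<omega> by (intro mult_left_mono pre_bound_estimate) auto
  also have "\<dots> = 2 * \<omega> * C * (1 + C) * m / (\<epsilon> ^ (N + 4) * \<epsilon> ^ 2)" by simp
  also have "\<epsilon> ^ (N + 4) * \<epsilon> ^ 2 = \<epsilon> ^ (N + 6)" by (simp add: power_add numeral_eq_Suc mult_ac)
  finally show ?thesis .
qed

text \<open>In C (3 + C), the part 2 C stems from the variation of \<open>fvar\<close>, and (1 + C)
  C from the variation of the density weighted by \<open>pre_bound\<close>.\<close>

lemma stability_estimate:
  "(1 / \<epsilon>\<^sup>2 + C * \<omega>) * ((2 * (C / \<epsilon> ^ (N + 4)) + (1 / \<epsilon>\<^sup>2 + C * m / \<epsilon>) * (C / \<epsilon> ^ (N + 2))) / \<epsilon>)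
    \<le> (1 + C * \<omega>) * (C * (3 + C)) * m / \<epsilon> ^ (N + 7)"
proof -
  have "(1 / \<epsilon>\<^sup>2 + C * m / \<epsilon>) * (C / \<epsilon> ^ (N + 2)) \<le> ((1 + C) * m / \<epsilon> ^ 2) * (C / \<epsilon> ^ (N + 2))"
    using e C by (intro mult_right_mono pre_bound_estimate) auto
  also have "\<dots> = (1 + C) * C * m / (\<epsilon> ^ 2 * \<epsilon> ^ (N + 2))" by simp
  also have "\<epsilon> ^ 2 * \<epsilon> ^ (N + 2) = \<epsilon> ^ (N + 4)" by (simp add: power_add numeral_eq_Suc mult_ac)
  finally have 1: "(1 / \<epsilon>\<^sup>2 + C * m / \<epsilon>) * (C / \<epsilon> ^ (N + 2)) \<le> (1 + C) * C * m / \<epsilon> ^ (N + 4)" .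
  have "2 * (C / \<epsilon> ^ (N + 4)) \<le> 2 * C * m / \<epsilon> ^ (N + 4)"
    using e C m by (simp add: divide_right_mono)
  then have "2 * (C / \<epsilon> ^ (N + 4)) + (1 / \<epsilon>\<^sup>2 + C * m / \<epsilon>) * (C / \<epsilon> ^ (N + 2))
      \<le> 2 * C * m / \<epsilon> ^ (N + 4) + (1 + C) * C * m / \<epsilon> ^ (N + 4)"
    using 1 by (rule add_mono)
  also have "\<dots> = C * (3 + C) * m / \<epsilon> ^ (N + 4)"
    by (simp add: algebra_simps flip: add_divide_distrib)
  finally have "(2 * (C / \<epsilon> ^ (N + 4)) + (1 / \<epsilon>\<^sup>2 + C * m / \<epsilon>) * (C / \<epsilon> ^ (N + 2))) / \<epsilon>
      \<le> C * (3 + C) * m / \<epsilon> ^ (N + 4) / \<epsilon>"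
    using e by (intro divide_right_mono) auto
  also have "\<dots> = C * (3 + C) * m / \<epsilon> ^ (N + 5)"
    by (simp add: mult.commute numeral_eq_Suc)
  finally have "(1 / \<epsilon>\<^sup>2 + C * \<omega>) * ((2 * (C / \<epsilon> ^ (N + 4)) + (1 / \<epsilon>\<^sup>2 + C * m / \<epsilon>) * (C / \<epsilon> ^ (N + 2))) / \<epsilon>)
      \<le> ((1 + C * \<omega>) / \<epsilon> ^ 2) * (C * (3 + C) * m / \<epsilon> ^ (N + 5))"
    using e C m \<omega> by (intro mult_mono grad_mass_estimate) auto
  also have "\<dots> = (1 + C * \<omega>) * (C * (3 + C)) * m / (\<epsilon> ^ 2 * \<epsilon> ^ (N + 5))" by simp
  also have "\<epsilon> ^ 2 * \<epsilon> ^ (N + 5) = \<epsilon> ^ (N + 7)" by (simp add: power_add numeral_eq_Suc mult_ac)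
  finally show ?thesis .
qed

end

text \<open>The mass clause has its own bound \<mu> with additive gain \<tau>, so that along the
  nodes the gains add up to the elapsed time; the other two clauses refer to the common ceiling
  m.\<close>

definition step_ok ::
  "('a::euclidean_space \<Rightarrow> real) \<Rightarrow> nat \<Rightarrow> real \<Rightarrow> real \<Rightarrow> real \<Rightarrow> real \<Rightarrow> bool" where
  "step_ok \<psi> d \<epsilon> m L \<tau> \<longleftrightarrow>
     (\<forall>V. varifold_of_mass d m V \<longrightarrow> C1_diffeo (step_map \<psi> \<epsilon> \<tau> V)) \<and>
     (\<forall>V \<mu>. 0 \<le> \<mu> \<longrightarrow> \<mu> \<le> m \<longrightarrow> varifold_of_mass d \<mu> V \<longrightarrow>
       varifold_of_mass d (\<mu> + \<tau>) (push_forward d (step_map \<psi> \<epsilon> \<tau> V) V)) \<and>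
     (\<forall>V W. varifold_of_mass d m V \<longrightarrow> varifold_of_mass d m W \<longrightarrow>
       varifold_dist d (push_forward d (step_map \<psi> \<epsilon> \<tau> V) V) (push_forward d (step_map \<psi> \<epsilon> \<tau> W) W)
         \<le> (1 + L * \<tau>) * varifold_dist d V W)"

lemma step_estimates:
  fixes \<psi> :: "'a::euclidean_space \<Rightarrow> real"
  assumes "is_cutoff \<psi>"
  shows "\<exists>c3>0. \<exists>c5>0. \<forall>d \<epsilon> m \<tau>. 0 < \<epsilon> \<longrightarrow> \<epsilon> < 1 \<longrightarrow> 1 \<le> m \<longrightarrow> 0 \<le> \<tau> \<longrightarrow> c3 * \<tau> \<le> \<epsilon> ^ 8 / m ^ 3 \<longrightarrow>
    step_ok \<psi> d \<epsilon> m (c5 * m\<^sup>2 / \<epsilon> ^ (DIM('a) + 7)) \<tau>"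
proof -
  interpret cutoff \<psi> by unfold_locales fact
  obtain C where C: "0 < C" and moll: "\<And>\<epsilon>. 0 < \<epsilon> \<Longrightarrow> \<epsilon> < 1 \<Longrightarrow>
      mollifier (kernel \<psi> \<epsilon>) (grad (kernel \<psi> \<epsilon>)) (1 / \<epsilon>\<^sup>2) C (C / \<epsilon> ^ (DIM('a) + 2)) (C / \<epsilon> ^ (DIM('a) + 4))"
    using kernel_mollifier by blast
  let ?N = "DIM('a)"
  define \<omega> where "\<omega> = ball_vol TYPE('a)"
  define J where "J = jac_const TYPE('a)"
  define K0 where "K0 = (1 + C * \<omega>) * (1 + C)"
  define K1 where "K1 = 2 * \<omega> * C * (1 + C)"
  define S0 where "S0 = (1 + C * \<omega>) * (C * (3 + C))"
  \<comment> \<open>The first summand of \<open>c3\<close> brings \<open>\<tau> * K\<close> below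
    the Jacobian threshold, the second bounds the quadratic mass gain by \<tau>. In
    \<open>c5\<close>, the part with \<open>K0 + K1\<close> is the growth of test functions under
    pull-back and the part with \<open>S0\<close> the change of the field.\<close>
  define c3 where "c3 = 4 * J * K0 + (?N + 5 * J) * K0\<^sup>2"
  define c5 where "c5 = 13 * J * (K0 + K1) + 10 * J * S0"
  have \<omega>: "0 \<le> \<omega>" by (simp add: \<omega>_def ball_vol_nonneg)
  have J: "1 \<le> J" by (simp add: J_def jac_const_ge_1)
  have K0: "0 < K0" unfolding K0_def using C \<omega> by (intro mult_pos_pos add_pos_nonneg) auto
  have K1: "0 \<le> K1" unfolding K1_def using C \<omega> by simp
  have S0: "0 < S0" unfolding S0_def using C \<omega> by (intro mult_pos_pos add_pos_nonneg) auto
  have c3: "0 < c3" unfolding c3_def using J K0 by (intro add_pos_nonneg mult_pos_pos) auto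
  have c5: "0 < c5" unfolding c5_def using J K0 K1 S0 by (intro add_nonneg_pos mult_pos_pos mult_nonneg_nonneg) auto
  have "step_ok \<psi> d \<epsilon> m (c5 * m\<^sup>2 / \<epsilon> ^ (?N + 7)) \<tau>"
    if e: "0 < \<epsilon>" "\<epsilon> < 1" and m: "1 \<le> m" and \<tau>: "0 \<le> \<tau>" "c3 * \<tau> \<le> \<epsilon> ^ 8 / m ^ 3" for d \<epsilon> m \<tau>
  proof -
    interpret mollifier "kernel \<psi> \<epsilon>" "grad (kernel \<psi> \<epsilon>)" "1 / \<epsilon>\<^sup>2" C "C / \<epsilon> ^ (?N + 2)" "C / \<epsilon> ^ (?N + 4)"
      by (rule moll[OF e])
    interpret curvature "kernel \<psi> \<epsilon>" "grad (kernel \<psi> \<epsilon>)" "1 / \<epsilon>\<^sup>2" C "C / \<epsilon> ^ (?N + 2)" "C / \<epsilon> ^ (?N + 4)" \<epsilon>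
      by unfold_locales (rule e(1))
    have m0: "0 \<le> m" using m by simp
    define A where "A = 1 / \<epsilon>\<^sup>2 + C * \<omega>"
    define K where "K = A * pre_bound m"
    define K2 where "K2 = C / \<epsilon> ^ (?N + 4) * (2 * \<omega>) * pre_bound m"
    have A1: "1 \<le> A" unfolding A_def using inverse_power_ge_1[OF e m C \<omega>, of 2] C \<omega> by (intro add_increasing2) auto
    have K: "0 \<le> K" "K \<le> K0 * m / \<epsilon> ^ 4"
      using field_estimate[OF e m C \<omega>] A1 pre_bound_nonneg[OF m0]
      by (auto simp: K_def A_def K0_def pre_bound_def)
    have K2: "0 \<le> K2" "K2 \<le> K1 * m / \<epsilon> ^ (?N + 6)"
      using second_derivative_estimate[OF e m C \<omega>, of ?N] e C \<omega> pre_bound_nonneg[OF m0]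
      by (auto simp: K2_def K1_def pre_bound_def)
    have stab: "A * stab_bound m \<le> S0 * m / \<epsilon> ^ (?N + 7)"
      unfolding A_def S0_def stab_bound_def pre_bound_def by (rule stability_estimate[OF e m C \<omega>])
    have m3: "c3 * (\<tau> * (m ^ 3 / \<epsilon> ^ 8)) \<le> 1"
      using mult_right_mono[OF \<tau>(2), of "m ^ 3 / \<epsilon> ^ 8"] e m by (simp add: mult.assoc)
    have \<tau>m: "0 \<le> \<tau> * (m ^ 3 / \<epsilon> ^ 8)" using \<tau>(1) e m by simp
    have "\<tau> * K \<le> \<tau> * (K0 * m / \<epsilon> ^ 4)" using K(2) \<tau>(1) by (rule mult_left_mono)
    also have "\<dots> \<le> \<tau> * (K0 * (m ^ 3 / \<epsilon> ^ 8))"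
    proof -
      have "m ^ 1 * (1 / \<epsilon> ^ 4) \<le> m ^ 3 * (1 / \<epsilon> ^ 8)"
        using m e by (intro mult_mono power_increasing inverse_power_mono[OF e m C \<omega>]) auto
      then have "K0 * (m / \<epsilon> ^ 4) \<le> K0 * (m ^ 3 / \<epsilon> ^ 8)" using K0 by (intro mult_left_mono) auto
      then show ?thesis using \<tau>(1) by (intro mult_left_mono) auto
    qed
    finally have \<tau>K: "\<tau> * K \<le> K0 * (\<tau> * (m ^ 3 / \<epsilon> ^ 8))" by (simp add: mult_ac)
    have \<tau>K_small: "\<tau> * K \<le> 1 / (4 * J)"
    proof -
      have "4 * J * (\<tau> * K) \<le> 4 * J * (K0 * (\<tau> * (m ^ 3 / \<epsilon> ^ 8)))"
        using \<tau>K J by (intro mult_left_mono) auto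
      also have "\<dots> = (4 * J * K0) * (\<tau> * (m ^ 3 / \<epsilon> ^ 8))" by simp
      also have "\<dots> \<le> c3 * (\<tau> * (m ^ 3 / \<epsilon> ^ 8))"
        using \<tau>m J by (intro mult_right_mono) (auto simp: c3_def)
      finally have "4 * J * (\<tau> * K) \<le> 1" using m3 by simp
      then show ?thesis using J by (simp add: field_simps)
    qed
    \<comment> \<open>Of the two factors \<tau>, one is spent on the step-size condition and the
      other survives as the gain allowed per step.\<close>
    have quad: "(?N + 5 * J) * (\<tau> * K)\<^sup>2 * m \<le> \<tau>"
    proof -
      have "K\<^sup>2 * m \<le> (K0 * m / \<epsilon> ^ 4)\<^sup>2 * m" using K m by (intro mult_right_mono power_mono) auto
      also have "\<dots> = K0\<^sup>2 * (m ^ 3 / \<epsilon> ^ 8)"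
        by (simp add: power_mult_distrib power_divide power2_eq_square power3_eq_cube flip: power_add)
      finally have "(?N + 5 * J) * \<tau> * (K\<^sup>2 * m) \<le> (?N + 5 * J) * \<tau> * (K0\<^sup>2 * (m ^ 3 / \<epsilon> ^ 8))"
        using J \<tau>(1) by (intro mult_left_mono) auto
      also have "\<dots> = ((?N + 5 * J) * K0\<^sup>2) * (\<tau> * (m ^ 3 / \<epsilon> ^ 8))" by simp
      also have "\<dots> \<le> c3 * (\<tau> * (m ^ 3 / \<epsilon> ^ 8))"
        using \<tau>m J K0 by (intro mult_right_mono) (auto simp: c3_def)
      finally have "(?N + 5 * J) * \<tau> * (K\<^sup>2 * m) \<le> 1" using m3 by simp
      then have "((?N + 5 * J) * \<tau> * (K\<^sup>2 * m)) * \<tau> \<le> 1 * \<tau>" using \<tau>(1) by (rule mult_right_mono)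
      then show ?thesis by (simp add: power_mult_distrib power2_eq_square mult_ac)
    qed
    have field: "perturbation_field (mean_curvature \<psi> \<epsilon> V) (Dcurv V) K K2 \<tau>" if "varifold_of_mass d m V" for V
      using curv_perturbation_field[OF that m0 \<tau>(1)] \<tau>K_small
        mean_curvature_eq_curv[OF curvature_axioms that]
      by (simp add: K_def K2_def A_def \<omega>_def J_def)
    have "C1_diffeo (step_map \<psi> \<epsilon> \<tau> V)" if V: "varifold_of_mass d m V" for V
      unfolding step_map_eq[OF field[OF V]] by (rule perturbation_field.C1_diffeo_step[OF field[OF V]])
    moreover have "varifold_of_mass d (\<mu> + \<tau>) (push_forward d (step_map \<psi> \<epsilon> \<tau> V) V)"
      if \<mu>: "0 \<le> \<mu>" "\<mu> \<le> m" and V: "varifold_of_mass d \<mu> V" for V \<mu>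
    proof -
      note Vm = varifold_of_mass_mono[OF V \<mu>(2)]
      interpret F: perturbation_field "mean_curvature \<psi> \<epsilon> V" "Dcurv V" K K2 \<tau> by (rule field[OF Vm])
      have "(LINT p|V. F.jac d p) \<le> \<mu> + (?N + 5 * jac_const TYPE('a)) * (\<tau> * K)\<^sup>2 * \<mu>"
        by (rule F.integral_jac_le[OF V \<mu>(1) curv_decreases_mass[OF Vm m0]])
      also have "\<dots> \<le> \<mu> + (?N + 5 * J) * (\<tau> * K)\<^sup>2 * m"
        unfolding J_def[symmetric] using J \<mu>(2) by (intro add_left_mono mult_left_mono) auto
      also have "\<dots> \<le> \<mu> + \<tau>" using quad by simp
      finally show ?thesis
        unfolding step_map_eq[OF field[OF Vm]] by (rule F.push_forward_step_mass[OF V])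
    qed
    moreover have "varifold_dist d (push_forward d (step_map \<psi> \<epsilon> \<tau> V) V) (push_forward d (step_map \<psi> \<epsilon> \<tau> W) W)
        \<le> (1 + c5 * m\<^sup>2 / \<epsilon> ^ (?N + 7) * \<tau>) * varifold_dist d V W"
      if V: "varifold_of_mass d m V" and W: "varifold_of_mass d m W" for V W
    proof -
      let ?\<Delta> = "varifold_dist d V W"
      let ?r = "m\<^sup>2 / \<epsilon> ^ (?N + 7)"
      have \<Delta>: "0 \<le> ?\<Delta>" by (rule varifold_dist_nonneg[OF V W m0 m0])
      have s0: "0 \<le> stab_bound m * ?\<Delta>"
        using norm_ge_zero pre_diff_le[OF V W m0] by (rule order.trans)
      \<comment> \<open>\<open>push_forward_stability\<close> takes one bound for field and
        derivative; A \<ge> 1 enlarges the first to the second.\<close>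
      have 1: "norm (curv V x - curv W x) \<le> A * (stab_bound m * ?\<Delta>)" for x
        using curv_diff_le(1)[OF V W m0, of x] mult_right_mono[OF A1 s0] by simp
      have 2: "norm (Dcurv V x - Dcurv W x) \<le> A * (stab_bound m * ?\<Delta>)" for x
        using curv_diff_le(2)[OF V W m0, of x] by (simp add: A_def \<omega>_def)
      have "varifold_dist d (push_forward d (step_map \<psi> \<epsilon> \<tau> V) V) (push_forward d (step_map \<psi> \<epsilon> \<tau> W) W)
          \<le> (1 + 13 * jac_const TYPE('a) * (\<tau> * (K + K2))) * ?\<Delta>
            + 10 * jac_const TYPE('a) * (\<tau> * (A * (stab_bound m * ?\<Delta>))) * m"
        unfolding step_map_eq[OF field[OF V]] step_map_eq[OF field[OF W]]
        by (rule push_forward_stability[OF field[OF V] field[OF W] V W m0])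
          (unfold mean_curvature_eq_curv[OF curvature_axioms V] mean_curvature_eq_curv[OF curvature_axioms W], rule 1, rule 2)
      also have "\<dots> = (1 + (13 * J * (K + K2) + 10 * J * (A * stab_bound m * m)) * \<tau>) * ?\<Delta>"
        by (simp add: J_def algebra_simps)
      also have "\<dots> \<le> (1 + (c5 * ?r) * \<tau>) * ?\<Delta>"
      proof (intro mult_right_mono add_left_mono \<Delta> \<tau>(1))
        \<comment> \<open>The growth terms carry one mass and lower powers of 1/eps; they are raised
          to the rate m^2 eps^(-n-7) of the stability term.\<close>
        have mm: "m \<le> m\<^sup>2" using m by (simp add: power2_eq_square)
        have "m * (1 / \<epsilon> ^ 4) \<le> m\<^sup>2 * (1 / \<epsilon> ^ (?N + 7))" "m * (1 / \<epsilon> ^ (?N + 6)) \<le> m\<^sup>2 * (1 / \<epsilon> ^ (?N + 7))"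
          using mm e by (intro mult_mono inverse_power_mono[OF e m C \<omega>]; simp)+
        then have "K0 * (m / \<epsilon> ^ 4) \<le> K0 * ?r" "K1 * (m / \<epsilon> ^ (?N + 6)) \<le> K1 * ?r"
          using K0 K1 by (intro mult_left_mono; simp)+
        then have "K + K2 \<le> (K0 + K1) * ?r" using K(2) K2(2) by (simp add: distrib_right add_divide_distrib)
        then have "13 * J * (K + K2) \<le> 13 * J * ((K0 + K1) * ?r)" using J by (intro mult_left_mono) auto
        moreover have "A * stab_bound m * m \<le> (S0 * m / \<epsilon> ^ (?N + 7)) * m"
          using stab m0 by (rule mult_right_mono)
        then have "10 * J * (A * stab_bound m * m) \<le> 10 * J * (S0 * ?r)"
          using J by (intro mult_left_mono) (auto simp: power2_eq_square mult_ac)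
        ultimately have "13 * J * (K + K2) + 10 * J * (A * stab_bound m * m)
            \<le> 13 * J * ((K0 + K1) * ?r) + 10 * J * (S0 * ?r)" by (rule add_mono)
        also have "\<dots> = c5 * ?r" by (simp only: c5_def algebra_simps)
        finally show "13 * J * (K + K2) + 10 * J * (A * stab_bound m * m) \<le> c5 * ?r" .
      qed
      finally show ?thesis by simp
    qed
    ultimately show ?thesis by (simp add: step_ok_def)
  qed
  then show ?thesis using c3 c5 by blast
qed

section \<open>Iteration along the subdivision\<close>

lemma subdivision_interval:
  assumes T: "is_subdivision m T" and t: "t \<in> {0..1}"
  obtains i where "i < m" "t \<in> {T i..T (Suc i)}"
proof -
  have T0: "T 0 = 0" and Tm: "T m = 1" using T by (auto simp: is_subdivision_def)
  then have "m \<noteq> 0" by (metis zero_neq_one)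
  \<comment> \<open>The first node at or after t. If it is node 0, then t = 0 is the left end of the
    first interval, which exists because m is not 0.\<close>
  let ?k = "LEAST j. t \<le> T j"
  have "t \<le> T m" using t Tm by simp
  then have k: "t \<le> T ?k" "?k \<le> m" by (rule LeastI, rule Least_le)
  show ?thesis
  proof (cases ?k)
    case 0
    then have "t = T 0" using k(1) t T0 by simp
    moreover have "T 0 \<le> T (Suc 0)" using T \<open>m \<noteq> 0\<close> by (auto simp: is_subdivision_def less_imp_le)
    ultimately show ?thesis using that[of 0] \<open>m \<noteq> 0\<close> by simp
  next
    case (Suc i)
    then have "\<not> t \<le> T i" using not_less_Least[of i "\<lambda>j. t \<le> T j"] by simp
    then show ?thesis using that[of i] Suc k by auto
  qed
qed

text \<open>By induction the mass at node i is at most \<open>M + T i\<close>, hence at most M + 1,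
  which makes \<open>step_ok\<close> at mass M + 1 available at every node. A time between nodes is
  one more, possibly shorter, step from its left node; \<open>ok\<close> admits every \<tau> up to
  the mesh.\<close>

lemma flow_step_ok:
  fixes V W :: "'a::euclidean_space varifold"
  assumes T: "is_subdivision m T" and M: "0 \<le> M" and L: "0 \<le> L"
    and V: "is_varifold d V" "varifold_of_mass d M V" and W: "is_varifold d W" "varifold_of_mass d M W"
    and ok: "\<And>\<tau>. 0 \<le> \<tau> \<Longrightarrow> \<tau> \<le> mesh m T \<Longrightarrow> step_ok \<psi> d \<epsilon> (M + 1) L \<tau>"
  shows "flow_well_posed \<psi> d \<epsilon> m T M V"
    and "t \<in> {0..1} \<Longrightarrow> varifold_dist d (flow \<psi> d \<epsilon> T V t) (flow \<psi> d \<epsilon> T W t) \<le> exp (L * t) * varifold_dist d V W"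
proof -
  let ?F = "flow \<psi> d \<epsilon> T"
  have T0: "T 0 = 0" and Tm: "T m = 1" using T by (auto simp: is_subdivision_def)
  have Tb: "0 \<le> T i" "T i \<le> 1" if "i \<le> m" for i
    using subdivision_mono[OF T, of 0 i] subdivision_mono[OF T, of i m] that T0 Tm by auto
  have gap: "t - T i \<le> mesh m T" if "i < m" "t \<in> {T i..T (Suc i)}" for i t
  proof -
    have "T (Suc i) - T i \<le> mesh m T"
      unfolding mesh_def using that(1) by (intro Max_ge) auto
    then show ?thesis using that(2) by simp
  qed
  have ok': "step_ok \<psi> d \<epsilon> (M + 1) L (t - T i)" if "i < m" "t \<in> {T i..T (Suc i)}" for i t
    using ok[of "t - T i"] gap[OF that] that(2) by simp
  have stepmass: "varifold_of_mass d (M + t) (?F U t)"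
    if U: "is_varifold d U" and it: "i < m" "t \<in> {T i..T (Suc i)}" and IH: "varifold_of_mass d (M + T i) (?F U (T i))"
    for U i t
  proof -
    have "0 \<le> M + T i" "M + T i \<le> M + 1" using M Tb[of i] it(1) by auto
    then have "varifold_of_mass d (M + T i + (t - T i))
        (push_forward d (step_map \<psi> \<epsilon> (t - T i) (?F U (T i))) (?F U (T i)))"
      using ok'[OF it] IH unfolding step_ok_def by blast
    then show ?thesis using flow_eq(2)[OF U T it] by simp
  qed
  have node: "varifold_of_mass d (M + T i) (?F U (T i))"
    if U: "is_varifold d U" "varifold_of_mass d M U" and "i \<le> m" for U i
    using \<open>i \<le> m\<close>
  proof (induction i)
    case 0
    then show ?case using U(2) by (simp add: T0 flow_def)
  next
    case (Suc i)
    then show ?case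
      using stepmass[OF U(1), of i "T (Suc i)"] T by (auto simp: is_subdivision_def less_imp_le)
  qed
  have node1: "varifold_of_mass d (M + 1) (?F U (T i))"
    if U: "is_varifold d U" "varifold_of_mass d M U" and "i \<le> m" for U i
    by (rule varifold_of_mass_mono[OF node[OF U \<open>i \<le> m\<close>]]) (use Tb[OF \<open>i \<le> m\<close>] in simp)
  show "flow_well_posed \<psi> d \<epsilon> m T M V"
    unfolding flow_well_posed_def
  proof (intro conjI allI impI ballI)
    fix i t assume it: "i < m" "t \<in> {T i..T (Suc i)}"
    show "C1_diffeo (step_map \<psi> \<epsilon> (t - T i) (?F V (T i)))"
      using ok'[OF it] node1[OF V, of i] it(1) unfolding step_ok_def by simp
  next
    fix t :: real assume t: "t \<in> {0..1}"
    obtain i where i: "i < m" "t \<in> {T i..T (Suc i)}" by (rule subdivision_interval[OF T t])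
    have "varifold_of_mass d (M + 1) (?F V t)"
      by (rule varifold_of_mass_mono[OF stepmass[OF V(1) i node[OF V]]]) (use i t in auto)
    then show "emeasure (weight (?F V t)) UNIV \<le> ennreal (M + 1)"
      by (simp add: varifold_of_mass_def emeasure_weight_UNIV)
  qed
  let ?\<Delta> = "varifold_dist d V W"
  have \<Delta>: "0 \<le> ?\<Delta>" by (rule varifold_dist_nonneg[OF V(2) W(2) M M])
  have stepdist: "varifold_dist d (?F V t) (?F W t) \<le> exp (L * t) * ?\<Delta>"
    if it: "i < m" "t \<in> {T i..T (Suc i)}" and IH: "varifold_dist d (?F V (T i)) (?F W (T i)) \<le> exp (L * T i) * ?\<Delta>"
    for i t
  proof -
    have im: "i \<le> m" using it(1) by simp
    have "varifold_dist d (?F V t) (?F W t) \<le> (1 + L * (t - T i)) * varifold_dist d (?F V (T i)) (?F W (T i))"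
      using ok'[OF it] node1[OF V im] node1[OF W im]
      unfolding flow_eq(2)[OF V(1) T it] flow_eq(2)[OF W(1) T it] step_ok_def by blast
    \<comment> \<open>Through 1 + x \<le> exp x the factors of the steps multiply to
      \<open>exp (L * t)\<close>, whatever the subdivision.\<close>
    also have "\<dots> \<le> exp (L * (t - T i)) * (exp (L * T i) * ?\<Delta>)"
    proof (rule mult_mono[OF exp_ge_add_one_self IH])
      show "0 \<le> varifold_dist d (?F V (T i)) (?F W (T i))"
        using M by (intro varifold_dist_nonneg[OF node1[OF V im] node1[OF W im]]) auto
    qed simp
    also have "\<dots> = exp (L * t) * ?\<Delta>" by (simp add: algebra_simps flip: exp_add)
    finally show ?thesis .
  qed
  have nodedist: "varifold_dist d (?F V (T i)) (?F W (T i)) \<le> exp (L * T i) * ?\<Delta>" if "i \<le> m" for i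
    using that
  proof (induction i)
    case 0
    then show ?case by (simp add: T0 flow_def)
  next
    case (Suc i)
    then show ?case
      using stepdist[of i "T (Suc i)"] T by (auto simp: is_subdivision_def less_imp_le)
  qed
  assume t: "t \<in> {0..1}"
  obtain i where i: "i < m" "t \<in> {T i..T (Suc i)}" by (rule subdivision_interval[OF T t])
  show "varifold_dist d (?F V t) (?F W t) \<le> exp (L * t) * ?\<Delta>"
    by (rule stepdist[OF i nodedist]) (use i in simp)
qed

theorem proposition3p11:
  fixes \<psi> :: "real ^ 'n \<Rightarrow> real"
  assumes "CARD('n) \<ge> 2" and "is_cutoff \<psi>"
  shows "\<exists>c\<^sub>3 c\<^sub>5 :: real. c\<^sub>3 > 0 \<and> c\<^sub>5 > 0 \<and>
    (\<forall>(d::nat) (\<epsilon>::real) (M::real) (V\<^sub>0 :: (real ^ 'n) varifold) (W\<^sub>0 :: (real ^ 'n) varifold)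
        (m::nat) (T :: nat \<Rightarrow> real).
      1 \<le> d \<and> d \<le> CARD('n) \<and> 0 < \<epsilon> \<and> \<epsilon> < 1 \<and> 1 \<le> M \<and>
      is_varifold d V\<^sub>0 \<and> is_varifold d W\<^sub>0 \<and>
      emeasure (weight V\<^sub>0) UNIV \<le> ennreal M \<and> emeasure (weight W\<^sub>0) UNIV \<le> ennreal M \<and>
      is_subdivision m T \<and> c\<^sub>3 * mesh m T \<le> (M + 1) powi (-3) * \<epsilon> ^ 8 \<longrightarrow>
        flow_well_posed \<psi> d \<epsilon> m T M V\<^sub>0 \<and> flow_well_posed \<psi> d \<epsilon> m T M W\<^sub>0 \<and>
        (\<forall>t\<in>{0..1}.
          varifold_dist d (flow \<psi> d \<epsilon> T V\<^sub>0 t) (flow \<psi> d \<epsilon> T W\<^sub>0 t)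
            \<le> exp (c\<^sub>5 * (M + 1)\<^sup>2 * t * \<epsilon> powi (- int CARD('n) - 7)) * varifold_dist d V\<^sub>0 W\<^sub>0))"
proof -
  \<comment> \<open>Both constants are fixed before d, \<epsilon>, M and the varifolds; they depend
    on the dimension and the cutoff, which is itself fixed with the dimension.\<close>
  obtain c3 c5 where c: "0 < c3" "0 < c5"
    and step: "\<And>d \<epsilon> m \<tau>. 0 < \<epsilon> \<Longrightarrow> \<epsilon> < 1 \<Longrightarrow> 1 \<le> m \<Longrightarrow> 0 \<le> \<tau> \<Longrightarrow> c3 * \<tau> \<le> \<epsilon> ^ 8 / m ^ 3 \<Longrightarrow>
      step_ok \<psi> d \<epsilon> m (c5 * m\<^sup>2 / \<epsilon> ^ (CARD('n) + 7)) \<tau>"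
    using step_estimates[OF assms(2)] by auto
  have core: "flow_well_posed \<psi> d \<epsilon> m T M V \<and> flow_well_posed \<psi> d \<epsilon> m T M W \<and>
      (\<forall>t\<in>{0..1}. varifold_dist d (flow \<psi> d \<epsilon> T V t) (flow \<psi> d \<epsilon> T W t)
        \<le> exp (c5 * (M + 1)\<^sup>2 * t * \<epsilon> powi (- int CARD('n) - 7)) * varifold_dist d V W)"
    if H: "1 \<le> d \<and> d \<le> CARD('n) \<and> 0 < \<epsilon> \<and> \<epsilon> < 1 \<and> 1 \<le> M \<and>
      is_varifold d V \<and> is_varifold d W \<and>
      emeasure (weight V) UNIV \<le> ennreal M \<and> emeasure (weight W) UNIV \<le> ennreal M \<and>
      is_subdivision m T \<and> c3 * mesh m T \<le> (M + 1) powi (-3) * \<epsilon> ^ 8"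
    for d m :: nat and \<epsilon> M :: real and V W :: "(real ^ 'n) varifold" and T :: "nat \<Rightarrow> real"
  proof -
    from H have e: "0 < \<epsilon>" "\<epsilon> < 1" and M: "1 \<le> M" and V: "is_varifold d V" and W: "is_varifold d W"
      and T: "is_subdivision m T" by auto
    let ?L = "c5 * (M + 1)\<^sup>2 / \<epsilon> ^ (CARD('n) + 7)"
    have mass: "varifold_of_mass d M U"
      if "is_varifold d U" "emeasure (weight U) UNIV \<le> ennreal M" for U :: "(real ^ 'n) varifold"
      using that by (simp add: is_varifold_def radon_on_def varifold_of_mass_def emeasure_weight_UNIV)
    have mV: "varifold_of_mass d M V" and mW: "varifold_of_mass d M W" using mass H by auto
    have powi: "(M + 1) powi (-3) * \<epsilon> ^ 8 = \<epsilon> ^ 8 / (M + 1) ^ 3"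
      by (simp add: power_int_minus divide_inverse mult.commute)
    \<comment> \<open>Used at mass M + 1, the ceiling for all nodes; hence the powers of M + 1 in
      the step-size condition and in the exponent.\<close>
    have ok: "step_ok \<psi> d \<epsilon> (M + 1) ?L \<tau>" if "0 \<le> \<tau>" "\<tau> \<le> mesh m T" for \<tau>
    proof (rule step[OF e _ that(1)])
      have "c3 * \<tau> \<le> c3 * mesh m T" using that(2) c(1) by (intro mult_left_mono) auto
      then show "c3 * \<tau> \<le> \<epsilon> ^ 8 / (M + 1) ^ 3" using H powi by simp
    qed (use M in simp)
    have M0: "0 \<le> M" and L: "0 \<le> ?L" using M c(2) e by auto
    have expo: "?L * t = c5 * (M + 1)\<^sup>2 * t * \<epsilon> powi (- int CARD('n) - 7)" for t
    proof -
      have "- int CARD('n) - 7 = - int (CARD('n) + 7)" by simp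
      then have "\<epsilon> powi (- int CARD('n) - 7) = 1 / \<epsilon> ^ (CARD('n) + 7)"
        by (simp only: power_int_minus power_int_of_nat inverse_eq_divide)
      then show ?thesis by simp
    qed
    have "varifold_dist d (flow \<psi> d \<epsilon> T V t) (flow \<psi> d \<epsilon> T W t)
        \<le> exp (c5 * (M + 1)\<^sup>2 * t * \<epsilon> powi (- int CARD('n) - 7)) * varifold_dist d V W" if "t \<in> {0..1}" for t
      using flow_step_ok(2)[OF T M0 L V mV W mW ok that] unfolding expo by simp
    then show ?thesis
      using flow_step_ok(1)[OF T M0 L V mV W mW ok] flow_step_ok(1)[OF T M0 L W mW V mV ok] by blast
  qed
  show ?thesis
    by (intro exI[of _ c3] exI[of _ c5] conjI[OF c(1) conjI[OF c(2)]] allI impI) (rule core)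
qed

end
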